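(* The theory $V^0$ proves the following: Let $P$ be a sequence of edges in the $n\times n$ grid that form a closed curve, and suppose $P$ has no point on the border of the grid. Let $P'$ be the corresponding sequence of edges in the $(3n)\times(3n)$ grid. Let $p_1,p_2$ be any two points on different sides of $P'$. Then any point $p$ of the $(3n)\times(3n)$ grid that is not on $P'$ can be connected to $p_1$ or to $p_2$ by a sequence of edges that does not intersect $P'$.
   Context: Grid of size $N$: points $(x,y)$ with $0\le x,y\le N$; edges join points differing by exactly 1 in exactly one coordinate; the border consists of points with a coordinate equal to $0$ or $N$. A sequence of edges forms a closed curve if it is $\langle q_0,q_1\rangle,\ldots,\langle q_{t-1},q_0\rangle$, $t\ge4$, with the $q_i$ distinct. $P'$ is obtained from $P$ by tripling the grid density: each point $(x,y)$ becomes $(3x,3y)$ and each edge of $P$ is replaced by the corresponding three consecutive unit edges, in order. For a set/sequence $E$ of edges, the $E$-degree of a point is the number of edges of $E$ incident to it. Points $p_1,p_2$ are on different sides of $E$ if $x(p_1)=x(p_2)$, $|y(p_1)-y(p_2)|=2$, both have $E$-degree $0$, and the point with $x$-coordinate $x(p_1)$ and $y$-coordinate $\frac12(y(p_1)+y(p_2))$ has $E$-degree $2$. A sequence of edges connects $p$ to $q$ if it forms a path $\langle r_0,r_1\rangle,\ldots,\langle r_{s-1},r_s\rangle$ with $r_0=p$, $r_s=q$. Two sets of edges intersect if some point has positive degree in both. $V^0$ is the two-sorted theory (numbers and finite sets) over $0,1,+,\cdot,\le,=,|X|,\in$ axiomatized by 2-BASIC plus $\Sigma^B_0$-comprehension.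 *)

theory Defs
  imports Main
begin

section \<open>Two-sorted first-order logic over the vocabulary $0,1,+,\cdot,|\,|,=,\le,\in$\<close>

text \<open>
  Formulas are represented locally nameless: free variables of both sorts carry names, bound
  variables are de Bruijn indices, with a separate index space for each sort. Formulas are
  written with the name-binding operators defined below, so indices never show up in them.
\<close>

datatype stm = SV string | SB nat

datatype ntm =
    NV string | NB nat
  | Zero  (\<open>\<^bold>0\<close>)
  | One  (\<open>\<^bold>1\<close>)
  | Add ntm ntm  (infixl \<open>\<^bold>+\<close> 65)
  | Mul ntm ntm  (infixl \<open>\<^bold>*\<close> 70)
  | Len stm  (\<open>\<^bold>|_\<^bold>|\<close>)

datatype fm =
    Fls
  | EqN ntm ntm  (infix \<open>\<^bold>=\<close> 50)
  | EqS stm stm  (infix \<open>\<^bold>=\<^sub>S\<close> 50)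
  | Le ntm ntm  (infix \<open>\<^bold>\<le>\<close> 50)
  | Mem ntm stm  (infix \<open>\<^bold>\<in>\<close> 50)
  | Imp fm fm  (infixr \<open>\<^bold>\<longrightarrow>\<close> 25)
  | AllN fm
  | AllS fm

definition Neg :: "fm \<Rightarrow> fm"  (\<open>\<^bold>\<not> _\<close> [40] 40)
  where "(\<^bold>\<not> A) = (A \<^bold>\<longrightarrow> Fls)"

definition Or :: "fm \<Rightarrow> fm \<Rightarrow> fm"  (infixr \<open>\<^bold>\<or>\<close> 30)
  where "(A \<^bold>\<or> B) = (\<^bold>\<not> A \<^bold>\<longrightarrow> B)"

definition And :: "fm \<Rightarrow> fm \<Rightarrow> fm"  (infixr \<open>\<^bold>\<and>\<close> 35)
  where "(A \<^bold>\<and> B) = (\<^bold>\<not> (A \<^bold>\<longrightarrow> \<^bold>\<not> B))"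

definition Iff :: "fm \<Rightarrow> fm \<Rightarrow> fm"  (infixr \<open>\<^bold>\<longleftrightarrow>\<close> 25)
  where "(A \<^bold>\<longleftrightarrow> B) = ((A \<^bold>\<longrightarrow> B) \<^bold>\<and> (B \<^bold>\<longrightarrow> A))"

definition Lt :: "ntm \<Rightarrow> ntm \<Rightarrow> fm"  (infix \<open>\<^bold><\<close> 50)
  where "(t \<^bold>< u) = (t \<^bold>\<le> u \<^bold>\<and> \<^bold>\<not> t \<^bold>= u)"

subsection \<open>Free variables, opening and closing\<close>

primrec fvS_stm :: "stm \<Rightarrow> string set" where
  "fvS_stm (SV X) = {X}"
| "fvS_stm (SB k) = {}"

primrec fvN_ntm :: "ntm \<Rightarrow> string set" where
  "fvN_ntm (NV x) = {x}"
| "fvN_ntm (NB k) = {}"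
| "fvN_ntm \<^bold>0 = {}"
| "fvN_ntm \<^bold>1 = {}"
| "fvN_ntm (t \<^bold>+ u) = fvN_ntm t \<union> fvN_ntm u"
| "fvN_ntm (t \<^bold>* u) = fvN_ntm t \<union> fvN_ntm u"
| "fvN_ntm \<^bold>|X\<^bold>| = {}"

primrec fvS_ntm :: "ntm \<Rightarrow> string set" where
  "fvS_ntm (NV x) = {}"
| "fvS_ntm (NB k) = {}"
| "fvS_ntm \<^bold>0 = {}"
| "fvS_ntm \<^bold>1 = {}"
| "fvS_ntm (t \<^bold>+ u) = fvS_ntm t \<union> fvS_ntm u"
| "fvS_ntm (t \<^bold>* u) = fvS_ntm t \<union> fvS_ntm u"
| "fvS_ntm \<^bold>|X\<^bold>| = fvS_stm X"

primrec fvN :: "fm \<Rightarrow> string set" where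
  "fvN Fls = {}"
| "fvN (t \<^bold>= u) = fvN_ntm t \<union> fvN_ntm u"
| "fvN (X \<^bold>=\<^sub>S Y) = {}"
| "fvN (t \<^bold>\<le> u) = fvN_ntm t \<union> fvN_ntm u"
| "fvN (t \<^bold>\<in> X) = fvN_ntm t"
| "fvN (A \<^bold>\<longrightarrow> B) = fvN A \<union> fvN B"
| "fvN (AllN A) = fvN A"
| "fvN (AllS A) = fvN A"

primrec fvS :: "fm \<Rightarrow> string set" where
  "fvS Fls = {}"
| "fvS (t \<^bold>= u) = fvS_ntm t \<union> fvS_ntm u"
| "fvS (X \<^bold>=\<^sub>S Y) = fvS_stm X \<union> fvS_stm Y"
| "fvS (t \<^bold>\<le> u) = fvS_ntm t \<union> fvS_ntm u"
| "fvS (t \<^bold>\<in> X) = fvS_ntm t \<union> fvS_stm X"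
| "fvS (A \<^bold>\<longrightarrow> B) = fvS A \<union> fvS B"
| "fvS (AllN A) = fvS A"
| "fvS (AllS A) = fvS A"

text \<open>Locally closed terms: no dangling bound variable.\<close>

primrec lcS :: "stm \<Rightarrow> bool" where
  "lcS (SV X) = True"
| "lcS (SB k) = False"

primrec lcN :: "ntm \<Rightarrow> bool" where
  "lcN (NV x) = True"
| "lcN (NB k) = False"
| "lcN \<^bold>0 = True"
| "lcN \<^bold>1 = True"
| "lcN (t \<^bold>+ u) = (lcN t \<and> lcN u)"
| "lcN (t \<^bold>* u) = (lcN t \<and> lcN u)"
| "lcN \<^bold>|X\<^bold>| = lcS X"

text \<open>
  The four substitutions below are instances of mapping the number leaves or the set leaves of a
  formula; the index argument counts the binders of the respective sort passed on the way down.
\<close>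

primrec mapN_ntm :: "(ntm \<Rightarrow> ntm) \<Rightarrow> ntm \<Rightarrow> ntm" where
  "mapN_ntm f (NV x) = f (NV x)"
| "mapN_ntm f (NB k) = f (NB k)"
| "mapN_ntm f \<^bold>0 = \<^bold>0"
| "mapN_ntm f \<^bold>1 = \<^bold>1"
| "mapN_ntm f (t \<^bold>+ u) = mapN_ntm f t \<^bold>+ mapN_ntm f u"
| "mapN_ntm f (t \<^bold>* u) = mapN_ntm f t \<^bold>* mapN_ntm f u"
| "mapN_ntm f \<^bold>|X\<^bold>| = \<^bold>|X\<^bold>|"

primrec mapS_ntm :: "(stm \<Rightarrow> stm) \<Rightarrow> ntm \<Rightarrow> ntm" where
  "mapS_ntm f (NV x) = NV x"
| "mapS_ntm f (NB k) = NB k"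
| "mapS_ntm f \<^bold>0 = \<^bold>0"
| "mapS_ntm f \<^bold>1 = \<^bold>1"
| "mapS_ntm f (t \<^bold>+ u) = mapS_ntm f t \<^bold>+ mapS_ntm f u"
| "mapS_ntm f (t \<^bold>* u) = mapS_ntm f t \<^bold>* mapS_ntm f u"
| "mapS_ntm f \<^bold>|X\<^bold>| = \<^bold>|f X\<^bold>|"

primrec mapN :: "(nat \<Rightarrow> ntm \<Rightarrow> ntm) \<Rightarrow> nat \<Rightarrow> fm \<Rightarrow> fm" where
  "mapN f k Fls = Fls"
| "mapN f k (t \<^bold>= u) = (mapN_ntm (f k) t \<^bold>= mapN_ntm (f k) u)"
| "mapN f k (X \<^bold>=\<^sub>S Y) = (X \<^bold>=\<^sub>S Y)"
| "mapN f k (t \<^bold>\<le> u) = (mapN_ntm (f k) t \<^bold>\<le> mapN_ntm (f k) u)"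
| "mapN f k (t \<^bold>\<in> X) = (mapN_ntm (f k) t \<^bold>\<in> X)"
| "mapN f k (A \<^bold>\<longrightarrow> B) = (mapN f k A \<^bold>\<longrightarrow> mapN f k B)"
| "mapN f k (AllN A) = AllN (mapN f (Suc k) A)"
| "mapN f k (AllS A) = AllS (mapN f k A)"

primrec mapS :: "(nat \<Rightarrow> stm \<Rightarrow> stm) \<Rightarrow> nat \<Rightarrow> fm \<Rightarrow> fm" where
  "mapS f k Fls = Fls"
| "mapS f k (t \<^bold>= u) = (mapS_ntm (f k) t \<^bold>= mapS_ntm (f k) u)"
| "mapS f k (X \<^bold>=\<^sub>S Y) = (f k X \<^bold>=\<^sub>S f k Y)"
| "mapS f k (t \<^bold>\<le> u) = (mapS_ntm (f k) t \<^bold>\<le> mapS_ntm (f k) u)"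
| "mapS f k (t \<^bold>\<in> X) = (mapS_ntm (f k) t \<^bold>\<in> f k X)"
| "mapS f k (A \<^bold>\<longrightarrow> B) = (mapS f k A \<^bold>\<longrightarrow> mapS f k B)"
| "mapS f k (AllN A) = AllN (mapS f k A)"
| "mapS f k (AllS A) = AllS (mapS f (Suc k) A)"

definition openN :: "ntm \<Rightarrow> fm \<Rightarrow> fm"
  where "openN t = mapN (\<lambda>k v. if v = NB k then t else v) 0"

definition openS :: "stm \<Rightarrow> fm \<Rightarrow> fm"
  where "openS T = mapS (\<lambda>k v. if v = SB k then T else v) 0"

definition closeN :: "string \<Rightarrow> fm \<Rightarrow> fm"
  where "closeN x = mapN (\<lambda>k v. if v = NV x then NB k else v) 0"

definition closeS :: "string \<Rightarrow> fm \<Rightarrow> fm"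
  where "closeS X = mapS (\<lambda>k V. if V = SV X then SB k else V) 0"

subsection \<open>Quantifiers binding names\<close>

definition alln :: "string \<Rightarrow> fm \<Rightarrow> fm" where "alln x A = AllN (closeN x A)"
definition alls :: "string \<Rightarrow> fm \<Rightarrow> fm" where "alls X A = AllS (closeS X A)"
definition exn :: "string \<Rightarrow> fm \<Rightarrow> fm" where "exn x A = (\<^bold>\<not> alln x (\<^bold>\<not> A))"
definition exs :: "string \<Rightarrow> fm \<Rightarrow> fm" where "exs X A = (\<^bold>\<not> alls X (\<^bold>\<not> A))"

abbreviation ALLN :: "string list \<Rightarrow> fm \<Rightarrow> fm"  (\<open>(\<open>indent=2\<close>\<^bold>\<forall>\<^sub>N_./ _)\<close> [1000, 10] 10)
  where "\<^bold>\<forall>\<^sub>Nxs. A \<equiv> foldr alln xs A"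
abbreviation ALLS :: "string list \<Rightarrow> fm \<Rightarrow> fm"  (\<open>(\<open>indent=2\<close>\<^bold>\<forall>\<^sub>S_./ _)\<close> [1000, 10] 10)
  where "\<^bold>\<forall>\<^sub>SXs. A \<equiv> foldr alls Xs A"
abbreviation EXN :: "string list \<Rightarrow> fm \<Rightarrow> fm"  (\<open>(\<open>indent=2\<close>\<^bold>\<exists>\<^sub>N_./ _)\<close> [1000, 10] 10)
  where "\<^bold>\<exists>\<^sub>Nxs. A \<equiv> foldr exn xs A"
abbreviation EXS :: "string list \<Rightarrow> fm \<Rightarrow> fm"  (\<open>(\<open>indent=2\<close>\<^bold>\<exists>\<^sub>S_./ _)\<close> [1000, 10] 10)
  where "\<^bold>\<exists>\<^sub>SXs. A \<equiv> foldr exs Xs A"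

subsection \<open>Provability\<close>

text \<open>
  Classical natural deduction with equality on both sorts. The axioms in \<open>T\<close> are read as
  universally closed: their free variables do not restrict the eigenvariables, only those of the
  open assumptions \<open>G\<close> do.
\<close>

inductive deriv :: "fm set \<Rightarrow> fm set \<Rightarrow> fm \<Rightarrow> bool" for T :: "fm set" where
  Axiom: "A \<in> T \<Longrightarrow> deriv T G A"
| Assumption: "A \<in> G \<Longrightarrow> deriv T G A"
| ImpI: "deriv T (insert A G) B \<Longrightarrow> deriv T G (A \<^bold>\<longrightarrow> B)"
| ImpE: "deriv T G (A \<^bold>\<longrightarrow> B) \<Longrightarrow> deriv T G A \<Longrightarrow> deriv T G B"
| Classical: "deriv T (insert (\<^bold>\<not> A) G) Fls \<Longrightarrow> deriv T G A"
| AllNI: "deriv T G (openN (NV x) A) \<Longrightarrow> x \<notin> fvN A \<union> (\<Union>B\<in>G. fvN B) \<Longrightarrow> deriv T G (AllN A)"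
| AllNE: "deriv T G (AllN A) \<Longrightarrow> lcN t \<Longrightarrow> deriv T G (openN t A)"
| AllSI: "deriv T G (openS (SV X) A) \<Longrightarrow> X \<notin> fvS A \<union> (\<Union>B\<in>G. fvS B) \<Longrightarrow> deriv T G (AllS A)"
| AllSE: "deriv T G (AllS A) \<Longrightarrow> lcS U \<Longrightarrow> deriv T G (openS U A)"
| ReflN: "deriv T G (t \<^bold>= t)"
| ReflS: "deriv T G (X \<^bold>=\<^sub>S X)"
| SubstN: "deriv T G (t \<^bold>= u) \<Longrightarrow> lcN t \<Longrightarrow> lcN u \<Longrightarrow> deriv T G (openN t A) \<Longrightarrow> deriv T G (openN u A)"
| SubstS: "deriv T G (X \<^bold>=\<^sub>S Y) \<Longrightarrow> lcS X \<Longrightarrow> lcS Y \<Longrightarrow> deriv T G (openS X A) \<Longrightarrow> deriv T G (openS Y A)"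

definition proves :: "fm set \<Rightarrow> fm \<Rightarrow> bool"  (infix \<open>\<^bold>\<turnstile>\<close> 8)
  where "(T \<^bold>\<turnstile> A) = deriv T {} A"

section \<open>The theory $V^0$\<close>

definition two_BASIC :: "fm set" where
  "two_BASIC = (let x = NV ''x''; y = NV ''y''; X = SV ''X''; Y = SV ''Y'' in
   {\<^bold>\<not> x \<^bold>+ \<^bold>1 \<^bold>= \<^bold>0,
    x \<^bold>+ \<^bold>1 \<^bold>= y \<^bold>+ \<^bold>1 \<^bold>\<longrightarrow> x \<^bold>= y,
    x \<^bold>+ \<^bold>0 \<^bold>= x,
    x \<^bold>+ (y \<^bold>+ \<^bold>1) \<^bold>= (x \<^bold>+ y) \<^bold>+ \<^bold>1,
    x \<^bold>* \<^bold>0 \<^bold>= \<^bold>0,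
    x \<^bold>* (y \<^bold>+ \<^bold>1) \<^bold>= (x \<^bold>* y) \<^bold>+ x,
    x \<^bold>\<le> y \<^bold>\<and> y \<^bold>\<le> x \<^bold>\<longrightarrow> x \<^bold>= y,
    x \<^bold>\<le> x \<^bold>+ y,
    \<^bold>0 \<^bold>\<le> x,
    x \<^bold>\<le> y \<^bold>\<or> y \<^bold>\<le> x,
    x \<^bold>\<le> y \<^bold>\<longleftrightarrow> x \<^bold>< y \<^bold>+ \<^bold>1,
    \<^bold>\<not> x \<^bold>= \<^bold>0 \<^bold>\<longrightarrow> (\<^bold>\<exists>\<^sub>N[''y'']. y \<^bold>\<le> x \<^bold>\<and> y \<^bold>+ \<^bold>1 \<^bold>= x),
    y \<^bold>\<in> X \<^bold>\<longrightarrow> y \<^bold>< \<^bold>|X\<^bold>|,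
    y \<^bold>+ \<^bold>1 \<^bold>= \<^bold>|X\<^bold>| \<^bold>\<longrightarrow> y \<^bold>\<in> X,
    \<^bold>|X\<^bold>| \<^bold>= \<^bold>|Y\<^bold>| \<^bold>\<and> (\<^bold>\<forall>\<^sub>N[''x'']. x \<^bold>< \<^bold>|X\<^bold>| \<^bold>\<longrightarrow> (x \<^bold>\<in> X \<^bold>\<longleftrightarrow> x \<^bold>\<in> Y)) \<^bold>\<longrightarrow> X \<^bold>=\<^sub>S Y})"

text \<open>
  $\Sigma^B_0$: no set quantifiers, and all number quantifiers bounded by a term not containing the
  bound variable. The defined connectives are covered by \<^term>\<open>Fls\<close> and implication.
\<close>

inductive sigma0B :: "fm \<Rightarrow> bool" where
  "sigma0B Fls"
| "lcN t \<Longrightarrow> lcN u \<Longrightarrow> sigma0B (t \<^bold>= u)"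
| "lcS X \<Longrightarrow> lcS Y \<Longrightarrow> sigma0B (X \<^bold>=\<^sub>S Y)"
| "lcN t \<Longrightarrow> lcN u \<Longrightarrow> sigma0B (t \<^bold>\<le> u)"
| "lcN t \<Longrightarrow> lcS X \<Longrightarrow> sigma0B (t \<^bold>\<in> X)"
| "sigma0B A \<Longrightarrow> sigma0B B \<Longrightarrow> sigma0B (A \<^bold>\<longrightarrow> B)"
| "sigma0B A \<Longrightarrow> lcN t \<Longrightarrow> x \<notin> fvN_ntm t \<Longrightarrow> sigma0B (\<^bold>\<forall>\<^sub>N[x]. NV x \<^bold>\<le> t \<^bold>\<longrightarrow> A)"
| "sigma0B A \<Longrightarrow> lcN t \<Longrightarrow> x \<notin> fvN_ntm t \<Longrightarrow> sigma0B (\<^bold>\<exists>\<^sub>N[x]. NV x \<^bold>\<le> t \<^bold>\<and> A)"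

definition sigma0B_COMP :: "fm set" where
  "sigma0B_COMP =
    {\<^bold>\<exists>\<^sub>S[X]. \<^bold>|SV X\<^bold>| \<^bold>\<le> NV y \<^bold>\<and> (\<^bold>\<forall>\<^sub>N[z]. NV z \<^bold>< NV y \<^bold>\<longrightarrow> (NV z \<^bold>\<in> SV X \<^bold>\<longleftrightarrow> A)) | X y z A.
      y \<noteq> z \<and> sigma0B A \<and> X \<notin> fvS A}"

definition V0 :: "fm set"
  where "V0 = two_BASIC \<union> sigma0B_COMP"

section \<open>Grids and sequences of edges, in the language of $V^0$\<close>

text \<open>
  The formulas below are parametrized by terms; the names they bind start with an underscore, so
  that no capture occurs as long as the parameters avoid these names. Where one of the formulas
  occurs under quantifiers of another one, their bound names are disjoint.

  Points are pairs of number terms. They are coded by the pairing function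
  $\langle x,y\rangle = (x+y)(x+y+1)+2y$, and an edge by the pair of its end points, in the order
  in which a curve or path passes through them. A sequence of \<open>t\<close> points (edges) is coded by a set
  containing, for every $i<t$, exactly one number $\langle i,c\rangle$ such that \<open>c\<close> codes a
  point (an edge); other elements of the set are irrelevant.
\<close>

type_synonym pt = "ntm \<times> ntm"

definition pair :: "ntm \<Rightarrow> ntm \<Rightarrow> ntm"
  where "pair t u = (t \<^bold>+ u) \<^bold>* (t \<^bold>+ u \<^bold>+ \<^bold>1) \<^bold>+ (\<^bold>1 \<^bold>+ \<^bold>1) \<^bold>* u"

definition code :: "pt \<Rightarrow> ntm"
  where "code p = pair (fst p) (snd p)"

definition point_at :: "stm \<Rightarrow> ntm \<Rightarrow> pt \<Rightarrow> fm"
  where "point_at Q i p = (pair i (code p) \<^bold>\<in> Q)"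

definition edge_at :: "stm \<Rightarrow> ntm \<Rightarrow> pt \<Rightarrow> pt \<Rightarrow> fm"
  where "edge_at E i p q = (pair i (pair (code p) (code q)) \<^bold>\<in> E)"

definition Eq_pt :: "pt \<Rightarrow> pt \<Rightarrow> fm"  (infix \<open>\<^bold>=\<^sub>P\<close> 50)
  where "(p \<^bold>=\<^sub>P q) = (fst p \<^bold>= fst q \<^bold>\<and> snd p \<^bold>= snd q)"

definition in_grid :: "ntm \<Rightarrow> pt \<Rightarrow> fm"
  where "in_grid n p = (fst p \<^bold>\<le> n \<^bold>\<and> snd p \<^bold>\<le> n)"

definition on_border :: "ntm \<Rightarrow> pt \<Rightarrow> fm"
  where "on_border n p =
    (in_grid n p \<^bold>\<and> (fst p \<^bold>= \<^bold>0 \<^bold>\<or> fst p \<^bold>= n \<^bold>\<or> snd p \<^bold>= \<^bold>0 \<^bold>\<or> snd p \<^bold>= n))"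

definition adjacent :: "pt \<Rightarrow> pt \<Rightarrow> fm"
  where "adjacent p q =
    (fst p \<^bold>= fst q \<^bold>\<and> (snd p \<^bold>+ \<^bold>1 \<^bold>= snd q \<^bold>\<or> snd q \<^bold>+ \<^bold>1 \<^bold>= snd p) \<^bold>\<or>
     snd p \<^bold>= snd q \<^bold>\<and> (fst p \<^bold>+ \<^bold>1 \<^bold>= fst q \<^bold>\<or> fst q \<^bold>+ \<^bold>1 \<^bold>= fst p))"

text \<open>\<open>Q\<close> is a sequence of \<open>t\<close> points, \<open>E\<close> a sequence of \<open>t\<close> edges, in the grid of size \<open>n\<close>.\<close>

definition point_seq :: "ntm \<Rightarrow> ntm \<Rightarrow> stm \<Rightarrow> fm"
  where "point_seq n t Q =
   (let i = NV ''_i''; p = (NV ''_x'', NV ''_y''); p' = (NV ''_x1'', NV ''_y1'') in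
    \<^bold>\<forall>\<^sub>N[''_i'']. i \<^bold>< t \<^bold>\<longrightarrow>
      (\<^bold>\<exists>\<^sub>N[''_x'', ''_y'']. point_at Q i p \<^bold>\<and> in_grid n p \<^bold>\<and>
        (\<^bold>\<forall>\<^sub>N[''_x1'', ''_y1'']. point_at Q i p' \<^bold>\<longrightarrow> p' \<^bold>=\<^sub>P p)))"

definition edge_seq :: "ntm \<Rightarrow> ntm \<Rightarrow> stm \<Rightarrow> fm"
  where "edge_seq n t E =
   (let i = NV ''_i'';
        p = (NV ''_x'', NV ''_y''); q = (NV ''_u'', NV ''_v'');
        p' = (NV ''_x1'', NV ''_y1''); q' = (NV ''_u1'', NV ''_v1'') in
    \<^bold>\<forall>\<^sub>N[''_i'']. i \<^bold>< t \<^bold>\<longrightarrow>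
      (\<^bold>\<exists>\<^sub>N[''_x'', ''_y'', ''_u'', ''_v'']. edge_at E i p q \<^bold>\<and>
        in_grid n p \<^bold>\<and> in_grid n q \<^bold>\<and> adjacent p q \<^bold>\<and>
        (\<^bold>\<forall>\<^sub>N[''_x1'', ''_y1'', ''_u1'', ''_v1'']. edge_at E i p' q' \<^bold>\<longrightarrow> p' \<^bold>=\<^sub>P p \<^bold>\<and> q' \<^bold>=\<^sub>P q)))"

definition closed_curve :: "ntm \<Rightarrow> ntm \<Rightarrow> stm \<Rightarrow> fm"
  where "closed_curve n t E =
   (let i = NV ''_i''; j = NV ''_j''; Q = SV ''_Q'';
        p = (NV ''_x'', NV ''_y''); q = (NV ''_u'', NV ''_v'') in
    edge_seq n t E \<^bold>\<and> \<^bold>1 \<^bold>+ \<^bold>1 \<^bold>+ \<^bold>1 \<^bold>+ \<^bold>1 \<^bold>\<le> t \<^bold>\<and>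
    (\<^bold>\<exists>\<^sub>S[''_Q'']. point_seq n t Q \<^bold>\<and>
      (\<^bold>\<forall>\<^sub>N[''_i'', ''_j'', ''_x'', ''_y''].
        i \<^bold>< t \<^bold>\<and> j \<^bold>< t \<^bold>\<and> point_at Q i p \<^bold>\<and> point_at Q j p \<^bold>\<longrightarrow> i \<^bold>= j) \<^bold>\<and>
      (\<^bold>\<forall>\<^sub>N[''_i'', ''_x'', ''_y'', ''_u'', ''_v''].
        i \<^bold>+ \<^bold>1 \<^bold>< t \<^bold>\<and> point_at Q i p \<^bold>\<and> point_at Q (i \<^bold>+ \<^bold>1) q \<^bold>\<longrightarrow> edge_at E i p q) \<^bold>\<and>
      (\<^bold>\<forall>\<^sub>N[''_i'', ''_x'', ''_y'', ''_u'', ''_v''].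
        i \<^bold>+ \<^bold>1 \<^bold>= t \<^bold>\<and> point_at Q i p \<^bold>\<and> point_at Q \<^bold>0 q \<^bold>\<longrightarrow> edge_at E i p q)))"

text \<open>
  The sequence \<open>R\<close> of \<open>s\<close> edges connects \<open>a\<close> to \<open>b\<close>. Points may repeat along a path, and a point
  is connected to itself by the empty sequence.
\<close>

definition connects :: "ntm \<Rightarrow> ntm \<Rightarrow> stm \<Rightarrow> pt \<Rightarrow> pt \<Rightarrow> fm"
  where "connects n s R a b =
   (let i = NV ''_i''; Q = SV ''_Q'';
        p = (NV ''_x'', NV ''_y''); q = (NV ''_u'', NV ''_v'') in
    edge_seq n s R \<^bold>\<and>
    (\<^bold>\<exists>\<^sub>S[''_Q'']. point_seq n (s \<^bold>+ \<^bold>1) Q \<^bold>\<and> point_at Q \<^bold>0 a \<^bold>\<and> point_at Q s b \<^bold>\<and>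
      (\<^bold>\<forall>\<^sub>N[''_i'', ''_x'', ''_y'', ''_u'', ''_v''].
        i \<^bold>< s \<^bold>\<and> point_at Q i p \<^bold>\<and> point_at Q (i \<^bold>+ \<^bold>1) q \<^bold>\<longrightarrow> edge_at R i p q)))"

text \<open>The \<open>E\<close>-degree of a point is the number of indices $i<t$ whose edge is incident to it.\<close>

definition incident :: "stm \<Rightarrow> ntm \<Rightarrow> pt \<Rightarrow> fm"
  where "incident E i a =
   (let b = (NV ''_bx'', NV ''_by'') in
    \<^bold>\<exists>\<^sub>N[''_bx'', ''_by'']. edge_at E i a b \<^bold>\<or> edge_at E i b a)"

definition degree0 :: "ntm \<Rightarrow> stm \<Rightarrow> pt \<Rightarrow> fm"
  where "degree0 t E a =
   (let i = NV ''_i'' in \<^bold>\<forall>\<^sub>N[''_i'']. i \<^bold>< t \<^bold>\<longrightarrow> \<^bold>\<not> incident E i a)"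

definition degree2 :: "ntm \<Rightarrow> stm \<Rightarrow> pt \<Rightarrow> fm"
  where "degree2 t E a =
   (let i = NV ''_i''; j = NV ''_j''; k = NV ''_k'' in
    \<^bold>\<exists>\<^sub>N[''_i'', ''_j'']. i \<^bold>< t \<^bold>\<and> j \<^bold>< t \<^bold>\<and> \<^bold>\<not> i \<^bold>= j \<^bold>\<and> incident E i a \<^bold>\<and> incident E j a \<^bold>\<and>
      (\<^bold>\<forall>\<^sub>N[''_k'']. k \<^bold>< t \<^bold>\<and> incident E k a \<^bold>\<longrightarrow> k \<^bold>= i \<^bold>\<or> k \<^bold>= j))"

definition avoids_border :: "ntm \<Rightarrow> ntm \<Rightarrow> stm \<Rightarrow> fm"
  where "avoids_border n t E =
   (let p = (NV ''_x'', NV ''_y'') in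
    \<^bold>\<forall>\<^sub>N[''_x'', ''_y'']. on_border n p \<^bold>\<longrightarrow> degree0 t E p)"

definition different_sides :: "ntm \<Rightarrow> stm \<Rightarrow> pt \<Rightarrow> pt \<Rightarrow> fm"
  where "different_sides t E a b =
   (let m = NV ''_m'' in
    fst a \<^bold>= fst b \<^bold>\<and> (snd a \<^bold>+ (\<^bold>1 \<^bold>+ \<^bold>1) \<^bold>= snd b \<^bold>\<or> snd b \<^bold>+ (\<^bold>1 \<^bold>+ \<^bold>1) \<^bold>= snd a) \<^bold>\<and>
    degree0 t E a \<^bold>\<and> degree0 t E b \<^bold>\<and>
    (\<^bold>\<exists>\<^sub>N[''_m'']. (\<^bold>1 \<^bold>+ \<^bold>1) \<^bold>* m \<^bold>= snd a \<^bold>+ snd b \<^bold>\<and> degree2 t E (fst a, m)))"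

definition intersect :: "ntm \<Rightarrow> stm \<Rightarrow> ntm \<Rightarrow> stm \<Rightarrow> fm"
  where "intersect s R t E =
   (let p = (NV ''_x'', NV ''_y'') in
    \<^bold>\<exists>\<^sub>N[''_x'', ''_y'']. \<^bold>\<not> degree0 s R p \<^bold>\<and> \<^bold>\<not> degree0 t E p)"

abbreviation thrice :: "ntm \<Rightarrow> ntm"
  where "thrice t \<equiv> (\<^bold>1 \<^bold>+ \<^bold>1 \<^bold>+ \<^bold>1) \<^bold>* t"

text \<open>
  \<open>E'\<close> is the sequence of \<open>3t\<close> edges in the grid of size \<open>3n\<close> obtained from the sequence \<open>E\<close> of
  \<open>t\<close> edges in the grid of size \<open>n\<close>. For adjacent \<open>p\<close> and \<open>q\<close> the three unit edges from $3p$ to $3q$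
  pass through $2p+q$ and $p+2q$.
\<close>

definition tripled :: "ntm \<Rightarrow> ntm \<Rightarrow> stm \<Rightarrow> stm \<Rightarrow> fm"
  where "tripled n t E E' =
   (let i = NV ''_i''; x = NV ''_x''; y = NV ''_y''; u = NV ''_u''; v = NV ''_v'' in
    edge_seq (thrice n) (thrice t) E' \<^bold>\<and>
    (\<^bold>\<forall>\<^sub>N[''_i'', ''_x'', ''_y'', ''_u'', ''_v'']. i \<^bold>< t \<^bold>\<and> edge_at E i (x, y) (u, v) \<^bold>\<longrightarrow>
      edge_at E' (thrice i)
        (thrice x, thrice y) (x \<^bold>+ x \<^bold>+ u, y \<^bold>+ y \<^bold>+ v) \<^bold>\<and>
      edge_at E' (thrice i \<^bold>+ \<^bold>1)
        (x \<^bold>+ x \<^bold>+ u, y \<^bold>+ y \<^bold>+ v) (x \<^bold>+ u \<^bold>+ u, y \<^bold>+ v \<^bold>+ v) \<^bold>\<and>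
      edge_at E' (thrice i \<^bold>+ (\<^bold>1 \<^bold>+ \<^bold>1))
        (x \<^bold>+ u \<^bold>+ u, y \<^bold>+ v \<^bold>+ v) (thrice u, thrice v)))"

end

(*
  By completeness of the calculus it suffices to verify the theorem in every countable model of V0,
  where it can be argued as in the integers, as long as induction and comprehension are used for
  Sigma^B_0 relations only. Along a tripled curve there are two parallel paths, one on either side,
  which stay off the curve and whose i-th segment is Sigma^B_0-definable from the i-th edge of P.
  Every point adjacent to the curve is one or two steps away from one of these paths, and p1 and p2
  belong to different ones. Walking from p on an L-shaped route towards p1 one either arrives or
  gets stuck next to the curve, at a point on the side of p1 or of p2.
*)
theory Submission
  imports Defs "HOL-Library.Countable" "HOL-Library.Nat_Bijection"
begin

section \<open>Structures and satisfaction\<close>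

text \<open>The obstacle that shapes the proof: being connected is an existential statement about
  sets, so V^0 has no induction for it, and in a model the curve may have nonstandard length.
  Concatenation of paths may thus be iterated only a fixed number of times, and a path along the
  whole curve must be given at one stroke by a Sigma^B_0 graph. This works because every edge
  contributes a segment of the same length, so that division recovers edge and offset from an index.
  Paths are therefore kept as HOL functions with definable graphs; sets coding them are formed by
  comprehension at the very end. The tripling makes room: a point of the curve has a coordinate
  divisible by 3, so all diagonal neighbours of tripled vertices are off the curve. Type classes
  need a type and not a model fixed within a proof, hence one model is chosen once and for all. Its
  numbers are extended to an ordered ring to have subtraction, which the language lacks;
  definability then has to be regained for expressions with negative values.\<close>

record ('a, 'b) struc =
  DN :: "'a set"
  DS :: "'b set"
  zer :: 'a
  one :: 'a
  add :: "'a \<Rightarrow> 'a \<Rightarrow> 'a"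
  mul :: "'a \<Rightarrow> 'a \<Rightarrow> 'a"
  leq :: "'a \<Rightarrow> 'a \<Rightarrow> bool"
  len :: "'b \<Rightarrow> 'a"
  mem :: "'a \<Rightarrow> 'b \<Rightarrow> bool"

text \<open>Nonemptiness has to be demanded for the set sort alone: \<open>zer\<close> inhabits the
  number sort.\<close>

definition struc_ok :: "('a, 'b) struc \<Rightarrow> bool" where
  "struc_ok M \<longleftrightarrow> zer M \<in> DN M \<and> one M \<in> DN M \<and> DS M \<noteq> {} \<and>
    (\<forall>a\<in>DN M. \<forall>b\<in>DN M. add M a b \<in> DN M \<and> mul M a b \<in> DN M) \<and> (\<forall>X\<in>DS M. len M X \<in> DN M)"

primrec evS :: "(string \<Rightarrow> 'b) \<Rightarrow> (nat \<Rightarrow> 'b) \<Rightarrow> stm \<Rightarrow> 'b" where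
  "evS es bs (SV X) = es X"
| "evS es bs (SB k) = bs k"

primrec evN :: "('a, 'b) struc \<Rightarrow> (string \<Rightarrow> 'a) \<Rightarrow> (string \<Rightarrow> 'b) \<Rightarrow> (nat \<Rightarrow> 'a) \<Rightarrow> (nat \<Rightarrow> 'b) \<Rightarrow> ntm \<Rightarrow> 'a"
where
  "evN M e es bn bs (NV x) = e x"
| "evN M e es bn bs (NB k) = bn k"
| "evN M e es bn bs \<^bold>0 = zer M"
| "evN M e es bn bs \<^bold>1 = one M"
| "evN M e es bn bs (t \<^bold>+ u) = add M (evN M e es bn bs t) (evN M e es bn bs u)"
| "evN M e es bn bs (t \<^bold>* u) = mul M (evN M e es bn bs t) (evN M e es bn bs u)"
| "evN M e es bn bs \<^bold>|X\<^bold>| = len M (evS es bs X)"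

primrec sat :: "('a, 'b) struc \<Rightarrow> (string \<Rightarrow> 'a) \<Rightarrow> (string \<Rightarrow> 'b) \<Rightarrow> (nat \<Rightarrow> 'a) \<Rightarrow> (nat \<Rightarrow> 'b) \<Rightarrow> fm \<Rightarrow> bool"
where
  "sat M e es bn bs Fls = False"
| "sat M e es bn bs (t \<^bold>= u) = (evN M e es bn bs t = evN M e es bn bs u)"
| "sat M e es bn bs (X \<^bold>=\<^sub>S Y) = (evS es bs X = evS es bs Y)"
| "sat M e es bn bs (t \<^bold>\<le> u) = leq M (evN M e es bn bs t) (evN M e es bn bs u)"
| "sat M e es bn bs (t \<^bold>\<in> X) = mem M (evN M e es bn bs t) (evS es bs X)"
| "sat M e es bn bs (A \<^bold>\<longrightarrow> B) = (sat M e es bn bs A \<longrightarrow> sat M e es bn bs B)"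
| "sat M e es bn bs (AllN A) = (\<forall>d\<in>DN M. sat M e es (case_nat d bn) bs A)"
| "sat M e es bn bs (AllS A) = (\<forall>d\<in>DS M. sat M e es bn (case_nat d bs) A)"

lemma sat_connectives [simp]:
  "sat M e es bn bs (\<^bold>\<not> A) \<longleftrightarrow> \<not> sat M e es bn bs A"
  "sat M e es bn bs (A \<^bold>\<or> B) \<longleftrightarrow> sat M e es bn bs A \<or> sat M e es bn bs B"
  "sat M e es bn bs (A \<^bold>\<and> B) \<longleftrightarrow> sat M e es bn bs A \<and> sat M e es bn bs B"
  "sat M e es bn bs (A \<^bold>\<longleftrightarrow> B) \<longleftrightarrow> (sat M e es bn bs A \<longleftrightarrow> sat M e es bn bs B)"
  "sat M e es bn bs (t \<^bold>< u) \<longleftrightarrow>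
     leq M (evN M e es bn bs t) (evN M e es bn bs u) \<and> evN M e es bn bs t \<noteq> evN M e es bn bs u"
  by (auto simp: Neg_def Or_def And_def Iff_def Lt_def)

section \<open>Evaluation under opening and closing\<close>

lemma case_nat_upd: "(case_nat d b)(Suc k := v) = case_nat d (b(k := v))"
  by (auto simp: fun_eq_iff split: nat.split)

lemma evN_mapN_close:
  "evN M e es bn bs (mapN_ntm (\<lambda>v. if v = NV x then NB k else v) t) = evN M (e(x := bn k)) es bn bs t"
  by (induction t) auto

lemma evS_close: "evS es bs (if V = SV X then SB k else V) = evS (es(X := bs k)) bs V"
  by (cases V) auto

lemma evN_mapS_close:
  "evN M e es bn bs (mapS_ntm (\<lambda>V. if V = SV X then SB k else V) t) = evN M e (es(X := bs k)) bn bs t"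
  proof (induction t)
  case (Len V) show ?case by (simp only: evN.simps mapS_ntm.simps evS_close)
qed simp_all

lemma sat_mapN_close:
  "sat M e es bn bs (mapN (\<lambda>k v. if v = NV x then NB k else v) k A) = sat M (e(x := bn k)) es bn bs A"
  by (induction A arbitrary: bn bs k) (auto simp: evN_mapN_close)

lemma sat_mapS_close:
  "sat M e es bn bs (mapS (\<lambda>k V. if V = SV X then SB k else V) k A) = sat M e (es(X := bs k)) bn bs A"
  by (induction A arbitrary: bn bs k) (simp_all add: evN_mapS_close evS_close split del: if_split)

text \<open>Closing turns a name into an index without shifting the other indices, so the value
  appears twice: as the value of the name and on top of the stack. For locally closed
  \<open>A\<close> the stack is irrelevant by \<open>sat_cong\<close>.\<close>

lemma sat_quantifiers [simp]:
  "sat M e es bn bs (alln x A) \<longleftrightarrow> (\<forall>d\<in>DN M. sat M (e(x := d)) es (case_nat d bn) bs A)"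
  "sat M e es bn bs (alls X A) \<longleftrightarrow> (\<forall>d\<in>DS M. sat M e (es(X := d)) bn (case_nat d bs) A)"
  "sat M e es bn bs (exn x A) \<longleftrightarrow> (\<exists>d\<in>DN M. sat M (e(x := d)) es (case_nat d bn) bs A)"
  "sat M e es bn bs (exs X A) \<longleftrightarrow> (\<exists>d\<in>DS M. sat M e (es(X := d)) bn (case_nat d bs) A)"
  by (simp_all add: alln_def alls_def exn_def exs_def closeN_def closeS_def sat_mapN_close sat_mapS_close)

lemma evN_mapN_open:
  assumes "evN M e es bn bs s = v"
  shows "evN M e es bn bs (mapN_ntm (\<lambda>v. if v = NB k then s else v) t) = evN M e es (bn(k := v)) bs t"
  using assms by (induction t) auto

lemma evS_open:
  "evS es bs U = v \<Longrightarrow> evS es bs (if V = SB k then U else V) = evS es (bs(k := v)) V"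
  by (cases V) auto

lemma evN_mapS_open:
  assumes "evS es bs U = v"
  shows "evN M e es bn bs (mapS_ntm (\<lambda>V. if V = SB k then U else V) t) = evN M e es bn (bs(k := v)) t"
  proof (induction t)
  case (Len V) show ?case by (simp only: evN.simps mapS_ntm.simps evS_open[OF assms])
qed simp_all

lemma evN_lc: "lcN s \<Longrightarrow> evN M e es bn bs s = evN M e es bn' bs' s"
proof (induction s)
  case (Len X) then show ?case by (cases X) auto
qed auto

text \<open>The stacks grow on the way down; local closedness of \<open>s\<close> makes its value
  independent of them, so one \<open>v\<close> serves at every depth.\<close>

lemma sat_mapN_open:
  assumes "lcN s" "\<And>bn bs. evN M e es bn bs s = v"
  shows "sat M e es bn bs (mapN (\<lambda>k v. if v = NB k then s else v) k A) = sat M e es (bn(k := v)) bs A"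
proof (induction A arbitrary: bn bs k)
  case (AllN A) then show ?case by (simp add: case_nat_upd del: fun_upd_apply)
qed (simp_all add: evN_mapN_open[OF assms(2)])

lemma sat_mapS_open:
  assumes "lcS U" "\<And>bs. evS es bs U = v"
  shows "sat M e es bn bs (mapS (\<lambda>k v. if v = SB k then U else v) k A) = sat M e es bn (bs(k := v)) A"
proof (induction A arbitrary: bn bs k)
  case (AllS A) then show ?case by (simp add: case_nat_upd del: fun_upd_apply)
qed (simp_all add: evN_mapS_open[OF assms(2)] evS_open[OF assms(2)] del: fun_upd_apply split del: if_split)

subsection \<open>Closedness levels and coincidence\<close>

primrec lvS :: "nat \<Rightarrow> stm \<Rightarrow> bool" where
  "lvS j (SV X) = True"
| "lvS j (SB k) = (k < j)"

primrec lvN :: "nat \<Rightarrow> nat \<Rightarrow> ntm \<Rightarrow> bool" where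
  "lvN i j (NV x) = True"
| "lvN i j (NB k) = (k < i)"
| "lvN i j \<^bold>0 = True"
| "lvN i j \<^bold>1 = True"
| "lvN i j (t \<^bold>+ u) = (lvN i j t \<and> lvN i j u)"
| "lvN i j (t \<^bold>* u) = (lvN i j t \<and> lvN i j u)"
| "lvN i j \<^bold>|X\<^bold>| = lvS j X"

text \<open>\<open>lv i j A\<close>: the dangling indices of \<open>A\<close> are below \<open>i\<close> (numbers) and \<open>j\<close> (sets).\<close>

primrec lv :: "nat \<Rightarrow> nat \<Rightarrow> fm \<Rightarrow> bool" where
  "lv i j Fls = True"
| "lv i j (t \<^bold>= u) = (lvN i j t \<and> lvN i j u)"
| "lv i j (X \<^bold>=\<^sub>S Y) = (lvS j X \<and> lvS j Y)"
| "lv i j (t \<^bold>\<le> u) = (lvN i j t \<and> lvN i j u)"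
| "lv i j (t \<^bold>\<in> X) = (lvN i j t \<and> lvS j X)"
| "lv i j (A \<^bold>\<longrightarrow> B) = (lv i j A \<and> lv i j B)"
| "lv i j (AllN A) = lv (Suc i) j A"
| "lv i j (AllS A) = lv i (Suc j) A"

lemma lvS_0 [simp]: "lvS 0 X = lcS X" by (cases X) auto
lemma lvN_0 [simp]: "lvN 0 0 t = lcN t" by (induction t) auto

lemma evS_cong:
  "lvS j X \<Longrightarrow> (\<And>x. x \<in> fvS_stm X \<Longrightarrow> es x = es' x) \<Longrightarrow> (\<And>k. k < j \<Longrightarrow> bs k = bs' k) \<Longrightarrow> evS es bs X = evS es' bs' X"
  by (cases X) auto

lemma evN_cong:
  "lvN i j t \<Longrightarrow> (\<And>x. x \<in> fvN_ntm t \<Longrightarrow> e x = e' x) \<Longrightarrow> (\<And>x. x \<in> fvS_ntm t \<Longrightarrow> es x = es' x) \<Longrightarrow>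
   (\<And>k. k < i \<Longrightarrow> bn k = bn' k) \<Longrightarrow> (\<And>k. k < j \<Longrightarrow> bs k = bs' k) \<Longrightarrow> evN M e es bn bs t = evN M e' es' bn' bs' t"
proof (induction t)
  case (Len X)
  then have "evS es bs X = evS es' bs' X" by (intro evS_cong) auto
  then show ?case by simp
qed auto

text \<open>Coincidence lemma. The levels vary in the induction because a quantifier raises the
  number of indices on which the stacks must agree; the entry it pushes is the same on both
  sides.\<close>

lemma sat_cong:
  "lv i j A \<Longrightarrow> (\<And>x. x \<in> fvN A \<Longrightarrow> e x = e' x) \<Longrightarrow> (\<And>x. x \<in> fvS A \<Longrightarrow> es x = es' x) \<Longrightarrow>
   (\<And>k. k < i \<Longrightarrow> bn k = bn' k) \<Longrightarrow> (\<And>k. k < j \<Longrightarrow> bs k = bs' k) \<Longrightarrow> sat M e es bn bs A = sat M e' es' bn' bs' A"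
proof (induction A arbitrary: i j bn bs bn' bs')
  case (EqN t u)
  then have "evN M e es bn bs t = evN M e' es' bn' bs' t" "evN M e es bn bs u = evN M e' es' bn' bs' u"
    by (auto intro!: evN_cong)
  then show ?case by simp
next
  case (EqS X Y)
  then have "evS es bs X = evS es' bs' X" "evS es bs Y = evS es' bs' Y"
    by (auto intro!: evS_cong)
  then show ?case by simp
next
  case (Le t u)
  then have "evN M e es bn bs t = evN M e' es' bn' bs' t" "evN M e es bn bs u = evN M e' es' bn' bs' u"
    by (auto intro!: evN_cong)
  then show ?case by simp
next
  case (Mem t X)
  then have "evN M e es bn bs t = evN M e' es' bn' bs' t" "evS es bs X = evS es' bs' X"
    by (auto intro!: evN_cong evS_cong)
  then show ?case by simp
next
  case (Imp A B)
  have "sat M e es bn bs A = sat M e' es' bn' bs' A" "sat M e es bn bs B = sat M e' es' bn' bs' B"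
    using Imp.prems by (intro Imp.IH[of i j]; simp)+
  then show ?case by simp
next
  case (AllN A)
  have "sat M e es (case_nat d bn) bs A = sat M e' es' (case_nat d bn') bs' A" for d
    using AllN.prems by (intro AllN.IH[of "Suc i" j]) (auto split: nat.split)
  then show ?case by simp
next
  case (AllS A)
  have "sat M e es bn (case_nat d bs) A = sat M e' es' bn' (case_nat d bs') A" for d
    using AllS.prems by (intro AllS.IH[of i "Suc j"]) (auto split: nat.split)
  then show ?case by simp
qed simp

lemma lvN_mapN_close: "lvN i j t \<Longrightarrow> i \<le> k \<Longrightarrow> lvN (Suc k) j (mapN_ntm (\<lambda>v. if v = NV x then NB k else v) t)"
  by (induction t) auto

lemma lvS_close: "lvS j V \<Longrightarrow> j \<le> k \<Longrightarrow> lvS (Suc k) (if V = SV X then SB k else V)"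
  by (cases V) auto

lemma lvN_mapS_close: "lvN i j t \<Longrightarrow> lvN i (Suc j) (mapS_ntm (\<lambda>v. if v = SV x then SB j else v) t)"
  by (induction t) (simp_all add: lvS_close[OF _ order_refl] split del: if_split)

text \<open>The new index equals the old level, hence clashes with none of the old ones, and raises
  the level by one.\<close>

lemma lv_closeN: "lv i j A \<Longrightarrow> lv (Suc i) j (mapN (\<lambda>k v. if v = NV x then NB k else v) i A)"
  by (induction A arbitrary: i j) (auto simp: lvN_mapN_close)

lemma lv_closeS: "lv i j A \<Longrightarrow> lv i (Suc j) (mapS (\<lambda>k v. if v = SV x then SB k else v) j A)"
  by (induction A arbitrary: i j) (simp_all add: lvN_mapS_close lvS_close[OF _ order_refl] split del: if_split)

lemma lv_intros [simp]:
  "lv i j (\<^bold>\<not> A) \<longleftrightarrow> lv i j A"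
  "lv i j (A \<^bold>\<or> B) \<longleftrightarrow> lv i j A \<and> lv i j B"
  "lv i j (A \<^bold>\<and> B) \<longleftrightarrow> lv i j A \<and> lv i j B"
  "lv i j (A \<^bold>\<longleftrightarrow> B) \<longleftrightarrow> lv i j A \<and> lv i j B"
  "lv i j (t \<^bold>< u) \<longleftrightarrow> lvN i j t \<and> lvN i j u"
  "lv 0 0 A \<Longrightarrow> lv 0 0 (alln x A)"
  "lv 0 0 A \<Longrightarrow> lv 0 0 (exn x A)"
  "lv 0 0 A \<Longrightarrow> lv 0 0 (alls X A)"
  "lv 0 0 A \<Longrightarrow> lv 0 0 (exs X A)"
  by (auto simp: Neg_def Or_def And_def Iff_def Lt_def alln_def exn_def alls_def exs_def closeN_def closeS_def
    lv_closeN lv_closeS)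

lemma sigma0B_lv: "sigma0B A \<Longrightarrow> lv 0 0 A"
  by (induction rule: sigma0B.induct) simp_all

lemma lvN_mapN_open:
  "lvN (Suc i) j t \<Longrightarrow> lvN i j s \<Longrightarrow> lvN i j (mapN_ntm (\<lambda>v. if v = NB i then s else v) t)"
  by (induction t) auto

lemma lvS_open: "lvS (Suc j) V \<Longrightarrow> lvS j U \<Longrightarrow> lvS j (if V = SB j then U else V)"
  by (cases V) auto

lemma lvN_mapS_open:
  "lvN i (Suc j) t \<Longrightarrow> lvS j U \<Longrightarrow> lvN i j (mapS_ntm (\<lambda>v. if v = SB j then U else v) t)"
  by (induction t) (simp_all add: lvS_open split del: if_split)

lemma lvS_lc: "lcS U \<Longrightarrow> lvS j U" by (cases U) auto
lemma lvN_lc: "lcN t \<Longrightarrow> lvN i j t" by (induction t) (auto simp: lvS_lc)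

lemma lv_openN:
  assumes "lcN s"
  shows "lv (Suc i) j A \<Longrightarrow> lv i j (mapN (\<lambda>k v. if v = NB k then s else v) i A)"
  by (induction A arbitrary: i j) (auto simp: lvN_mapN_open assms lvN_lc)

lemma lv_openS:
  assumes "lcS U"
  shows "lv i (Suc j) A \<Longrightarrow> lv i j (mapS (\<lambda>k v. if v = SB k then U else v) j A)"
  by (induction A arbitrary: i j) (simp_all add: lvN_mapS_open lvS_open assms lvS_lc split del: if_split)

section \<open>Completeness\<close>

instance stm :: countable by countable_datatype
instance ntm :: countable by countable_datatype
instance fm :: countable by countable_datatype

subsection \<open>Renaming and weakening\<close>

primrec renS :: "(string \<Rightarrow> string) \<Rightarrow> stm \<Rightarrow> stm" where
  "renS g (SV X) = SV (g X)"
| "renS g (SB k) = SB k"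

primrec renN :: "(string \<Rightarrow> string) \<Rightarrow> (string \<Rightarrow> string) \<Rightarrow> ntm \<Rightarrow> ntm" where
  "renN f g (NV x) = NV (f x)"
| "renN f g (NB k) = NB k"
| "renN f g \<^bold>0 = \<^bold>0"
| "renN f g \<^bold>1 = \<^bold>1"
| "renN f g (t \<^bold>+ u) = renN f g t \<^bold>+ renN f g u"
| "renN f g (t \<^bold>* u) = renN f g t \<^bold>* renN f g u"
| "renN f g \<^bold>|X\<^bold>| = \<^bold>|renS g X\<^bold>|"

primrec ren :: "(string \<Rightarrow> string) \<Rightarrow> (string \<Rightarrow> string) \<Rightarrow> fm \<Rightarrow> fm" where
  "ren f g Fls = Fls"
| "ren f g (t \<^bold>= u) = (renN f g t \<^bold>= renN f g u)"
| "ren f g (X \<^bold>=\<^sub>S Y) = (renS g X \<^bold>=\<^sub>S renS g Y)"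
| "ren f g (t \<^bold>\<le> u) = (renN f g t \<^bold>\<le> renN f g u)"
| "ren f g (t \<^bold>\<in> X) = (renN f g t \<^bold>\<in> renS g X)"
| "ren f g (A \<^bold>\<longrightarrow> B) = (ren f g A \<^bold>\<longrightarrow> ren f g B)"
| "ren f g (AllN A) = AllN (ren f g A)"
| "ren f g (AllS A) = AllS (ren f g A)"

lemma ren_Neg [simp]: "ren f g (\<^bold>\<not> A) = (\<^bold>\<not> ren f g A)"
  by (simp add: Neg_def)

lemma lcS_renS [simp]: "lcS (renS g X) = lcS X" by (cases X) auto
lemma lcN_renN [simp]: "lcN (renN f g t) = lcN t" by (induction t) auto

lemma renS_id [simp]: "renS (\<lambda>x. x) X = X" by (cases X) auto
lemma renN_id [simp]: "renN (\<lambda>x. x) (\<lambda>x. x) t = t" by (induction t) auto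
lemma ren_id [simp]: "ren (\<lambda>x. x) (\<lambda>x. x) A = A" by (induction A) auto

lemma renS_cong: "(\<And>x. x \<in> fvS_stm X \<Longrightarrow> g x = g' x) \<Longrightarrow> renS g X = renS g' X"
  by (cases X) auto
lemma renN_cong:
  "(\<And>x. x \<in> fvN_ntm t \<Longrightarrow> f x = f' x) \<Longrightarrow> (\<And>x. x \<in> fvS_ntm t \<Longrightarrow> g x = g' x) \<Longrightarrow> renN f g t = renN f' g' t"
  by (induction t) (auto intro: renS_cong)
lemma ren_cong:
  "(\<And>x. x \<in> fvN A \<Longrightarrow> f x = f' x) \<Longrightarrow> (\<And>x. x \<in> fvS A \<Longrightarrow> g x = g' x) \<Longrightarrow> ren f g A = ren f' g' A"
  by (induction A) (auto intro: renS_cong renN_cong)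

lemma renN_mapN_open:
  "renN f g (mapN_ntm (\<lambda>v. if v = NB k then t else v) u) =
   mapN_ntm (\<lambda>v. if v = NB k then renN f g t else v) (renN f g u)"
  by (induction u) auto
lemma renS_open: "renS g (if V = SB k then U else V) = (if renS g V = SB k then renS g U else renS g V)"
  by (cases V) auto
lemma renN_mapS_open:
  "renN f g (mapS_ntm (\<lambda>v. if v = SB k then U else v) u) =
   mapS_ntm (\<lambda>v. if v = SB k then renS g U else v) (renN f g u)"
proof (induction u)
  case (Len V) show ?case by (simp only: mapS_ntm.simps renN.simps renS_open)
qed auto

lemma ren_openN: "ren f g (openN t A) = openN (renN f g t) (ren f g A)"
proof -
  have "ren f g (mapN (\<lambda>k v. if v = NB k then t else v) k A) =
    mapN (\<lambda>k v. if v = NB k then renN f g t else v) k (ren f g A)" for k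
    by (induction A arbitrary: k) (auto simp: renN_mapN_open)
  then show ?thesis by (simp add: openN_def)
qed

lemma ren_openS: "ren f g (openS U A) = openS (renS g U) (ren f g A)"
proof -
  have "ren f g (mapS (\<lambda>k v. if v = SB k then U else v) k A) =
    mapS (\<lambda>k v. if v = SB k then renS g U else v) k (ren f g A)" for k
    by (induction A arbitrary: k) (simp_all add: renN_mapS_open renS_open split del: if_split)
  then show ?thesis by (simp add: openS_def)
qed

lemma finite_fvS_stm [simp]: "finite (fvS_stm X)" by (cases X) auto
lemma finite_fvN_ntm [simp]: "finite (fvN_ntm t)" by (induction t) auto
lemma finite_fvS_ntm [simp]: "finite (fvS_ntm t)" by (induction t) auto
lemma finite_fvN [simp]: "finite (fvN A)" by (induction A) auto
lemma finite_fvS [simp]: "finite (fvS A)" by (induction A) auto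

lemma fresh_string: "finite (S :: string set) \<Longrightarrow> \<exists>x. x \<notin> S"
  using ex_new_if_finite infinite_UNIV_listI by blast

text \<open>
  Weakening has to rename eigenvariables, which is only possible without axioms: from an axiom
  \<open>A(x)\<close> one cannot derive \<open>A(y)\<close> under an assumption in which \<open>x\<close> is free. The completeness proof
  therefore uses universal closures of the axioms as assumptions.
\<close>

lemma deriv_ren:
  "deriv {} G A \<Longrightarrow> finite H \<Longrightarrow> ren f g ` G \<subseteq> H \<Longrightarrow> deriv {} H (ren f g A)"
proof (induction arbitrary: f g H rule: deriv.induct)
  case (Assumption A G)
  then show ?case by (auto intro: deriv.Assumption)
next
  case (ImpI A G B)
  have "deriv {} (insert (ren f g A) H) (ren f g B)"
    by (rule ImpI.IH) (use ImpI.prems in auto)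
  then show ?case by (auto intro: deriv.ImpI)
next
  case (ImpE G A B)
  have "deriv {} H (ren f g A \<^bold>\<longrightarrow> ren f g B)" "deriv {} H (ren f g A)"
    using ImpE.IH[of H f g] ImpE.prems by auto
  then show ?case by (rule deriv.ImpE)
next
  case (Classical A G)
  have "deriv {} (insert (\<^bold>\<not> ren f g A) H) (ren f g Fls)"
    by (rule Classical.IH) (use Classical.prems in auto)
  then show ?case by (auto intro: deriv.Classical)
next
  case (AllNI G x A)
  \<comment> \<open>The eigenvariable may occur in \<open>H\<close>, so it is redirected to a name
    fresh for \<open>H\<close>, which exists as \<open>H\<close> is finite. On \<open>A\<close> and
    \<open>G\<close> the redirected map agrees with \<open>f\<close>.\<close>
  obtain x' where x': "x' \<notin> fvN (ren f g A) \<union> (\<Union>B\<in>H. fvN B)"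
    using fresh_string[of "fvN (ren f g A) \<union> (\<Union>B\<in>H. fvN B)"] AllNI.prems by auto
  have "ren (f(x := x')) g B = ren f g B" if "B \<in> insert A G" for B
    using that AllNI.hyps by (intro ren_cong) auto
  then have *: "ren (f(x := x')) g A = ren f g A" "ren (f(x := x')) g ` G = ren f g ` G" by auto
  have "deriv {} H (ren (f(x := x')) g (openN (NV x) A))"
    by (rule AllNI.IH) (simp_all only: * AllNI.prems)
  then have "deriv {} H (openN (NV x') (ren f g A))" by (simp only: ren_openN *) simp
  then show ?case using x' by (auto intro!: deriv.AllNI)
next
  case (AllSI G x A)
  obtain x' where x': "x' \<notin> fvS (ren f g A) \<union> (\<Union>B\<in>H. fvS B)"
    using fresh_string[of "fvS (ren f g A) \<union> (\<Union>B\<in>H. fvS B)"] AllSI.prems by auto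
  have "ren f (g(x := x')) B = ren f g B" if "B \<in> insert A G" for B
    using that AllSI.hyps by (intro ren_cong) auto
  then have *: "ren f (g(x := x')) A = ren f g A" "ren f (g(x := x')) ` G = ren f g ` G" by auto
  have "deriv {} H (ren f (g(x := x')) (openS (SV x) A))"
    by (rule AllSI.IH) (simp_all only: * AllSI.prems)
  then have "deriv {} H (openS (SV x') (ren f g A))" by (simp only: ren_openS *) simp
  then show ?case using x' by (auto intro!: deriv.AllSI)
next
  case (AllNE G A t)
  then have "deriv {} H (AllN (ren f g A))" by (metis ren.simps(7))
  then show ?case unfolding ren_openN by (rule deriv.AllNE) (simp add: AllNE.hyps)
next
  case (AllSE G A U)
  then have "deriv {} H (AllS (ren f g A))" by (metis ren.simps(8))
  then show ?case unfolding ren_openS by (rule deriv.AllSE) (simp add: AllSE.hyps)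
next
  case (SubstN G t u A)
  have "deriv {} H (renN f g t \<^bold>= renN f g u)" "deriv {} H (openN (renN f g t) (ren f g A))"
    using SubstN by (auto simp flip: ren_openN)
  then show ?case unfolding ren_openN
    using SubstN.hyps by (simp add: deriv.SubstN[of "{}" H _ _ "ren f g A"])
next
  case (SubstS G t u A)
  have "deriv {} H (renS g t \<^bold>=\<^sub>S renS g u)" "deriv {} H (openS (renS g t) (ren f g A))"
    using SubstS by (auto simp flip: ren_openS)
  then show ?case unfolding ren_openS
    using SubstS.hyps by (simp add: deriv.SubstS[of "{}" H _ _ "ren f g A"])
qed (auto intro: deriv.ReflN deriv.ReflS)

text \<open>Even the identity renaming is enough, since \<open>deriv_ren\<close> renames the
  eigenvariables inside the derivation.\<close>

lemma weakening: "deriv {} G A \<Longrightarrow> finite H \<Longrightarrow> G \<subseteq> H \<Longrightarrow> deriv {} H A"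
  using deriv_ren[of G A H "\<lambda>x. x" "\<lambda>x. x"] by (simp add: image_def subset_iff)

text \<open>Weakening needs finite contexts, where fresh eigenvariables exist; passing to finite
  subsets makes derivability monotone for arbitrary sets.\<close>

definition ded :: "fm set \<Rightarrow> fm \<Rightarrow> bool" where
  "ded \<Gamma> A \<longleftrightarrow> (\<exists>F. finite F \<and> F \<subseteq> \<Gamma> \<and> deriv {} F A)"

lemma ded_assm: "A \<in> \<Gamma> \<Longrightarrow> ded \<Gamma> A"
  unfolding ded_def by (rule exI[of _ "{A}"]) (auto intro: deriv.Assumption)

lemma ded2:
  assumes "ded \<Gamma> A" "ded \<Gamma> B" "\<And>F. deriv {} F A \<Longrightarrow> deriv {} F B \<Longrightarrow> deriv {} F C"
  shows "ded \<Gamma> C"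
proof -
  obtain F G where "finite F" "F \<subseteq> \<Gamma>" "deriv {} F A" "finite G" "G \<subseteq> \<Gamma>" "deriv {} G B"
    using assms(1,2) unfolding ded_def by blast
  moreover from this have "deriv {} (F \<union> G) A" "deriv {} (F \<union> G) B"
    using weakening[of F A "F \<union> G"] weakening[of G B "F \<union> G"] by auto
  ultimately have "deriv {} (F \<union> G) C" "finite (F \<union> G)" "F \<union> G \<subseteq> \<Gamma>"
    by (auto intro: assms(3))
  then show ?thesis unfolding ded_def by blast
qed

lemma ded1: "ded \<Gamma> A \<Longrightarrow> (\<And>F. deriv {} F A \<Longrightarrow> deriv {} F C) \<Longrightarrow> ded \<Gamma> C"
  by (rule ded2)

lemma ded_mp: "ded \<Gamma> (A \<^bold>\<longrightarrow> B) \<Longrightarrow> ded \<Gamma> A \<Longrightarrow> ded \<Gamma> B"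
  by (erule (1) ded2) (rule deriv.ImpE)

lemma ded_discharge: assumes "ded (insert A \<Gamma>) B"
  obtains F where "finite F" "F \<subseteq> \<Gamma>" "deriv {} (insert A F) B"
proof -
  obtain F where "finite F" "F \<subseteq> insert A \<Gamma>" "deriv {} F B" using assms unfolding ded_def by blast
  then show ?thesis using weakening[of F B "insert A (F - {A})"] by (intro that[of "F - {A}"]) auto
qed

lemma ded_impI: "ded (insert A \<Gamma>) B \<Longrightarrow> ded \<Gamma> (A \<^bold>\<longrightarrow> B)"
  by (elim ded_discharge) (use deriv.ImpI in \<open>fastforce simp: ded_def\<close>)

lemma ded_classical: "ded (insert (\<^bold>\<not> A) \<Gamma>) Fls \<Longrightarrow> ded \<Gamma> A"
  by (elim ded_discharge) (use deriv.Classical in \<open>fastforce simp: ded_def\<close>)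

lemma ded_mono: "ded \<Gamma> A \<Longrightarrow> \<Gamma> \<subseteq> \<Delta> \<Longrightarrow> ded \<Delta> A"
  unfolding ded_def by blast

subsection \<open>Henkin sets\<close>

definition con :: "fm set \<Rightarrow> bool" where "con \<Gamma> \<longleftrightarrow> \<not> ded \<Gamma> Fls"

text \<open>A set with at most one element, because \<open>A\<close> has at most one of the two
  shapes; this avoids an option type in the union below.\<close>

definition wit :: "fm set \<Rightarrow> fm \<Rightarrow> fm set" where
  "wit \<Gamma> A =
    {\<^bold>\<not> openN (NV (SOME x. x \<notin> fvN B \<union> (\<Union>C\<in>\<Gamma>. fvN C))) B | B. A = (\<^bold>\<not> AllN B)} \<union>
    {\<^bold>\<not> openS (SV (SOME x. x \<notin> fvS B \<union> (\<Union>C\<in>\<Gamma>. fvS C))) B | B. A = (\<^bold>\<not> AllS B)}"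

text \<open>Lindenbaum's enumeration and Henkin's witnesses in one: an accepted negated universal
  formula gets its counterexample at the stage at which it is accepted.\<close>

primrec henkin :: "fm set \<Rightarrow> nat \<Rightarrow> fm set" where
  "henkin \<Gamma> 0 = \<Gamma>"
| "henkin \<Gamma> (Suc n) = (let A = from_nat n in
     if con (insert A (henkin \<Gamma> n)) then insert A (henkin \<Gamma> n \<union> wit (henkin \<Gamma> n) A) else henkin \<Gamma> n)"

lemma Neg_inj [simp]: "((\<^bold>\<not> A) = (\<^bold>\<not> B)) = (A = B)" by (auto simp: Neg_def)
lemma fv_Neg [simp]: "fvN (\<^bold>\<not> A) = fvN A" "fvS (\<^bold>\<not> A) = fvS A" by (auto simp: Neg_def)

lemma finite_wit: "finite (wit \<Gamma> A)"
proof -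
  have "wit \<Gamma> (\<^bold>\<not> AllN B) = {\<^bold>\<not> openN (NV (SOME x. x \<notin> fvN B \<union> (\<Union>C\<in>\<Gamma>. fvN C))) B}"
    "wit \<Gamma> (\<^bold>\<not> AllS B) = {\<^bold>\<not> openS (SV (SOME x. x \<notin> fvS B \<union> (\<Union>C\<in>\<Gamma>. fvS C))) B}" for B
    by (auto simp: wit_def)
  then have "finite (wit \<Gamma> A)" if "(\<exists>B. A = (\<^bold>\<not> AllN B)) \<or> (\<exists>B. A = (\<^bold>\<not> AllS B))" using that by auto
  moreover have "wit \<Gamma> A = {}" if "\<not> ((\<exists>B. A = (\<^bold>\<not> AllN B)) \<or> (\<exists>B. A = (\<^bold>\<not> AllS B)))"
    using that by (auto simp: wit_def)
  ultimately show ?thesis by fastforce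
qed

text \<open>Each stage adds finitely many formulas, so a fresh name remains available at every stage
  although the initial set may be infinite.\<close>

lemma finite_fv_henkin:
  assumes "finite (\<Union>C\<in>\<Gamma>. fvN C)" "finite (\<Union>C\<in>\<Gamma>. fvS C)"
  shows "finite (\<Union>C\<in>henkin \<Gamma> n. fvN C) \<and> finite (\<Union>C\<in>henkin \<Gamma> n. fvS C)"
  by (induction n) (use assms finite_wit in \<open>auto simp: Let_def UN_Un\<close>)

text \<open>If the witness led to a contradiction, \<open>B\<close> would be derivable for a name
  fresh for the context, and generalization would yield the universal formula that \<open>A\<close>
  negates.\<close>

lemma con_wit:
  assumes "con (insert A \<Gamma>)" "finite (\<Union>C\<in>\<Gamma>. fvN C)" "finite (\<Union>C\<in>\<Gamma>. fvS C)"
  shows "con (insert A (\<Gamma> \<union> wit \<Gamma> A))"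
proof -
  consider B where "A = (\<^bold>\<not> AllN B)" | B where "A = (\<^bold>\<not> AllS B)" | "wit \<Gamma> A = {}"
    by (force simp: wit_def)
  then show ?thesis
  proof cases
    case (1 B)
    define x where "x = (SOME x. x \<notin> fvN B \<union> (\<Union>C\<in>\<Gamma>. fvN C))"
    have "x \<notin> fvN B \<union> (\<Union>C\<in>\<Gamma>. fvN C)"
      unfolding x_def by (rule someI_ex, rule fresh_string) (use assms in auto)
    then have x: "x \<notin> fvN B \<union> (\<Union>C\<in>insert A \<Gamma>. fvN C)" using 1 by auto
    have w: "wit \<Gamma> A = {\<^bold>\<not> openN (NV x) B}" using 1 by (auto simp: wit_def x_def)
    show ?thesis unfolding con_def
    proof
      assume "ded (insert A (\<Gamma> \<union> wit \<Gamma> A)) Fls"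
      then have "ded (insert (\<^bold>\<not> openN (NV x) B) (insert A \<Gamma>)) Fls" by (simp add: w insert_commute)
      then have "ded (insert A \<Gamma>) (openN (NV x) B)" by (rule ded_classical)
      then obtain F where F: "finite F" "F \<subseteq> insert A \<Gamma>" "deriv {} F (openN (NV x) B)" unfolding ded_def by blast
      then have "deriv {} F (AllN B)" by (intro deriv.AllNI[OF F(3)]) (use x in blast)
      then have "ded (insert A \<Gamma>) (AllN B)" unfolding ded_def using F by blast
      then have "ded (insert A \<Gamma>) Fls"
        by (rule ded_mp[rotated]) (use 1 in \<open>auto simp: Neg_def intro: ded_assm\<close>)
      then show False using assms(1) by (simp add: con_def)
    qed
  next
    case (2 B)
    define x where "x = (SOME x. x \<notin> fvS B \<union> (\<Union>C\<in>\<Gamma>. fvS C))"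
    have "x \<notin> fvS B \<union> (\<Union>C\<in>\<Gamma>. fvS C)"
      unfolding x_def by (rule someI_ex, rule fresh_string) (use assms in auto)
    then have x: "x \<notin> fvS B \<union> (\<Union>C\<in>insert A \<Gamma>. fvS C)" using 2 by auto
    have w: "wit \<Gamma> A = {\<^bold>\<not> openS (SV x) B}" using 2 by (auto simp: wit_def x_def)
    show ?thesis unfolding con_def
    proof
      assume "ded (insert A (\<Gamma> \<union> wit \<Gamma> A)) Fls"
      then have "ded (insert (\<^bold>\<not> openS (SV x) B) (insert A \<Gamma>)) Fls" by (simp add: w insert_commute)
      then have "ded (insert A \<Gamma>) (openS (SV x) B)" by (rule ded_classical)
      then obtain F where F: "finite F" "F \<subseteq> insert A \<Gamma>" "deriv {} F (openS (SV x) B)" unfolding ded_def by blast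
      then have "deriv {} F (AllS B)" by (intro deriv.AllSI[OF F(3)]) (use x in blast)
      then have "ded (insert A \<Gamma>) (AllS B)" unfolding ded_def using F by blast
      then have "ded (insert A \<Gamma>) Fls"
        by (rule ded_mp[rotated]) (use 2 in \<open>auto simp: Neg_def intro: ded_assm\<close>)
      then show False using assms(1) by (simp add: con_def)
    qed
  next
    case 3 then show ?thesis using assms by simp
  qed
qed

locale henkin_set =
  fixes \<Gamma> :: "fm set"
  assumes con: "con \<Gamma>"
    and max: "\<And>A. A \<notin> \<Gamma> \<Longrightarrow> \<not> con (insert A \<Gamma>)"
    and witN: "\<And>B. (\<^bold>\<not> AllN B) \<in> \<Gamma> \<Longrightarrow> \<exists>x. (\<^bold>\<not> openN (NV x) B) \<in> \<Gamma>"
    and witS: "\<And>B. (\<^bold>\<not> AllS B) \<in> \<Gamma> \<Longrightarrow> \<exists>x. (\<^bold>\<not> openS (SV x) B) \<in> \<Gamma>"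

lemma henkin_extension:
  assumes "con \<Gamma>" "finite (\<Union>C\<in>\<Gamma>. fvN C)" "finite (\<Union>C\<in>\<Gamma>. fvS C)"
  obtains \<Delta> where "henkin_set \<Delta>" "\<Gamma> \<subseteq> \<Delta>"
proof
  let ?\<Delta> = "\<Union>n. henkin \<Gamma> n"
  show "\<Gamma> \<subseteq> ?\<Delta>" using UN_upper[of 0 UNIV "henkin \<Gamma>"] by simp
  have mono: "henkin \<Gamma> m \<subseteq> henkin \<Gamma> n" if "m \<le> n" for m n
    by (rule lift_Suc_mono_le[OF _ that]) (auto simp: Let_def)
  note fin = finite_fv_henkin[OF assms(2,3)]
  have con: "con (henkin \<Gamma> n)" for n
  proof (induction n)
    case (Suc n)
    then show ?case using con_wit[of "from_nat n" "henkin \<Gamma> n"] fin[of n] by (simp add: Let_def)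
  qed (simp add: assms)
  have fs: "\<exists>n. F \<subseteq> henkin \<Gamma> n" if "finite F" "F \<subseteq> ?\<Delta>" for F
    using that
  proof (induction F)
    case (insert A F)
    then obtain m n where "A \<in> henkin \<Gamma> m" "F \<subseteq> henkin \<Gamma> n" by blast
    then have "insert A F \<subseteq> henkin \<Gamma> (max m n)" using mono[of m "max m n"] mono[of n "max m n"] by fastforce
    then show ?case by blast
  qed simp
  have conD: "con ?\<Delta>" unfolding con_def
  proof
    assume "ded ?\<Delta> Fls"
    then obtain F where F: "deriv {} F Fls" "finite F" "F \<subseteq> ?\<Delta>" unfolding ded_def by blast
    then obtain n where "F \<subseteq> henkin \<Gamma> n" using fs by meson
    with F
    show False using con[of n] unfolding con_def ded_def by blast
  qed
  have step: "insert A (wit (henkin \<Gamma> n) A) \<subseteq> ?\<Delta>" if "con (insert A (henkin \<Gamma> n))" "n = to_nat A" for A n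
  proof -
    have "insert A (wit (henkin \<Gamma> n) A) \<subseteq> henkin \<Gamma> (Suc n)" using that by (auto simp: Let_def)
    then show ?thesis by blast
  qed
  \<comment> \<open>A formula of the limit is consistent with every stage, since both lie in the
    consistent limit. Hence it was accepted at the stage given by its own code, together with its
    witness.\<close>
  have sub: "con (insert A (henkin \<Gamma> n))" if "A \<in> ?\<Delta>" for A n
  proof -
    have "insert A (henkin \<Gamma> n) \<subseteq> ?\<Delta>" using that by blast
    then show ?thesis using conD ded_mono unfolding con_def by blast
  qed
  show "henkin_set ?\<Delta>"
  proof
    show "con ?\<Delta>" by (rule conD)
    show "\<not> con (insert A ?\<Delta>)" if "A \<notin> ?\<Delta>" for A
    proof -
      have "\<not> con (insert A (henkin \<Gamma> (to_nat A)))" using step[of A] that by blast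
      moreover have "insert A (henkin \<Gamma> (to_nat A)) \<subseteq> insert A ?\<Delta>" by blast
      ultimately show ?thesis using ded_mono unfolding con_def by blast
    qed
    show "\<exists>x. (\<^bold>\<not> openN (NV x) B) \<in> ?\<Delta>" if "(\<^bold>\<not> AllN B) \<in> ?\<Delta>" for B
      using step[OF sub[OF that] refl] by (auto simp: wit_def)
    show "\<exists>x. (\<^bold>\<not> openS (SV x) B) \<in> ?\<Delta>" if "(\<^bold>\<not> AllS B) \<in> ?\<Delta>" for B
      using step[OF sub[OF that] refl] by (auto simp: wit_def)
  qed
qed

lemma mapN_ntm_lc [simp]: "lcN u \<Longrightarrow> mapN_ntm (\<lambda>v. if v = NB k then t else v) u = u"
  by (induction u) auto

lemma mapS_ntm_lc [simp]: "lcN u \<Longrightarrow> mapS_ntm (\<lambda>v. if v = SB k then t else v) u = u"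
proof (induction u)
  case (Len X) then show ?case by (cases X) auto
qed auto

lemma subst_lcS [simp]: "lcS X \<Longrightarrow> (if X = SB k then t else X) = X"
  by (cases X) auto

text \<open>Instances of a quantified body are not subformulas, so structural induction does not
  reach them; this measure ignores terms and is invariant under opening.\<close>

primrec depth :: "fm \<Rightarrow> nat" where
  "depth Fls = 0"
| "depth (t \<^bold>= u) = 0"
| "depth (X \<^bold>=\<^sub>S Y) = 0"
| "depth (t \<^bold>\<le> u) = 0"
| "depth (t \<^bold>\<in> X) = 0"
| "depth (A \<^bold>\<longrightarrow> B) = Suc (depth A + depth B)"
| "depth (AllN A) = Suc (depth A)"
| "depth (AllS A) = Suc (depth A)"

lemma depth_openN [simp]: "depth (openN t A) = depth A"
proof -
  have "depth (mapN f k A) = depth A" for f k by (induction A arbitrary: k) auto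
  then show ?thesis by (simp add: openN_def)
qed

lemma depth_openS [simp]: "depth (openS t A) = depth A"
proof -
  have "depth (mapS f k A) = depth A" for f k by (induction A arbitrary: k) auto
  then show ?thesis by (simp add: openS_def)
qed

section \<open>Henkin sets as truth sets and their term models\<close>

context henkin_set
begin

lemma ded_iff: "ded \<Gamma> A \<longleftrightarrow> A \<in> \<Gamma>"
proof
  show "A \<in> \<Gamma>" if "ded \<Gamma> A"
  proof (rule ccontr)
    assume "A \<notin> \<Gamma>"
    then have "ded (insert A \<Gamma>) Fls" using max by (simp add: con_def)
    then have "ded \<Gamma> (A \<^bold>\<longrightarrow> Fls)" by (rule ded_impI)
    then have "ded \<Gamma> Fls" using that by (rule ded_mp)
    then show False using con by (simp add: con_def)
  qed
qed (rule ded_assm)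

lemma mem_Fls: "Fls \<notin> \<Gamma>"
  using con ded_assm[of Fls \<Gamma>] by (auto simp: con_def)

lemma mem_Imp: "(A \<^bold>\<longrightarrow> B) \<in> \<Gamma> \<longleftrightarrow> (A \<in> \<Gamma> \<longrightarrow> B \<in> \<Gamma>)"
proof
  show "A \<in> \<Gamma> \<longrightarrow> B \<in> \<Gamma>" if "(A \<^bold>\<longrightarrow> B) \<in> \<Gamma>" using that ded_mp[of \<Gamma> A B] by (simp add: ded_iff)
next
  assume AB: "A \<in> \<Gamma> \<longrightarrow> B \<in> \<Gamma>"
  have "ded (insert A \<Gamma>) B"
  proof (cases "A \<in> \<Gamma>")
    case True
    then show ?thesis using AB by (simp add: ded_assm)
  next
    case False
    then have "ded (insert A \<Gamma>) Fls" using max by (simp add: con_def)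
    then have "ded (insert (\<^bold>\<not> B) (insert A \<Gamma>)) Fls" by (rule ded_mono) blast
    then show ?thesis by (rule ded_classical)
  qed
  then show "(A \<^bold>\<longrightarrow> B) \<in> \<Gamma>" using ded_impI[of A \<Gamma> B] ded_iff by simp
qed

lemma mem_Neg: "(\<^bold>\<not> A) \<in> \<Gamma> \<longleftrightarrow> A \<notin> \<Gamma>"
  by (simp add: Neg_def mem_Imp mem_Fls)

lemma mem_AllN: "AllN A \<in> \<Gamma> \<longleftrightarrow> (\<forall>t. lcN t \<longrightarrow> openN t A \<in> \<Gamma>)"
proof (intro iffI allI impI)
  fix t assume "AllN A \<in> \<Gamma>" "lcN t"
  then show "openN t A \<in> \<Gamma>" unfolding ded_iff[symmetric] by - (erule ded1, erule (1) deriv.AllNE)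
next
  assume *: "\<forall>t. lcN t \<longrightarrow> openN t A \<in> \<Gamma>"
  show "AllN A \<in> \<Gamma>"
  proof (rule ccontr)
    assume "AllN A \<notin> \<Gamma>"
    then obtain x where "(\<^bold>\<not> openN (NV x) A) \<in> \<Gamma>" using witN by (auto simp: mem_Neg)
    then show False using * by (simp add: mem_Neg)
  qed
qed

lemma mem_AllS: "AllS A \<in> \<Gamma> \<longleftrightarrow> (\<forall>U. lcS U \<longrightarrow> openS U A \<in> \<Gamma>)"
proof (intro iffI allI impI)
  fix t assume "AllS A \<in> \<Gamma>" "lcS t"
  then show "openS t A \<in> \<Gamma>" unfolding ded_iff[symmetric] by - (erule ded1, erule (1) deriv.AllSE)
next
  assume *: "\<forall>t. lcS t \<longrightarrow> openS t A \<in> \<Gamma>"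
  show "AllS A \<in> \<Gamma>"
  proof (rule ccontr)
    assume "AllS A \<notin> \<Gamma>"
    then obtain x where "(\<^bold>\<not> openS (SV x) A) \<in> \<Gamma>" using witS by (auto simp: mem_Neg)
    then show False using * by (simp add: mem_Neg)
  qed
qed

lemma reflN: "(t \<^bold>= t) \<in> \<Gamma>" and reflS: "(X \<^bold>=\<^sub>S X) \<in> \<Gamma>"
  unfolding ded_iff[symmetric] ded_def by (blast intro: deriv.ReflN deriv.ReflS)+

lemma substN: "(t \<^bold>= u) \<in> \<Gamma> \<Longrightarrow> openN t A \<in> \<Gamma> \<Longrightarrow> lcN t \<Longrightarrow> lcN u \<Longrightarrow> openN u A \<in> \<Gamma>"
  unfolding ded_iff[symmetric] by (erule (1) ded2) (rule deriv.SubstN)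

lemma substS: "(X \<^bold>=\<^sub>S Y) \<in> \<Gamma> \<Longrightarrow> openS X A \<in> \<Gamma> \<Longrightarrow> lcS X \<Longrightarrow> lcS Y \<Longrightarrow> openS Y A \<in> \<Gamma>"
  unfolding ded_iff[symmetric] by (erule (1) ded2) (rule deriv.SubstS)

text \<open>Leibniz's rule for a formula with a hole \<open>NB 0\<close>; the same device gives
  transitivity and all congruences below.\<close>

lemma symN: "(t \<^bold>= u) \<in> \<Gamma> \<Longrightarrow> lcN t \<Longrightarrow> lcN u \<Longrightarrow> (u \<^bold>= t) \<in> \<Gamma>"
  using substN[of t u "NB 0 \<^bold>= t"] reflN[of t] by (simp add: openN_def)

lemma transN: "(t \<^bold>= u) \<in> \<Gamma> \<Longrightarrow> (u \<^bold>= v) \<in> \<Gamma> \<Longrightarrow> lcN t \<Longrightarrow> lcN u \<Longrightarrow> lcN v \<Longrightarrow> (t \<^bold>= v) \<in> \<Gamma>"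
  using substN[of u v "t \<^bold>= NB 0"] by (simp add: openN_def)

lemma symS: "(t \<^bold>=\<^sub>S u) \<in> \<Gamma> \<Longrightarrow> lcS t \<Longrightarrow> lcS u \<Longrightarrow> (u \<^bold>=\<^sub>S t) \<in> \<Gamma>"
  using substS[of t u "SB 0 \<^bold>=\<^sub>S t"] reflS[of t] by (auto simp: openS_def split: if_splits)

lemma transS: "(t \<^bold>=\<^sub>S u) \<in> \<Gamma> \<Longrightarrow> (u \<^bold>=\<^sub>S v) \<in> \<Gamma> \<Longrightarrow> lcS t \<Longrightarrow> lcS u \<Longrightarrow> lcS v \<Longrightarrow> (t \<^bold>=\<^sub>S v) \<in> \<Gamma>"
  using substS[of u v "t \<^bold>=\<^sub>S SB 0"] by (auto simp: openS_def split: if_splits)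

text \<open>Canonical representatives of provable equality stand in for equivalence classes, so that
  elements of the model are again terms.\<close>

definition repN :: "ntm \<Rightarrow> ntm" where "repN t = (SOME u. lcN u \<and> (t \<^bold>= u) \<in> \<Gamma>)"
definition repS :: "stm \<Rightarrow> stm" where "repS X = (SOME Y. lcS Y \<and> (X \<^bold>=\<^sub>S Y) \<in> \<Gamma>)"

lemma repN: assumes "lcN t" shows "lcN (repN t)" "(t \<^bold>= repN t) \<in> \<Gamma>"
  unfolding atomize_conj repN_def by (rule someI[of _ t]) (use assms reflN in auto)

lemma repS: assumes "lcS t" shows "lcS (repS t)" "(t \<^bold>=\<^sub>S repS t) \<in> \<Gamma>"
  unfolding atomize_conj repS_def by (rule someI[of _ t]) (use assms reflS in auto)

lemma repN_eq_iff: assumes "lcN t" "lcN u" shows "repN t = repN u \<longleftrightarrow> (t \<^bold>= u) \<in> \<Gamma>"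
proof
  show "(t \<^bold>= u) \<in> \<Gamma>" if "repN t = repN u"
    using that repN[of t] repN[of u] assms symN transN by metis
  show "repN t = repN u" if "(t \<^bold>= u) \<in> \<Gamma>"
  proof -
    have "(lcN v \<and> (t \<^bold>= v) \<in> \<Gamma>) = (lcN v \<and> (u \<^bold>= v) \<in> \<Gamma>)" for v
      using that assms symN transN by blast
    then show ?thesis by (simp add: repN_def)
  qed
qed

lemma repS_eq_iff: assumes "lcS t" "lcS u" shows "repS t = repS u \<longleftrightarrow> (t \<^bold>=\<^sub>S u) \<in> \<Gamma>"
proof
  show "(t \<^bold>=\<^sub>S u) \<in> \<Gamma>" if "repS t = repS u"
    using that repS[of t] repS[of u] assms symS transS by metis
  show "repS t = repS u" if "(t \<^bold>=\<^sub>S u) \<in> \<Gamma>"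
  proof -
    have "(lcS v \<and> (t \<^bold>=\<^sub>S v) \<in> \<Gamma>) = (lcS v \<and> (u \<^bold>=\<^sub>S v) \<in> \<Gamma>)" for v
      using that assms symS transS by blast
    then show ?thesis by (simp add: repS_def)
  qed
qed

lemma rep_congs_aux:
  assumes [simp]: "lcN t" "lcN u" "lcS X"
  shows "(t \<^bold>+ u \<^bold>= repN t \<^bold>+ repN u) \<in> \<Gamma>" "(t \<^bold>* u \<^bold>= repN t \<^bold>* repN u) \<in> \<Gamma>"
    "(\<^bold>|X\<^bold>| \<^bold>= \<^bold>|repS X\<^bold>|) \<in> \<Gamma>"
    "(repN t \<^bold>\<le> repN u) \<in> \<Gamma> \<longleftrightarrow> (t \<^bold>\<le> u) \<in> \<Gamma>" "(repN t \<^bold>\<in> repS X) \<in> \<Gamma> \<longleftrightarrow> (t \<^bold>\<in> X) \<in> \<Gamma>"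
proof -
  note [simp] = repN(1)[of t] repN(1)[of u] repS(1)[of X]
  note t = repN(2)[of t, simplified] and u = repN(2)[of u, simplified] and X = repS(2)[of X, simplified]
  have t': "(repN t \<^bold>= t) \<in> \<Gamma>" and u': "(repN u \<^bold>= u) \<in> \<Gamma>" and X': "(repS X \<^bold>=\<^sub>S X) \<in> \<Gamma>"
    using t u X symN symS by auto
  show "(t \<^bold>+ u \<^bold>= repN t \<^bold>+ repN u) \<in> \<Gamma>"
    using substN[OF t, of "t \<^bold>+ u \<^bold>= NB 0 \<^bold>+ u"] substN[OF u, of "t \<^bold>+ u \<^bold>= repN t \<^bold>+ NB 0"]
      reflN[of "t \<^bold>+ u"] by (simp add: openN_def)
  show "(t \<^bold>* u \<^bold>= repN t \<^bold>* repN u) \<in> \<Gamma>"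
    using substN[OF t, of "t \<^bold>* u \<^bold>= NB 0 \<^bold>* u"] substN[OF u, of "t \<^bold>* u \<^bold>= repN t \<^bold>* NB 0"]
      reflN[of "t \<^bold>* u"] by (simp add: openN_def)
  show "(\<^bold>|X\<^bold>| \<^bold>= \<^bold>|repS X\<^bold>|) \<in> \<Gamma>"
    using substS[OF X, of "\<^bold>|X\<^bold>| \<^bold>= \<^bold>|SB 0\<^bold>|"] reflN[of "\<^bold>|X\<^bold>|"]
    by (simp add: openS_def split: if_splits)
  show "(repN t \<^bold>\<le> repN u) \<in> \<Gamma> \<longleftrightarrow> (t \<^bold>\<le> u) \<in> \<Gamma>"
    using substN[OF t, of "NB 0 \<^bold>\<le> u"] substN[OF u, of "repN t \<^bold>\<le> NB 0"]
      substN[OF t', of "NB 0 \<^bold>\<le> repN u"] substN[OF u', of "t \<^bold>\<le> NB 0"] by (auto simp: openN_def)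
  show "(repN t \<^bold>\<in> repS X) \<in> \<Gamma> \<longleftrightarrow> (t \<^bold>\<in> X) \<in> \<Gamma>"
    using substN[OF t, of "NB 0 \<^bold>\<in> X"] substS[OF X, of "repN t \<^bold>\<in> SB 0"]
      substN[OF t', of "NB 0 \<^bold>\<in> repS X"] substS[OF X', of "t \<^bold>\<in> SB 0"]
    by (auto simp: openN_def openS_def split: if_splits)
qed

lemma rep_congs:
  "lcN t \<Longrightarrow> lcN u \<Longrightarrow> (t \<^bold>+ u \<^bold>= repN t \<^bold>+ repN u) \<in> \<Gamma>"
  "lcN t \<Longrightarrow> lcN u \<Longrightarrow> (t \<^bold>* u \<^bold>= repN t \<^bold>* repN u) \<in> \<Gamma>"
  "lcS X \<Longrightarrow> (\<^bold>|X\<^bold>| \<^bold>= \<^bold>|repS X\<^bold>|) \<in> \<Gamma>"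
  "lcN t \<Longrightarrow> lcN u \<Longrightarrow> (repN t \<^bold>\<le> repN u) \<in> \<Gamma> \<longleftrightarrow> (t \<^bold>\<le> u) \<in> \<Gamma>"
  "lcN t \<Longrightarrow> lcS X \<Longrightarrow> (repN t \<^bold>\<in> repS X) \<in> \<Gamma> \<longleftrightarrow> (t \<^bold>\<in> X) \<in> \<Gamma>"
  using rep_congs_aux[of t u "SV []"] rep_congs_aux[of "\<^bold>0" "\<^bold>0" X] rep_congs_aux[of t "\<^bold>0" X] by simp_all

text \<open>The domains are coded into the natural numbers, so as to have a single type of countermodels.\<close>

definition cN :: "ntm \<Rightarrow> nat" where "cN t = to_nat (repN t)"
definition cS :: "stm \<Rightarrow> nat" where "cS X = to_nat (repS X)"

definition term_model :: "(nat, nat) struc" where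
  "term_model = \<lparr>DN = cN ` {t. lcN t}, DS = cS ` {X. lcS X}, zer = cN \<^bold>0, one = cN \<^bold>1,
    add = (\<lambda>a b. cN (from_nat a \<^bold>+ from_nat b)), mul = (\<lambda>a b. cN (from_nat a \<^bold>* from_nat b)),
    leq = (\<lambda>a b. (from_nat a \<^bold>\<le> from_nat b) \<in> \<Gamma>), len = (\<lambda>a. cN \<^bold>|from_nat a\<^bold>|),
    mem = (\<lambda>a b. (from_nat a \<^bold>\<in> from_nat b) \<in> \<Gamma>)\<rparr>"

lemma cN_eq_iff: "lcN t \<Longrightarrow> lcN u \<Longrightarrow> cN t = cN u \<longleftrightarrow> (t \<^bold>= u) \<in> \<Gamma>"
  by (simp add: cN_def repN_eq_iff)
lemma cS_eq_iff: "lcS t \<Longrightarrow> lcS u \<Longrightarrow> cS t = cS u \<longleftrightarrow> (t \<^bold>=\<^sub>S u) \<in> \<Gamma>"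
  by (simp add: cS_def repS_eq_iff)
lemma from_nat_c [simp]: "from_nat (cN t) = repN t" "from_nat (cS X) = repS X"
  by (simp_all add: cN_def cS_def)

lemma term_model_simps [simp]:
  "DN term_model = cN ` {t. lcN t}" "DS term_model = cS ` {X. lcS X}"
  "zer term_model = cN \<^bold>0" "one term_model = cN \<^bold>1"
  "add term_model a b = cN (from_nat a \<^bold>+ from_nat b)" "mul term_model a b = cN (from_nat a \<^bold>* from_nat b)"
  "leq term_model a b \<longleftrightarrow> (from_nat a \<^bold>\<le> from_nat b) \<in> \<Gamma>" "len term_model c = cN \<^bold>|from_nat c\<^bold>|"
  "mem term_model a c \<longleftrightarrow> (from_nat a \<^bold>\<in> from_nat c) \<in> \<Gamma>"
  by (simp_all add: term_model_def)

lemma cN_rep [simp]: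
  "lcN t \<Longrightarrow> lcN u \<Longrightarrow> cN (repN t \<^bold>+ repN u) = cN (t \<^bold>+ u)"
  "lcN t \<Longrightarrow> lcN u \<Longrightarrow> cN (repN t \<^bold>* repN u) = cN (t \<^bold>* u)"
  "lcS X \<Longrightarrow> cN \<^bold>|repS X\<^bold>| = cN \<^bold>|X\<^bold>|"
  by (simp_all add: cN_eq_iff repN repS rep_congs symN)

lemma struc_ok_term_model: "struc_ok term_model"
proof -
  have "{X. lcS X} \<noteq> {}" using lcS.simps(1) by blast
  then show ?thesis unfolding struc_ok_def by (auto simp: repN repS)
qed

abbreviation tsat :: "(nat \<Rightarrow> nat) \<Rightarrow> (nat \<Rightarrow> nat) \<Rightarrow> fm \<Rightarrow> bool" where
  "tsat \<equiv> sat term_model (\<lambda>x. cN (NV x)) (\<lambda>X. cS (SV X))"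

lemma evS_term: "lcS X \<Longrightarrow> evS (\<lambda>X. cS (SV X)) bs X = cS X"
  by (cases X) auto

lemma evN_term: "lcN t \<Longrightarrow> evN term_model (\<lambda>x. cN (NV x)) (\<lambda>X. cS (SV X)) bn bs t = cN t"
  by (induction t) (auto simp: evS_term)

text \<open>Every element of the domain is the value of a locally closed term. Ranging over the
  domain therefore means ranging over instances, which \<open>mem_AllN\<close> and
  \<open>mem_AllS\<close> describe and which have smaller depth.\<close>

lemma truth: "lv 0 0 A \<Longrightarrow> tsat bn bs A \<longleftrightarrow> A \<in> \<Gamma>"
proof (induction A arbitrary: bn bs rule: measure_induct_rule[of depth])
  case (less A)
  show ?case
  proof (cases A)
    case (AllN B)
    then have lvB: "lv 1 0 B" using less.prems by simp
    have "tsat (case_nat (cN t) bn) bs B \<longleftrightarrow> openN t B \<in> \<Gamma>" if "lcN t" for t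
    proof -
      have "tsat (case_nat (cN t) bn) bs B \<longleftrightarrow> tsat (bn(0 := cN t)) bs B"
        by (rule sat_cong[OF lvB]) auto
      also have "\<dots> \<longleftrightarrow> tsat bn bs (openN t B)"
        using that by (simp add: openN_def sat_mapN_open evN_term)
      also have "\<dots> \<longleftrightarrow> openN t B \<in> \<Gamma>"
        using less.IH[of "openN t B"] lv_openN[OF that, of 0 0 B] lvB AllN by (simp add: openN_def[symmetric])
      finally show ?thesis .
    qed
    then have "(\<forall>d\<in>cN ` {t. lcN t}. tsat (case_nat d bn) bs B) \<longleftrightarrow> AllN B \<in> \<Gamma>"
      by (auto simp: mem_AllN)
    then show ?thesis by (simp add: AllN)
  next
    case (AllS B)
    then have lvB: "lv 0 1 B" using less.prems by simp
    have "tsat bn (case_nat (cS t) bs) B \<longleftrightarrow> openS t B \<in> \<Gamma>" if "lcS t" for t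
    proof -
      have "tsat bn (case_nat (cS t) bs) B \<longleftrightarrow> tsat bn (bs(0 := cS t)) B"
        by (rule sat_cong[OF lvB]) auto
      also have "\<dots> \<longleftrightarrow> tsat bn bs (openS t B)"
        using that by (simp add: openS_def sat_mapS_open evS_term)
      also have "\<dots> \<longleftrightarrow> openS t B \<in> \<Gamma>"
        using less.IH[of "openS t B"] lv_openS[OF that, of 0 0 B] lvB AllS by (simp add: openS_def[symmetric])
      finally show ?thesis .
    qed
    then have "(\<forall>d\<in>cS ` {t. lcS t}. tsat bn (case_nat d bs) B) \<longleftrightarrow> AllS B \<in> \<Gamma>"
      by (auto simp: mem_AllS)
    then show ?thesis by (simp add: AllS)
  next
    case (Imp B C)
    then show ?thesis using less.IH[of B] less.IH[of C] less.prems by (simp add: mem_Imp)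
  next
    case (Le t u)
    then show ?thesis using less.prems by (simp add: evN_term rep_congs(4))
  next
    case (Mem t X)
    then show ?thesis using less.prems
      by (simp add: evN_term evS_term rep_congs(5))
  qed (use less.prems in \<open>simp_all add: mem_Fls evN_term evS_term cN_eq_iff cS_eq_iff\<close>)
qed

end

subsection \<open>Universal closures and the completeness theorem\<close>

text \<open>Eigenvariable conditions speak about assumptions and never about axioms, so a derivation
  stays correct when axioms are added.\<close>

lemma deriv_mono: "deriv {} G A \<Longrightarrow> deriv T G A"
proof (induction rule: deriv.induct)
  case (ImpE G A B)
  then show ?case by (meson deriv.ImpE)
next
  case (AllNI G x A)
  then show ?case by (meson deriv.AllNI)
next
  case (AllSI G x A)
  then show ?case by (meson deriv.AllSI)
next
  case (SubstN G t u A)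
  then show ?case by (meson deriv.SubstN)
next
  case (SubstS G t u A)
  then show ?case by (meson deriv.SubstS)
qed (simp_all add: deriv.Assumption deriv.ImpI deriv.Classical deriv.AllNE deriv.AllSE deriv.ReflN deriv.ReflS)

lemma mapN_ntm_open_close:
  "lvN k j t \<Longrightarrow> mapN_ntm (\<lambda>v. if v = NB k then NV x else v) (mapN_ntm (\<lambda>v. if v = NV x then NB k else v) t) = t"
  by (induction t) auto

lemma openN_closeN: assumes "lv 0 0 A" shows "openN (NV x) (closeN x A) = A"
proof -
  have "mapN (\<lambda>k v. if v = NB k then NV x else v) i (mapN (\<lambda>k v. if v = NV x then NB k else v) i A) = A"
    if "lv i j A" for i j
    using that by (induction A arbitrary: i j) (auto simp: mapN_ntm_open_close)
  then show ?thesis using assms by (simp add: openN_def closeN_def)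
qed

lemma open_close_stm: "lvS k V \<Longrightarrow>
    (if (if V = SV X then SB k else V) = SB k then SV X else (if V = SV X then SB k else V)) = V"
  by (cases V) auto

lemma mapS_ntm_open_close:
  "lvN j k t \<Longrightarrow> mapS_ntm (\<lambda>v. if v = SB k then SV x else v) (mapS_ntm (\<lambda>v. if v = SV x then SB k else v) t) = t"
  by (induction t) (auto split: if_splits)

lemma openS_closeS: assumes "lv 0 0 A" shows "openS (SV x) (closeS x A) = A"
proof -
  have "mapS (\<lambda>k v. if v = SB k then SV x else v) j (mapS (\<lambda>k v. if v = SV x then SB k else v) j A) = A"
    if "lv i j A" for i j
    using that by (induction A arbitrary: i j)
      (auto simp only: lv.simps mapS.simps mapS_ntm_open_close open_close_stm)
  then show ?thesis using assms by (simp add: openS_def closeS_def)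
qed

lemma fv_mapN_close [simp]:
  "fvN (mapN (\<lambda>k v. if v = NV x then NB k else v) k A) = fvN A - {x}"
  "fvS (mapN (\<lambda>k v. if v = NV x then NB k else v) k A) = fvS A"
proof -
  have "fvN_ntm (mapN_ntm (\<lambda>v. if v = NV x then NB k else v) t) = fvN_ntm t - {x}"
    "fvS_ntm (mapN_ntm (\<lambda>v. if v = NV x then NB k else v) t) = fvS_ntm t" for k t
    by (induction t) auto
  then show "fvN (mapN (\<lambda>k v. if v = NV x then NB k else v) k A) = fvN A - {x}"
    "fvS (mapN (\<lambda>k v. if v = NV x then NB k else v) k A) = fvS A"
    by (induction A arbitrary: k) auto
qed

lemma fv_mapS_close [simp]:
  "fvN (mapS (\<lambda>k v. if v = SV x then SB k else v) k A) = fvN A"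
  "fvS (mapS (\<lambda>k v. if v = SV x then SB k else v) k A) = fvS A - {x}"
proof -
  have 1: "fvS_stm (if V = SV x then SB k else V) = fvS_stm V - {x}" for k V
    by (cases V) auto
  have 2: "fvN_ntm (mapS_ntm (\<lambda>v. if v = SV x then SB k else v) t) = fvN_ntm t"
    "fvS_ntm (mapS_ntm (\<lambda>v. if v = SV x then SB k else v) t) = fvS_ntm t - {x}" for k t
    by (induction t) (simp_all add: 1 Un_Diff split del: if_split)
  show "fvN (mapS (\<lambda>k v. if v = SV x then SB k else v) k A) = fvN A"
    "fvS (mapS (\<lambda>k v. if v = SV x then SB k else v) k A) = fvS A - {x}"
    by (induction A arbitrary: k) (simp_all add: 1 2 Un_Diff split del: if_split)
qed

lemma fv_quantifiers [simp]:
  "fvN (alln x A) = fvN A - {x}" "fvS (alln x A) = fvS A"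
  "fvN (alls X A) = fvN A" "fvS (alls X A) = fvS A - {X}"
  "fvN (exn x A) = fvN A - {x}" "fvS (exn x A) = fvS A"
  "fvN (exs X A) = fvN A" "fvS (exs X A) = fvS A - {X}"
  by (simp_all add: alln_def alls_def exn_def exs_def closeN_def closeS_def)

lemma fv_connectives [simp]:
  "fvN (A \<^bold>\<or> B) = fvN A \<union> fvN B" "fvS (A \<^bold>\<or> B) = fvS A \<union> fvS B"
  "fvN (A \<^bold>\<and> B) = fvN A \<union> fvN B" "fvS (A \<^bold>\<and> B) = fvS A \<union> fvS B"
  "fvN (A \<^bold>\<longleftrightarrow> B) = fvN A \<union> fvN B" "fvS (A \<^bold>\<longleftrightarrow> B) = fvS A \<union> fvS B"
  "fvN (t \<^bold>< u) = fvN_ntm t \<union> fvN_ntm u" "fvS (t \<^bold>< u) = fvS_ntm t \<union> fvS_ntm u"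
  by (auto simp: Or_def And_def Iff_def Lt_def)

text \<open>Without open assumptions the name to be bound can itself serve as eigenvariable, as it
  no longer occurs in the closed body.\<close>

lemma deriv_alln: "deriv T {} A \<Longrightarrow> lv 0 0 A \<Longrightarrow> deriv T {} (alln x A)"
  unfolding alln_def by (rule deriv.AllNI[where x = x]) (simp_all add: openN_closeN, simp add: closeN_def)

lemma deriv_alls: "deriv T {} A \<Longrightarrow> lv 0 0 A \<Longrightarrow> deriv T {} (alls x A)"
  unfolding alls_def by (rule deriv.AllSI[where X = x]) (simp_all add: openS_closeS, simp add: closeS_def)

text \<open>The order of the quantifiers does not matter, so any enumeration of the free names will
  do.\<close>

definition ucl :: "fm \<Rightarrow> fm" where
  "ucl A = foldr alln (SOME xs. set xs = fvN A) (foldr alls (SOME Xs. set Xs = fvS A) A)"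

lemma ucl_lists: "set (SOME xs. set xs = fvN A) = fvN A" "set (SOME xs. set xs = fvS A) = fvS A"
  by (rule someI_ex, simp add: finite_list)+

lemma lv_foldr_alls: "lv 0 0 A \<Longrightarrow> lv 0 0 (foldr alls xs A)"
  by (induction xs) auto
lemma lv_foldr_alln: "lv 0 0 A \<Longrightarrow> lv 0 0 (foldr alln xs A)"
  by (induction xs) auto

lemma fv_foldr_alln: "fvN (foldr alln xs A) = fvN A - set xs" "fvS (foldr alln xs A) = fvS A"
  by (induction xs) auto
lemma fv_foldr_alls: "fvN (foldr alls Xs A) = fvN A" "fvS (foldr alls Xs A) = fvS A - set Xs"
  by (induction Xs) auto

lemma ucl_closed: "lv 0 0 A \<Longrightarrow> lv 0 0 (ucl A)" "fvN (ucl A) = {}" "fvS (ucl A) = {}"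
  by (simp_all add: ucl_def lv_foldr_alls lv_foldr_alln fv_foldr_alln fv_foldr_alls ucl_lists)

lemma deriv_ucl: assumes "deriv T {} A" "lv 0 0 A" shows "deriv T {} (ucl A)"
proof -
  have 1: "deriv T {} (foldr alls Xs A)" for Xs
    by (induction Xs) (auto simp: assms deriv_alls lv_foldr_alls)
  have "deriv T {} (foldr alln xs (foldr alls Xs A))" for xs Xs
    by (induction xs) (auto simp: assms 1 deriv_alln lv_foldr_alls lv_foldr_alln)
  then show ?thesis by (simp add: ucl_def)
qed

lemma sat_foldr_alln:
  "sat M e es bn bs (foldr alln xs A) \<Longrightarrow> (\<And>x. e' x \<in> DN M) \<Longrightarrow> (\<And>x. x \<notin> set xs \<Longrightarrow> e' x = e x) \<Longrightarrow>
   \<exists>bn. sat M e' es bn bs A"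
proof (induction xs arbitrary: e bn)
  case Nil
  then have "e' = e" by auto
  then show ?case using Nil by auto
next
  case (Cons x xs)
  have "sat M (e(x := e' x)) es (case_nat (e' x) bn) bs (foldr alln xs A)" using Cons.prems(1,2) by simp
  then show ?case by (rule Cons.IH) (use Cons.prems in auto)
qed

lemma sat_foldr_alls:
  "sat M e es bn bs (foldr alls xs A) \<Longrightarrow> (\<And>x. es' x \<in> DS M) \<Longrightarrow> (\<And>x. x \<notin> set xs \<Longrightarrow> es' x = es x) \<Longrightarrow>
   \<exists>bs. sat M e es' bn bs A"
proof (induction xs arbitrary: es bs)
  case Nil
  then have "es' = es" by auto
  then show ?case using Nil by auto
next
  case (Cons x xs)
  have "sat M e (es(x := es' x)) bn (case_nat (es' x) bs) (foldr alls xs A)" using Cons.prems(1,2) by simp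
  then show ?case by (rule Cons.IH) (use Cons.prems in auto)
qed

text \<open>The prefix gives control over exactly the free names of \<open>A\<close>, so only these
  are switched to the new values; other names and the stacks are exchanged by
  \<open>sat_cong\<close>.\<close>

lemma sat_ucl:
  assumes "sat M e es bn bs (ucl A)" "lv 0 0 A"
    and "\<And>x. e x \<in> DN M" "\<And>x. e' x \<in> DN M" "\<And>x. es x \<in> DS M" "\<And>x. es' x \<in> DS M"
  shows "sat M e' es' bn' bs' A"
proof -
  let ?e = "\<lambda>x. if x \<in> fvN A then e' x else e x" and ?es = "\<lambda>x. if x \<in> fvS A then es' x else es x"
  have "\<exists>bn. sat M ?e es bn bs (foldr alls (SOME Xs. set Xs = fvS A) A)"
    by (rule sat_foldr_alln[OF assms(1)[unfolded ucl_def]]) (use assms in \<open>auto simp: ucl_lists\<close>)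
  then obtain bn1 where bn1: "sat M ?e es bn1 bs (foldr alls (SOME Xs. set Xs = fvS A) A)" ..
  have "\<exists>bs. sat M ?e ?es bn1 bs A"
    by (rule sat_foldr_alls[OF bn1]) (use assms in \<open>auto simp: ucl_lists\<close>)
  then obtain bs1 where "sat M ?e ?es bn1 bs1 A" ..
  then show ?thesis using sat_cong[OF assms(2), of ?e e' ?es es' bn1 bn' bs1 bs' M] by simp
qed

definition models :: "('a, 'b) struc \<Rightarrow> fm set \<Rightarrow> bool" where
  "models M T \<longleftrightarrow> struc_ok M \<and>
    (\<forall>A\<in>T. \<forall>e es bn bs. (\<forall>x. e x \<in> DN M) \<longrightarrow> (\<forall>X. es X \<in> DS M) \<longrightarrow> sat M e es bn bs A)"

lemma deriv_cut:
  assumes "finite F" "\<And>A. A \<in> F \<Longrightarrow> deriv T {} A" "deriv T F B"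
  shows "deriv T {} B"
  using assms
proof (induction F arbitrary: B rule: finite_induct)
  case (insert A F)
  then have "deriv T F (A \<^bold>\<longrightarrow> B)" by (intro deriv.ImpI)
  then have "deriv T {} (A \<^bold>\<longrightarrow> B)" using insert by blast
  then show ?case using insert.prems deriv.ImpE by blast
qed

text \<open>Checking models on subsets of \<open>nat\<close> suffices because the term model of the
  Henkin set is coded there. The closures of the axioms have no free names, so fresh witnesses exist
  even for infinite \<open>T\<close>.\<close>

theorem completeness:
  assumes T: "\<And>A. A \<in> T \<Longrightarrow> lv 0 0 A" and C: "lv 0 0 C" "fvN C = {}" "fvS C = {}"
    and valid: "\<And>M :: (nat, nat) struc. models M T \<Longrightarrow> models M {C}"
  shows "T \<^bold>\<turnstile> C"
proof -
  let ?G = "insert (\<^bold>\<not> C) (ucl ` T)"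
  have "\<not> con ?G"
  proof
    assume "con ?G"
    then obtain \<Delta> where "henkin_set \<Delta>" and G: "?G \<subseteq> \<Delta>"
      by (rule henkin_extension) (auto simp: ucl_closed C)
    interpret henkin_set \<Delta> by fact
    have env: "cN (NV x) \<in> DN term_model" "cS (SV X) \<in> DS term_model" for x X
      by auto
    have "models term_model T" unfolding models_def
    proof (intro conjI ballI allI impI)
      fix A bn bs and e es :: "string \<Rightarrow> nat"
      assume A: "A \<in> T" and "\<forall>x. e x \<in> DN term_model" "\<forall>X. es X \<in> DS term_model"
      moreover have "tsat bn bs (ucl A)" using G A truth[OF ucl_closed(1)[OF T[OF A]]] by blast
      ultimately show "sat term_model e es bn bs A"
        using env by (intro sat_ucl[OF _ T[OF A]]) (auto simp del: term_model_simps)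
    qed (rule struc_ok_term_model)
    then have "models term_model {C}" by (rule valid)
    then have "tsat (\<lambda>_. 0) (\<lambda>_. 0) C" using env by (simp add: models_def del: term_model_simps)
    then have "C \<in> \<Delta>" using truth[OF C(1)] by blast
    then show False using G by (auto simp: mem_Neg)
  qed
  then have "ded (ucl ` T) C" unfolding con_def not_not by (rule ded_classical)
  then obtain F where F: "finite F" "F \<subseteq> ucl ` T" "deriv {} F C" unfolding ded_def by blast
  have "deriv T {} C"
  proof (rule deriv_cut[OF F(1)])
    show "deriv T {} A" if A: "A \<in> F" for A
    proof -
      obtain B where B: "A = ucl B" "B \<in> T" using F(2) A by blast
      then show ?thesis using deriv_ucl[OF deriv.Axiom[OF B(2)] T[OF B(2)]] by simp
    qed
    show "deriv T F C" using F(3) by (rule deriv_mono)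
  qed
  then show ?thesis by (simp add: proves_def)
qed

section \<open>Definable relations\<close>

text \<open>
  A relation on a countable structure is a predicate on valuations of de Bruijn indices. It is
  definable if for every naming \<open>\<nu>\<close> of the indices it is expressed by a $\Sigma^B_0$ formula, in
  which all elements of the structure are available as parameters: the names \<open>cname k\<close> are
  reserved for them. A quantifier becomes a rule of the form \<open>fdef_all\<close> below, which resolution
  applies by higher-order pattern unification.
\<close>

definition cname :: "nat \<Rightarrow> string" where "cname k = replicate k CHR ''c''"

text \<open>The length of a name is the code of the element it denotes; codes of nothing get a
  default, so that all values lie in the domain.\<close>

definition constN :: "('a::countable, 'b) struc \<Rightarrow> string \<Rightarrow> 'a" where
  "constN M s = (let a = from_nat (length s) in if a \<in> DN M then a else zer M)"
definition constS :: "('a, 'b::countable) struc \<Rightarrow> string \<Rightarrow> 'b" where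
  "constS M s = (let X = from_nat (length s) in if X \<in> DS M then X else (SOME X. X \<in> DS M))"

definition admissible :: "('a::countable, 'b) struc \<Rightarrow> (string \<Rightarrow> 'a) \<Rightarrow> bool" where
  "admissible M e \<longleftrightarrow> (\<forall>x. e x \<in> DN M) \<and> (\<forall>k. e (cname k) = constN M (cname k))"

definition naming :: "(nat \<Rightarrow> string) \<Rightarrow> bool" where
  "naming \<nu> \<longleftrightarrow> infinite (- (range \<nu> \<union> range cname))"

text \<open>Free names are controlled because a bounded quantifier must not bind a name occurring in
  its bounding term.\<close>

definition tdef :: "('a::countable, 'b::countable) struc \<Rightarrow> ((nat \<Rightarrow> 'a) \<Rightarrow> 'a) \<Rightarrow> bool" where
  "tdef M f \<longleftrightarrow> (\<forall>\<nu>. naming \<nu> \<longrightarrow> (\<exists>t. lcN t \<and> fvN_ntm t \<subseteq> range \<nu> \<union> range cname \<and>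
     (\<forall>e bn bs. admissible M e \<longrightarrow> evN M e (constS M) bn bs t = f (\<lambda>k. e (\<nu> k)))))"

definition fdef :: "('a::countable, 'b::countable) struc \<Rightarrow> ((nat \<Rightarrow> 'a) \<Rightarrow> bool) \<Rightarrow> bool" where
  "fdef M \<phi> \<longleftrightarrow> (\<forall>\<nu>. naming \<nu> \<longrightarrow> (\<exists>A. sigma0B A \<and>
     (\<forall>e bn bs. admissible M e \<longrightarrow> sat M e (constS M) bn bs A = \<phi> (\<lambda>k. e (\<nu> k)))))"

lemma cname_eq_iff [simp]: "cname k = cname l \<longleftrightarrow> k = l"
  by (metis cname_def length_replicate)

lemma constN [simp]: "c \<in> DN M \<Longrightarrow> constN M (cname (to_nat c)) = c"
  by (simp add: constN_def cname_def)
lemma constS [simp]: "X \<in> DS M \<Longrightarrow> constS M (cname (to_nat X)) = X"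
  by (simp add: constS_def cname_def)
lemma constN_in: "struc_ok M \<Longrightarrow> constN M s \<in> DN M"
  by (simp add: constN_def struc_ok_def Let_def)
lemma constS_in: "struc_ok M \<Longrightarrow> constS M s \<in> DS M"
  by (simp add: constS_def struc_ok_def Let_def some_in_eq)

lemma naming_const: "naming (\<lambda>_. z)"
proof -
  let ?S = "range (\<lambda>k. replicate (Suc k) CHR ''d'')"
  have "inj (\<lambda>k. replicate (Suc k) CHR ''d'')" by (rule injI) (metis length_replicate nat.inject)
  then have "infinite ?S" using finite_imageD infinite_UNIV_nat by blast
  then have "infinite (?S - {z})" by simp
  moreover have "?S - {z} \<subseteq> - (range (\<lambda>_::nat. z) \<union> range cname)"
    by (auto simp: cname_def Cons_replicate_eq)
  ultimately show ?thesis unfolding naming_def using finite_subset by blast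
qed

lemma naming_fresh: assumes "naming \<nu>" obtains x where "x \<notin> range \<nu>" "x \<notin> range cname"
proof -
  have "- (range \<nu> \<union> range cname) \<noteq> {}"
    using assms unfolding naming_def by (intro notI) simp
  then show ?thesis using that by auto
qed

lemma fdef_cong: "fdef M \<phi> \<Longrightarrow> (\<And>e. (\<forall>k. e k \<in> DN M) \<Longrightarrow> \<phi> e = \<psi> e) \<Longrightarrow> fdef M \<psi>"
  unfolding fdef_def by (simp add: admissible_def)

lemma tdef_var: "tdef M (\<lambda>e. e k)"
  unfolding tdef_def
proof (intro allI impI)
  fix \<nu> :: "nat \<Rightarrow> string"
  show "\<exists>t. lcN t \<and> fvN_ntm t \<subseteq> range \<nu> \<union> range cname \<and>
      (\<forall>e bn bs. admissible M e \<longrightarrow> evN M e (constS M) bn bs t = e (\<nu> k))"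
    by (rule exI[of _ "NV (\<nu> k)"]) simp
qed

lemma tdef_const: "c \<in> DN M \<Longrightarrow> tdef M (\<lambda>e. c)"
  unfolding tdef_def
  by (intro allI impI exI[of _ "NV (cname (to_nat c))"]) (auto simp: admissible_def)

lemma tdef_add: assumes "tdef M f" "tdef M g" shows "tdef M (\<lambda>e. add M (f e) (g e))"
  unfolding tdef_def
proof (intro allI impI)
  fix \<nu> assume "naming \<nu>"
  then obtain t u where "lcN t \<and> fvN_ntm t \<subseteq> range \<nu> \<union> range cname \<and>
      (\<forall>e bn bs. admissible M e \<longrightarrow> evN M e (constS M) bn bs t = f (\<lambda>k. e (\<nu> k)))"
    "lcN u \<and> fvN_ntm u \<subseteq> range \<nu> \<union> range cname \<and>
      (\<forall>e bn bs. admissible M e \<longrightarrow> evN M e (constS M) bn bs u = g (\<lambda>k. e (\<nu> k)))"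
    using assms unfolding tdef_def by meson
  then show "\<exists>v. lcN v \<and> fvN_ntm v \<subseteq> range \<nu> \<union> range cname \<and> (\<forall>e bn bs. admissible M e \<longrightarrow>
      evN M e (constS M) bn bs v = add M (f (\<lambda>k. e (\<nu> k))) (g (\<lambda>k. e (\<nu> k))))"
    by (intro exI[of _ "t \<^bold>+ u"]) simp
qed

lemma tdef_mul: assumes "tdef M f" "tdef M g" shows "tdef M (\<lambda>e. mul M (f e) (g e))"
  unfolding tdef_def
proof (intro allI impI)
  fix \<nu> assume "naming \<nu>"
  then obtain t u where "lcN t \<and> fvN_ntm t \<subseteq> range \<nu> \<union> range cname \<and>
      (\<forall>e bn bs. admissible M e \<longrightarrow> evN M e (constS M) bn bs t = f (\<lambda>k. e (\<nu> k)))"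
    "lcN u \<and> fvN_ntm u \<subseteq> range \<nu> \<union> range cname \<and>
      (\<forall>e bn bs. admissible M e \<longrightarrow> evN M e (constS M) bn bs u = g (\<lambda>k. e (\<nu> k)))"
    using assms unfolding tdef_def by meson
  then show "\<exists>v. lcN v \<and> fvN_ntm v \<subseteq> range \<nu> \<union> range cname \<and> (\<forall>e bn bs. admissible M e \<longrightarrow>
      evN M e (constS M) bn bs v = mul M (f (\<lambda>k. e (\<nu> k))) (g (\<lambda>k. e (\<nu> k))))"
    by (intro exI[of _ "t \<^bold>* u"]) simp
qed

lemma fdef_eq: assumes "tdef M f" "tdef M g" shows "fdef M (\<lambda>e. f e = g e)"
  unfolding fdef_def
proof (intro allI impI)
  fix \<nu> assume "naming \<nu>"
  then obtain t u where "lcN t" "lcN u"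
    "\<forall>e bn bs. admissible M e \<longrightarrow> evN M e (constS M) bn bs t = f (\<lambda>k. e (\<nu> k))"
    "\<forall>e bn bs. admissible M e \<longrightarrow> evN M e (constS M) bn bs u = g (\<lambda>k. e (\<nu> k))"
    using assms unfolding tdef_def by meson
  then show "\<exists>A. sigma0B A \<and> (\<forall>e bn bs. admissible M e \<longrightarrow>
      sat M e (constS M) bn bs A = (f (\<lambda>k. e (\<nu> k)) = g (\<lambda>k. e (\<nu> k))))"
    by (intro exI[of _ "t \<^bold>= u"]) (simp add: sigma0B.intros)
qed

lemma fdef_leq: assumes "tdef M f" "tdef M g" shows "fdef M (\<lambda>e. leq M (f e) (g e))"
  unfolding fdef_def
proof (intro allI impI)
  fix \<nu> assume "naming \<nu>"
  then obtain t u where "lcN t" "lcN u"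
    "\<forall>e bn bs. admissible M e \<longrightarrow> evN M e (constS M) bn bs t = f (\<lambda>k. e (\<nu> k))"
    "\<forall>e bn bs. admissible M e \<longrightarrow> evN M e (constS M) bn bs u = g (\<lambda>k. e (\<nu> k))"
    using assms unfolding tdef_def by meson
  then show "\<exists>A. sigma0B A \<and> (\<forall>e bn bs. admissible M e \<longrightarrow>
      sat M e (constS M) bn bs A = leq M (f (\<lambda>k. e (\<nu> k))) (g (\<lambda>k. e (\<nu> k))))"
    by (intro exI[of _ "t \<^bold>\<le> u"]) (simp add: sigma0B.intros)
qed

lemma fdef_mem: assumes "tdef M f" "X \<in> DS M" shows "fdef M (\<lambda>e. mem M (f e) X)"
  unfolding fdef_def
proof (intro allI impI)
  fix \<nu> assume "naming \<nu>"
  then obtain t where "lcN t"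
    "\<forall>e bn bs. admissible M e \<longrightarrow> evN M e (constS M) bn bs t = f (\<lambda>k. e (\<nu> k))"
    using assms unfolding tdef_def by meson
  then show "\<exists>A. sigma0B A \<and> (\<forall>e bn bs. admissible M e \<longrightarrow>
      sat M e (constS M) bn bs A = mem M (f (\<lambda>k. e (\<nu> k))) X)"
    by (intro exI[of _ "t \<^bold>\<in> SV (cname (to_nat X))"]) (simp add: sigma0B.intros assms(2))
qed

lemma fdef_False: "fdef M (\<lambda>e. False)"
  unfolding fdef_def by (intro allI impI exI[of _ Fls]) (simp add: sigma0B.intros)

lemma fdef_imp: assumes "fdef M \<phi>" "fdef M \<psi>" shows "fdef M (\<lambda>e. \<phi> e \<longrightarrow> \<psi> e)"
  unfolding fdef_def
proof (intro allI impI)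
  fix \<nu> assume "naming \<nu>"
  then obtain A B where "sigma0B A" "sigma0B B"
    "\<forall>e bn bs. admissible M e \<longrightarrow> sat M e (constS M) bn bs A = \<phi> (\<lambda>k. e (\<nu> k))"
    "\<forall>e bn bs. admissible M e \<longrightarrow> sat M e (constS M) bn bs B = \<psi> (\<lambda>k. e (\<nu> k))"
    using assms unfolding fdef_def by meson
  then show "\<exists>A. sigma0B A \<and> (\<forall>e bn bs. admissible M e \<longrightarrow>
      sat M e (constS M) bn bs A = (\<phi> (\<lambda>k. e (\<nu> k)) \<longrightarrow> \<psi> (\<lambda>k. e (\<nu> k))))"
    by (intro exI[of _ "A \<^bold>\<longrightarrow> B"]) (simp add: sigma0B.intros)
qed

lemma fdef_const: "fdef M (\<lambda>e. P)"
  using fdef_False[of M] fdef_imp[OF fdef_False fdef_False, of M] by (cases P) auto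

lemma fdef_not: "fdef M \<phi> \<Longrightarrow> fdef M (\<lambda>e. \<not> \<phi> e)"
  using fdef_imp[OF _ fdef_False, of M \<phi>] by simp

lemma fdef_disj: "fdef M \<phi> \<Longrightarrow> fdef M \<psi> \<Longrightarrow> fdef M (\<lambda>e. \<phi> e \<or> \<psi> e)"
  using fdef_imp[OF fdef_not, of M \<phi> \<psi>] by (simp add: imp_conv_disj)

lemma fdef_conj: "fdef M \<phi> \<Longrightarrow> fdef M \<psi> \<Longrightarrow> fdef M (\<lambda>e. \<phi> e \<and> \<psi> e)"
  using fdef_not[OF fdef_disj[OF fdef_not fdef_not], of M \<phi> \<psi>] by simp

lemma fdef_iff: "fdef M \<phi> \<Longrightarrow> fdef M \<psi> \<Longrightarrow> fdef M (\<lambda>e. \<phi> e \<longleftrightarrow> \<psi> e)"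
  using fdef_conj[OF fdef_imp fdef_imp, of M \<phi> \<psi> \<psi> \<phi>] by (simp add: iff_conv_conj_imp)

text \<open>Definability is required for every naming, so a renaming of indices is absorbed by
  composing the naming with \<open>r\<close>; no formula has to be substituted into.\<close>

lemma fdef_rename: assumes "fdef M \<phi>" shows "fdef M (\<lambda>e. \<phi> (\<lambda>k. e (r k)))"
  unfolding fdef_def
proof (intro allI impI)
  fix \<nu> assume \<nu>: "naming \<nu>"
  have "naming (\<lambda>k. \<nu> (r k))" unfolding naming_def
    by (rule infinite_super[OF _ \<nu>[unfolded naming_def]]) auto
  then show "\<exists>A. sigma0B A \<and> (\<forall>e bn bs. admissible M e \<longrightarrow>
      sat M e (constS M) bn bs A = \<phi> (\<lambda>k. e (\<nu> (r k))))"
    using assms unfolding fdef_def by (elim allE impE)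
qed

lemma tdef_rename: assumes "tdef M f" shows "tdef M (\<lambda>e. f (\<lambda>k. e (r k)))"
  unfolding tdef_def
proof (intro allI impI)
  fix \<nu> assume \<nu>: "naming \<nu>"
  have "naming (\<lambda>k. \<nu> (r k))" unfolding naming_def
    by (rule infinite_super[OF _ \<nu>[unfolded naming_def]]) auto
  then obtain t where "lcN t" "fvN_ntm t \<subseteq> range (\<lambda>k. \<nu> (r k)) \<union> range cname"
    "\<forall>e bn bs. admissible M e \<longrightarrow> evN M e (constS M) bn bs t = f (\<lambda>k. e (\<nu> (r k)))"
    using assms unfolding tdef_def by meson
  then show "\<exists>t. lcN t \<and> fvN_ntm t \<subseteq> range \<nu> \<union> range cname \<and> (\<forall>e bn bs. admissible M e \<longrightarrow>
      evN M e (constS M) bn bs t = f (\<lambda>k. e (\<nu> (r k))))" by (intro exI[of _ t]) auto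
qed

lemma fdef_all:
  assumes "tdef M f" "fdef M (\<lambda>e. \<psi> (e 0) (\<lambda>k. e (Suc k)))"
  shows "fdef M (\<lambda>e. \<forall>x\<in>DN M. leq M x (f e) \<longrightarrow> \<psi> x e)"
  unfolding fdef_def
proof (intro allI impI)
  fix \<nu> assume \<nu>: "naming \<nu>"
  then obtain t where t: "lcN t" "fvN_ntm t \<subseteq> range \<nu> \<union> range cname"
    "\<And>e bn bs. admissible M e \<Longrightarrow> evN M e (constS M) bn bs t = f (\<lambda>k. e (\<nu> k))"
    using assms(1) unfolding tdef_def by meson
  obtain x where x: "x \<notin> range \<nu>" "x \<notin> range cname" using naming_fresh[OF \<nu>] .
  \<comment> \<open>Index 0 gets the fresh name and the old indices move up by one, matching
    \<open>e 0\<close> and \<open>e (Suc k)\<close> in the assumption.\<close>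
  let ?\<nu> = "case_nat x \<nu>"
  have "range ?\<nu> \<subseteq> insert x (range \<nu>)" by (auto split: nat.splits)
  then have "- (range \<nu> \<union> range cname) - {x} \<subseteq> - (range ?\<nu> \<union> range cname)" by auto
  moreover have "infinite (- (range \<nu> \<union> range cname) - {x})" using \<nu> unfolding naming_def by simp
  ultimately have "naming ?\<nu>" unfolding naming_def using finite_subset by blast
  then obtain A where A: "sigma0B A"
    "\<And>e bn bs. admissible M e \<Longrightarrow>
       sat M e (constS M) bn bs A = \<psi> (e (?\<nu> 0)) (\<lambda>k. e (?\<nu> (Suc k)))"
    using assms(2) unfolding fdef_def by meson
  show "\<exists>A. sigma0B A \<and> (\<forall>e bn bs. admissible M e \<longrightarrow>
      sat M e (constS M) bn bs A = (\<forall>x\<in>DN M. leq M x (f (\<lambda>k. e (\<nu> k))) \<longrightarrow> \<psi> x (\<lambda>k. e (\<nu> k))))"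
  proof (intro exI conjI allI impI)
    have xt: "x \<notin> fvN_ntm t" using t x by auto
    show "sigma0B (\<^bold>\<forall>\<^sub>N[x]. NV x \<^bold>\<le> t \<^bold>\<longrightarrow> A)" using A t xt by (intro sigma0B.intros)
    fix e bn bs assume e: "admissible M e"
    have "admissible M (e(x := d))" if "d \<in> DN M" for d
      using e x that by (auto simp: admissible_def)
    moreover have "(\<lambda>k. (e(x := d)) (\<nu> k)) = (\<lambda>k. e (\<nu> k))" for d
    proof -
      have "\<nu> k \<noteq> x" for k using x by auto
      then show ?thesis by simp
    qed
    ultimately show "sat M e (constS M) bn bs (\<^bold>\<forall>\<^sub>N[x]. NV x \<^bold>\<le> t \<^bold>\<longrightarrow> A) =
        (\<forall>x\<in>DN M. leq M x (f (\<lambda>k. e (\<nu> k))) \<longrightarrow> \<psi> x (\<lambda>k. e (\<nu> k)))"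
      by (simp add: t(3) A(2) del: fun_upd_apply) simp
  qed
qed

lemma fdef_ex:
  assumes "tdef M f" "fdef M (\<lambda>e. \<psi> (e 0) (\<lambda>k. e (Suc k)))"
  shows "fdef M (\<lambda>e. \<exists>x\<in>DN M. leq M x (f e) \<and> \<psi> x e)"
  using fdef_not[OF fdef_all[OF assms(1), of "\<lambda>x e. \<not> \<psi> x e"]] fdef_not[OF assms(2)] by simp

lemma modelsD:
  "models M T \<Longrightarrow> A \<in> T \<Longrightarrow> (\<And>x. e x \<in> DN M) \<Longrightarrow> (\<And>X. es X \<in> DS M) \<Longrightarrow> sat M e es bn bs A"
  by (simp add: models_def)

lemma comprehension:
  assumes M: "models M V0" and \<phi>: "fdef M \<phi>" and b: "b \<in> DN M"
  shows "\<exists>X\<in>DS M. leq M (len M X) b \<and>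
    (\<forall>a\<in>DN M. leq M a b \<and> a \<noteq> b \<longrightarrow> (mem M a X \<longleftrightarrow> \<phi> (\<lambda>_. a)))"
proof -
  have ok: "struc_ok M" using M by (simp add: models_def)
  \<comment> \<open>Neither the comprehension variable nor its bound may be a parameter name, since
    changing their values must keep the environment admissible.\<close>
  let ?z = "''z''"
  have "?z \<noteq> replicate k CHR ''c''" for k by (cases k) simp_all
  then have z: "?z \<notin> range cname" by (auto simp: cname_def)
  obtain A where A: "sigma0B A"
    "\<And>e bn bs. admissible M e \<Longrightarrow> sat M e (constS M) bn bs A = \<phi> (\<lambda>_. e ?z)"
    using \<phi> naming_const[of ?z] unfolding fdef_def by meson
  obtain y where y: "y \<noteq> ?z" "y \<notin> range cname" using naming_fresh[OF naming_const[of ?z]] by auto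
  obtain X where X: "X \<notin> fvS A" using fresh_string[OF finite_fvS] by blast
  let ?C = "\<^bold>\<exists>\<^sub>S[X]. \<^bold>|SV X\<^bold>| \<^bold>\<le> NV y \<^bold>\<and> (\<^bold>\<forall>\<^sub>N[?z]. NV ?z \<^bold>< NV y \<^bold>\<longrightarrow> (NV ?z \<^bold>\<in> SV X \<^bold>\<longleftrightarrow> A))"
  have "?C \<in> V0" unfolding V0_def sigma0B_COMP_def using A(1) X y(1)
    by (intro UnI2 CollectI exI[of _ X] exI[of _ y] exI[of _ ?z] exI[of _ A]) simp
  with M have "sat M ((constN M)(y := b)) (constS M) bn bs ?C" for bn bs
    by (rule modelsD) (simp_all add: b constN_in[OF ok] constS_in[OF ok])
  from this[of undefined undefined] obtain S where S: "S \<in> DS M" "leq M (len M S) b"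
    and *: "\<forall>a\<in>DN M. leq M a b \<and> a \<noteq> b \<longrightarrow> (mem M a S \<longleftrightarrow>
      sat M ((constN M)(y := b, ?z := a)) ((constS M)(X := S)) (case_nat a undefined) (case_nat S undefined) A)"
    using y(1) by auto
  have "sat M ((constN M)(y := b, ?z := a)) ((constS M)(X := S)) (case_nat a undefined) (case_nat S undefined) A
      \<longleftrightarrow> \<phi> (\<lambda>_. a)" if "a \<in> DN M" for a
  proof -
    have "cname k \<noteq> ?z" "cname k \<noteq> y" for k using z y(2) by (metis rangeI)+
    then have "admissible M ((constN M)(y := b, ?z := a))"
      using b that constN_in[OF ok] by (simp add: admissible_def)
    from A(2)[OF this, of undefined undefined] show ?thesis
      by (subst sat_cong[OF sigma0B_lv[OF A(1)], where es' = "constS M" and bn' = undefined and bs' = undefined])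
        (use X in auto)
  qed
  then show ?thesis using S * by blast
qed

section \<open>A generic countermodel\<close>

lemma lv_two_BASIC: "A \<in> two_BASIC \<Longrightarrow> lv 0 0 A"
  by (auto simp: two_BASIC_def Let_def)

lemma lv_V0: "A \<in> V0 \<Longrightarrow> lv 0 0 A"
  by (auto simp: V0_def sigma0B_COMP_def lv_two_BASIC sigma0B_lv)

subsection \<open>Isomorphisms\<close>

text \<open>Only the numbers are recoded and the sets are literally the same, which is the situation
  in both changes of representation below.\<close>

definition iso :: "('a \<Rightarrow> 'c) \<Rightarrow> ('a, 'b) struc \<Rightarrow> ('c, 'b) struc \<Rightarrow> bool" where
  "iso h M M' \<longleftrightarrow> struc_ok M \<and> inj_on h (DN M) \<and> h ` DN M = DN M' \<and> DS M = DS M' \<and>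
    h (zer M) = zer M' \<and> h (one M) = one M' \<and>
    (\<forall>a\<in>DN M. \<forall>b\<in>DN M. h (add M a b) = add M' (h a) (h b) \<and> h (mul M a b) = mul M' (h a) (h b) \<and>
      (leq M' (h a) (h b) \<longleftrightarrow> leq M a b)) \<and>
    (\<forall>X\<in>DS M. h (len M X) = len M' X) \<and> (\<forall>a\<in>DN M. \<forall>X\<in>DS M. mem M' (h a) X \<longleftrightarrow> mem M a X)"

lemma isoD:
  assumes "iso h M M'"
  shows "struc_ok M" "inj_on h (DN M)" "DN M' = h ` DN M" "DS M' = DS M" "zer M' = h (zer M)" "one M' = h (one M)"
    "a \<in> DN M \<Longrightarrow> b \<in> DN M \<Longrightarrow> add M' (h a) (h b) = h (add M a b)"
    "a \<in> DN M \<Longrightarrow> b \<in> DN M \<Longrightarrow> mul M' (h a) (h b) = h (mul M a b)"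
    "a \<in> DN M \<Longrightarrow> b \<in> DN M \<Longrightarrow> leq M' (h a) (h b) = leq M a b"
    "X \<in> DS M \<Longrightarrow> len M' X = h (len M X)" "a \<in> DN M \<Longrightarrow> X \<in> DS M \<Longrightarrow> mem M' (h a) X = mem M a X"
  using assms by (simp_all add: iso_def)

lemma struc_okD:
  assumes "struc_ok M"
  shows "zer M \<in> DN M" "one M \<in> DN M" "a \<in> DN M \<Longrightarrow> b \<in> DN M \<Longrightarrow> add M a b \<in> DN M"
    "a \<in> DN M \<Longrightarrow> b \<in> DN M \<Longrightarrow> mul M a b \<in> DN M" "X \<in> DS M \<Longrightarrow> len M X \<in> DN M"
  using assms by (simp_all add: struc_ok_def)

lemma struc_ok_iso: assumes iso: "iso h M M'" shows "struc_ok M'"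
proof -
  have "DS M \<noteq> {}" using isoD(1)[OF iso] by (simp add: struc_ok_def)
  then show ?thesis
    unfolding struc_ok_def using struc_okD[OF isoD(1)[OF iso]] by (auto simp: isoD(3-)[OF iso])
qed

lemma evS_in: "\<forall>X. es X \<in> D \<Longrightarrow> \<forall>k. bs k \<in> D \<Longrightarrow> evS es bs U \<in> D"
  by (cases U) auto

lemma evN_in:
  assumes "struc_ok M" "\<forall>x. e x \<in> DN M" "\<forall>X. es X \<in> DS M" "\<forall>k. bn k \<in> DN M" "\<forall>k. bs k \<in> DS M"
  shows "evN M e es bn bs t \<in> DN M"
  by (induction t) (simp_all add: struc_okD[OF assms(1)] evS_in assms(2-))

lemma evN_iso:
  assumes "iso h M M'" "\<forall>x. e x \<in> DN M" "\<forall>X. es X \<in> DS M" "\<forall>k. bn k \<in> DN M" "\<forall>k. bs k \<in> DS M"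
  shows "evN M' (\<lambda>x. h (e x)) es (\<lambda>k. h (bn k)) bs t = h (evN M e es bn bs t)"
  by (induction t) (simp_all add: isoD[OF assms(1)] evN_in[OF isoD(1)[OF assms(1)] assms(2-)] evS_in[OF assms(3,5)])

lemma sat_iso:
  assumes iso: "iso h M M'" and "\<forall>x. e x \<in> DN M"
  shows "\<forall>X. es X \<in> DS M \<Longrightarrow> \<forall>k. bn k \<in> DN M \<Longrightarrow> \<forall>k. bs k \<in> DS M \<Longrightarrow>
    sat M' (\<lambda>x. h (e x)) es (\<lambda>k. h (bn k)) bs A = sat M e es bn bs A"
proof (induction A arbitrary: bn bs)
  case (EqN t u)
  note ev = evN_iso[OF iso assms(2) EqN.prems] evN_in[OF isoD(1)[OF iso] assms(2) EqN.prems]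
  show ?case using isoD(2)[OF iso] by (simp add: ev inj_on_eq_iff)
next
  case (Le t u)
  note ev = evN_iso[OF iso assms(2) Le.prems] evN_in[OF isoD(1)[OF iso] assms(2) Le.prems]
  show ?case by (simp add: ev isoD(9)[OF iso])
next
  case (Mem t X)
  note ev = evN_iso[OF iso assms(2) Mem.prems] evN_in[OF isoD(1)[OF iso] assms(2) Mem.prems]
  show ?case using Mem.prems(1,3) by (simp add: ev isoD(11)[OF iso] evS_in)
next
  case (AllN A)
  have "(\<lambda>k. h (case_nat d bn k)) = case_nat (h d) (\<lambda>k. h (bn k))" for d
    by (auto split: nat.split)
  then have "sat M' (\<lambda>x. h (e x)) es (case_nat (h d) (\<lambda>k. h (bn k))) bs A = sat M e es (case_nat d bn) bs A"
    if "d \<in> DN M" for d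
    using AllN.IH[of "case_nat d bn" bs] AllN.prems that by (auto split: nat.split)
  moreover have "DN M' = h ` DN M" using iso by (simp add: iso_def)
  ultimately show ?case by simp
next
  case (AllS A)
  have "sat M' (\<lambda>x. h (e x)) es (\<lambda>k. h (bn k)) (case_nat d bs) A = sat M e es bn (case_nat d bs) A"
    if "d \<in> DS M" for d
    using AllS.prems that by (intro AllS.IH) (auto split: nat.split)
  moreover have "DS M' = DS M" using iso by (simp add: iso_def)
  ultimately show ?case by simp
qed simp_all

text \<open>\<open>sat_iso\<close> wants stacks with values in the domains; local closedness permits
  replacing arbitrary stacks by constant ones.\<close>

lemma models_iso:
  assumes iso: "iso h M M'" and lv: "\<And>A. A \<in> T \<Longrightarrow> lv 0 0 A"
  shows "models M' T \<longleftrightarrow> models M T"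
proof -
  have ok: "struc_ok M" "struc_ok M'" using iso struc_ok_iso by (auto simp: iso_def)
  obtain X0 where X0: "X0 \<in> DS M" using ok by (auto simp: struc_ok_def)
  have z: "zer M \<in> DN M" using ok by (simp add: struc_ok_def)
  have *: "sat M' (\<lambda>x. h (e x)) es bn' bs' A = sat M e es bn bs A"
    if "A \<in> T" "\<forall>x. e x \<in> DN M" "\<forall>X. es X \<in> DS M" for A e es bn bs bn' bs'
    using sat_iso[OF iso that(2,3), of "\<lambda>_. zer M" "\<lambda>_. X0" A] X0 z
      sat_cong[OF lv[OF that(1)], of e e es es bn "\<lambda>_. zer M" bs "\<lambda>_. X0" M]
      sat_cong[OF lv[OF that(1)], of "\<lambda>x. h (e x)" "\<lambda>x. h (e x)" es es bn' "\<lambda>_. h (zer M)" bs' "\<lambda>_. X0" M']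
    by simp
  have DS: "DS M' = DS M" and DN: "h ` DN M = DN M'" using isoD[OF iso] by simp_all
  show ?thesis
  proof
    assume M': "models M' T"
    show "models M T" unfolding models_def
    proof (intro conjI ballI allI impI)
      fix A bn bs and e es assume "A \<in> T" "\<forall>x::string. e x \<in> DN M" "\<forall>X::string. es X \<in> DS M"
      moreover from this have "sat M' (\<lambda>x. h (e x)) es undefined undefined A"
        using DN DS by (intro modelsD[OF M']) auto
      ultimately show "sat M e es bn bs A" using * by blast
    qed (rule ok)
  next
    assume M: "models M T"
    show "models M' T" unfolding models_def
    proof (intro conjI ballI allI impI)
      fix A bn bs and e es assume A: "A \<in> T" "\<forall>x::string. e x \<in> DN M'" "\<forall>X::string. es X \<in> DS M'"
      define e' where "e' = (\<lambda>x. inv_into (DN M) h (e x))"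
      have e': "\<forall>x. e' x \<in> DN M" "(\<lambda>x. h (e' x)) = e"
        using A(2) DN by (auto simp: e'_def inv_into_into f_inv_into_f)
      have "sat M e' es undefined undefined A"
        using A e' DS by (intro modelsD[OF M]) auto
      then show "sat M' e es bn bs A" using *[OF A(1) e'(1), of es bn bs undefined undefined] A(3) DS e'(2) by simp
    qed (rule ok)
  qed
qed

subsection \<open>The standard model\<close>

text \<open>Finite sets of naturals are coded by binary expansions. The model ensures that the
  choice of a countermodel has a candidate even for a valid formula.\<close>

definition standard :: "(nat, nat) struc" where
  "standard = \<lparr>DN = UNIV, DS = UNIV, zer = 0, one = 1, add = (+), mul = (*), leq = (\<le>),
    len = (\<lambda>X. if set_decode X = {} then 0 else Suc (Max (set_decode X))), mem = (\<lambda>a X. a \<in> set_decode X)\<rparr>"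

lemma standard_simps [simp]:
  "DN standard = UNIV" "DS standard = UNIV" "leq standard a b \<longleftrightarrow> a \<le> b" "mem standard a X \<longleftrightarrow> a \<in> set_decode X"
  "len standard X = (if set_decode X = {} then 0 else Suc (Max (set_decode X)))"
  by (simp_all add: standard_def)

lemma standard_models: "models standard V0"
  unfolding models_def
proof (intro conjI ballI allI impI)
  show "struc_ok standard" by (simp add: standard_def struc_ok_def)
  fix A bn bs and e es :: "string \<Rightarrow> nat"
  assume "A \<in> V0"
  then consider "A \<in> two_BASIC" | X y z B where "y \<noteq> z" "sigma0B B" "X \<notin> fvS B"
      "A = (\<^bold>\<exists>\<^sub>S[X]. \<^bold>|SV X\<^bold>| \<^bold>\<le> NV y \<^bold>\<and> (\<^bold>\<forall>\<^sub>N[z]. NV z \<^bold>< NV y \<^bold>\<longrightarrow> (NV z \<^bold>\<in> SV X \<^bold>\<longleftrightarrow> B)))"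
    unfolding V0_def sigma0B_COMP_def by blast
  then show "sat standard e es bn bs A"
  proof cases
    case 1
    have lt: "y \<le> Suc (Max (set_decode X)) \<and> y \<noteq> Suc (Max (set_decode X))" if "y \<in> set_decode X" for X y
      using Max_ge[OF finite_set_decode that] by simp
    have max: "Max (set_decode X) \<in> set_decode X" if "set_decode X \<noteq> {}" for X
      using that by (simp add: Max_in)
    have ext: "X = Y" if "set_decode X = {} \<longleftrightarrow> set_decode Y = {}"
      "set_decode X \<noteq> {} \<Longrightarrow> Max (set_decode X) = Max (set_decode Y)"
      "\<forall>d. d \<le> Max (set_decode X) \<longrightarrow> (d \<in> set_decode X \<longleftrightarrow> d \<in> set_decode Y)" for X Y
    proof -
      have "d \<in> set_decode X \<longleftrightarrow> d \<in> set_decode Y" for d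
        using that Max_ge[of "set_decode X" d] Max_ge[of "set_decode Y" d] by (metis empty_iff finite_set_decode)
      then have "set_decode X = set_decode Y" by blast
      then show ?thesis by (metis set_decode_inverse)
    qed
    have pred: "\<exists>d\<le>a. Suc d = a" if "0 < a" for a :: nat
      using that by (intro exI[of _ "a - 1"]) simp
    show ?thesis using 1 unfolding two_BASIC_def Let_def
    proof (elim insertE emptyE, simp_all add: standard_def, goal_cases)
      case 1 show ?case by (rule nat_le_linear)
    next
      case 2 show ?case by auto
    next
      case 3 show ?case by (intro impI pred)
    next
      case 4 show ?case by (intro impI lt)
    next
      case 5 show ?case
      proof (intro conjI impI)
        show "es ''X'' = es ''Y''" if "set_decode (es ''X'') = {}" "set_decode (es ''Y'') = {}"
          using ext[of "es ''X''" "es ''Y''"] that by simp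
      next
        assume "set_decode (es ''X'') \<noteq> {}" "set_decode (es ''Y'') \<noteq> {}" and
          "Max (set_decode (es ''X'')) = Max (set_decode (es ''Y'')) \<and>
           (\<forall>d. d \<le> Suc (Max (set_decode (es ''X''))) \<and> d \<noteq> Suc (Max (set_decode (es ''X''))) \<longrightarrow>
              (d \<in> set_decode (es ''X'')) = (d \<in> set_decode (es ''Y'')))"
        then show "es ''X'' = es ''Y''" by (intro ext[of "es ''X''" "es ''Y''"]) (simp_all add: le_SucI)
      qed
    qed
  next
    case 2
    \<comment> \<open>The set is formed in HOL, with no regard to the complexity of
      \<open>B\<close>. As \<open>X\<close> is not free in \<open>B\<close>, interpreting
      \<open>X\<close> by this set does not change the truth of \<open>B\<close>.\<close>
    define S where "S = {d. d < e y \<and> sat standard (e(z := d)) es (case_nat d bn) bs B}"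
    have fin: "finite S" by (simp add: S_def)
    have S: "d \<in> S \<longleftrightarrow> d < e y \<and> sat standard (e(z := d)) es (case_nat d bn) bs B" for d
      by (simp add: S_def)
    have *: "sat standard (e(z := d)) es (case_nat d bn) bs B =
        sat standard (e(z := d)) (es(X := set_encode S)) (case_nat d bn) (case_nat (set_encode S) bs) B" for d
      by (rule sat_cong[OF sigma0B_lv[OF 2(2)]]) (use 2 in auto)
    have "\<forall>d. d < e y \<longrightarrow> (d \<in> set_decode (set_encode S) \<longleftrightarrow>
        sat standard (e(z := d)) (es(X := set_encode S)) (case_nat d bn) (case_nat (set_encode S) bs) B)"
      using fin S by (simp flip: *)
    moreover have "(if S = {} then 0 else Suc (Max S)) \<le> e y"
      using Max_in[OF fin] S by (auto simp: Suc_le_eq)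
    ultimately show ?thesis using 2(1) set_encode_inverse[OF fin] unfolding 2(4)
      by (simp del: set_encode_empty split del: if_split) (intro exI[of _ "set_encode S"], simp add: nat_less_le del: set_encode_empty split: if_splits)
  qed
qed

text \<open>Refutes \<open>C\<close> as soon as some model on \<open>nat\<close> does. Being a
  closed term once \<open>C\<close> is given, it can serve in a type definition.\<close>

definition countermodel :: "fm \<Rightarrow> (nat, nat) struc" where
  "countermodel C = (SOME M. models M V0 \<and> ((\<exists>M :: (nat, nat) struc. models M V0 \<and> \<not> models M {C}) \<longrightarrow> \<not> models M {C}))"

lemma countermodel:
  "models (countermodel C) V0 \<and> (models (countermodel C) {C} \<longrightarrow> (\<forall>M :: (nat, nat) struc. models M V0 \<longrightarrow> models M {C}))"
proof -
  have "\<exists>M :: (nat, nat) struc. models M V0 \<and> ((\<exists>M :: (nat, nat) struc. models M V0 \<and> \<not> models M {C}) \<longrightarrow> \<not> models M {C})"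
    (is "\<exists>M. ?P M \<and> (?Q \<longrightarrow> ?R M)")
  proof (cases ?Q)
    case True
    then obtain M :: "(nat, nat) struc" where "models M V0" "\<not> models M {C}" by (elim exE conjE)
    then show ?thesis by (intro exI[of _ M]) simp
  next
    case False
    then show ?thesis using standard_models by (intro exI[of _ standard]) simp
  qed
  from someI_ex[OF this] show ?thesis unfolding countermodel_def by blast
qed

lemma provable_if_countermodel:
  assumes "lv 0 0 C" "fvN C = {}" "fvS C = {}" "models (countermodel C) {C}"
  shows "V0 \<^bold>\<turnstile> C"
proof (rule completeness[OF _ assms(1-3)])
  show "models M {C}" if "models M V0" for M :: "(nat, nat) struc"
    using countermodel[of C] assms(4) that by blast
qed (rule lv_V0)

section \<open>The numbers of the countermodel\<close>

text \<open>The statement gets a name of its own because the model fixed next depends on it.\<close>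

definition jct :: fm where
  "jct = (let n = NV ''n''; t = NV ''t''; P = SV ''P''; P' = SV ''P3'';
         p1 = (NV ''x1'', NV ''y1''); p2 = (NV ''x2'', NV ''y2''); p = (NV ''x'', NV ''y'');
         s = NV ''s''; R = SV ''R'' in
     \<^bold>\<forall>\<^sub>N[''n'', ''t'']. \<^bold>\<forall>\<^sub>S[''P'', ''P3'']. \<^bold>\<forall>\<^sub>N[''x1'', ''y1'', ''x2'', ''y2'', ''x'', ''y''].
       closed_curve n t P \<^bold>\<and> avoids_border n t P \<^bold>\<and> tripled n t P P' \<^bold>\<and>
       in_grid (thrice n) p1 \<^bold>\<and> in_grid (thrice n) p2 \<^bold>\<and>
       different_sides (thrice t) P' p1 p2 \<^bold>\<and>
       in_grid (thrice n) p \<^bold>\<and> degree0 (thrice t) P' p \<^bold>\<longrightarrow>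
       (\<^bold>\<exists>\<^sub>N[''s'']. \<^bold>\<exists>\<^sub>S[''R''].
         (connects (thrice n) s R p p1 \<^bold>\<or> connects (thrice n) s R p p2) \<^bold>\<and>
         \<^bold>\<not> intersect s R (thrice t) P'))"

text \<open>
  With a model of $V^0$ fixed globally, one in which the theorem fails if there is any, its numbers
  form a type, and the arithmetic of $V^0$ is available through type classes.
\<close>

definition M0 :: "(nat, nat) struc" where "M0 = countermodel jct"

lemma M0: "models M0 V0" "struc_ok M0"
  using countermodel[of jct] by (simp_all add: M0_def models_def)

typedef vnat = "DN M0"
  using M0(2) by (auto simp: struc_ok_def)

setup_lifting type_definition_vnat

instance vnat :: countable
  by (rule countable_classI[of Rep_vnat]) (simp add: Rep_vnat_inject)

instantiation vnat :: "{zero, one, plus, times, ord, minus}"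
begin
lift_definition zero_vnat :: vnat is "zer M0" by (rule struc_okD[OF M0(2)])
lift_definition one_vnat :: vnat is "one M0" by (rule struc_okD[OF M0(2)])
lift_definition plus_vnat :: "vnat \<Rightarrow> vnat \<Rightarrow> vnat" is "add M0" by (rule struc_okD[OF M0(2)])
lift_definition times_vnat :: "vnat \<Rightarrow> vnat \<Rightarrow> vnat" is "mul M0" by (rule struc_okD[OF M0(2)])
lift_definition less_eq_vnat :: "vnat \<Rightarrow> vnat \<Rightarrow> bool" is "leq M0" .
definition less_vnat :: "vnat \<Rightarrow> vnat \<Rightarrow> bool" where "less_vnat a b \<longleftrightarrow> a \<le> b \<and> a \<noteq> b"
text \<open>Truncated subtraction, demanded by the class of ordered semidomains; it has no symbol in
  the language and is obtained by choice.\<close>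

definition minus_vnat :: "vnat \<Rightarrow> vnat \<Rightarrow> vnat" where
  "minus_vnat a b = (if b \<le> a then SOME c. b + c = a else 0)"
instance ..
end

definition MN :: "(vnat, nat) struc" where
  "MN = \<lparr>DN = UNIV, DS = DS M0, zer = 0, one = 1, add = (+), mul = (*), leq = (\<le>),
     len = (\<lambda>X. Abs_vnat (len M0 X)), mem = (\<lambda>a X. mem M0 (Rep_vnat a) X)\<rparr>"

lemma MN_simps [simp]:
  "DN MN = UNIV" "zer MN = 0" "one MN = 1" "add MN = (+)" "mul MN = (*)" "leq MN = (\<le>)"
  by (simp_all add: MN_def)

lemma iso_MN: "iso Rep_vnat MN M0"
proof -
  have "range Rep_vnat = DN M0" using type_definition.Rep_range[OF type_definition_vnat] .
  then show ?thesis using M0(2)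
    by (simp add: iso_def MN_def struc_ok_def inj_on_def Rep_vnat_inject zero_vnat.rep_eq one_vnat.rep_eq
      plus_vnat.rep_eq times_vnat.rep_eq less_eq_vnat.rep_eq Abs_vnat_inverse)
qed

lemma MN: "models MN V0" "struc_ok MN"
  using models_iso[OF iso_MN lv_V0] M0 by (auto simp: models_def)

lemma BASIC_aux:
  fixes x y :: vnat
  assumes XY: "X \<in> DS MN" "Y \<in> DS MN"
  shows "x + 1 \<noteq> 0" "x + 1 = y + 1 \<longrightarrow> x = y" "x + 0 = x" "x + (y + 1) = x + y + 1" "x * 0 = 0"
    "x * (y + 1) = x * y + x" "x \<le> y \<and> y \<le> x \<longrightarrow> x = y" "x \<le> x + y" "0 \<le> x" "x \<le> y \<or> y \<le> x"
    "x \<le> y \<longleftrightarrow> x < y + 1" "x \<noteq> 0 \<longrightarrow> (\<exists>y\<le>x. y + 1 = x)" "mem MN y X \<longrightarrow> y < len MN X"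
    "y + 1 = len MN X \<longrightarrow> mem MN y X"
proof -
  let ?e = "\<lambda>s. if s = ''x'' then x else y" and ?es = "\<lambda>s. if s = ''X'' then X else Y"
  have "\<forall>A\<in>two_BASIC. sat MN ?e ?es undefined undefined A"
    using XY by (intro ballI modelsD[OF MN(1)]) (auto simp: V0_def)
  then have B: "x + 1 \<noteq> 0 \<and> (x + 1 = y + 1 \<longrightarrow> x = y) \<and> x + 0 = x \<and> x + (y + 1) = x + y + 1 \<and> x * 0 = 0 \<and>
    x * (y + 1) = x * y + x \<and> (x \<le> y \<and> y \<le> x \<longrightarrow> x = y) \<and> x \<le> x + y \<and> 0 \<le> x \<and> (x \<le> y \<or> y \<le> x) \<and>
    (x \<le> y \<longleftrightarrow> x \<le> y + 1 \<and> x \<noteq> y + 1) \<and> (x \<noteq> 0 \<longrightarrow> (\<exists>y. y \<le> x \<and> y + 1 = x)) \<and>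
    (mem MN y X \<longrightarrow> y \<le> len MN X \<and> y \<noteq> len MN X) \<and> (y + 1 = len MN X \<longrightarrow> mem MN y X)"
    unfolding two_BASIC_def Let_def ball_simps by (simp, metis)
  show "x + 1 \<noteq> 0" "x + 1 = y + 1 \<longrightarrow> x = y" "x + 0 = x" "x + (y + 1) = x + y + 1" "x * 0 = 0"
    "x * (y + 1) = x * y + x" "x \<le> y \<and> y \<le> x \<longrightarrow> x = y" "x \<le> x + y" "0 \<le> x" "x \<le> y \<or> y \<le> x"
    "x \<le> y \<longleftrightarrow> x < y + 1" "x \<noteq> 0 \<longrightarrow> (\<exists>y\<le>x. y + 1 = x)" "mem MN y X \<longrightarrow> y < len MN X"
    "y + 1 = len MN X \<longrightarrow> mem MN y X"
    unfolding less_vnat_def by - (insert B, (elim conjE, assumption)+)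
qed

lemmas BASIC = BASIC_aux[rule_format]

lemma ex_DS: "\<exists>X. X \<in> DS MN" using MN(2) by (auto simp: struc_ok_def)

text \<open>The arithmetical axioms do not mention the sets, whose places are filled by an arbitrary
  element of the set sort.\<close>

lemmas basic = BASIC[OF someI_ex[OF ex_DS] someI_ex[OF ex_DS]]

section \<open>Definable induction over the numbers of the model\<close>

lemma vnat_tdef:
  "tdef MN (\<lambda>e. e k)" "tdef MN (\<lambda>e. c)" "tdef MN f \<Longrightarrow> tdef MN g \<Longrightarrow> tdef MN (\<lambda>e. f e + g e)"
  "tdef MN f \<Longrightarrow> tdef MN g \<Longrightarrow> tdef MN (\<lambda>e. f e * g e)"
  using tdef_add[of MN f g] tdef_mul[of MN f g] by (simp_all add: tdef_var tdef_const)

lemma vnat_fdef: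
  "tdef MN f \<Longrightarrow> tdef MN g \<Longrightarrow> fdef MN (\<lambda>e. f e \<le> g e)"
  "tdef MN f \<Longrightarrow> tdef MN g \<Longrightarrow> fdef MN (\<lambda>e. f e = g e)"
  "tdef MN f \<Longrightarrow> fdef MN (\<lambda>e. \<psi> (e 0) (\<lambda>k. e (Suc k))) \<Longrightarrow> fdef MN (\<lambda>e. \<forall>x\<le>f e. \<psi> x e)"
  "tdef MN f \<Longrightarrow> fdef MN (\<lambda>e. \<psi> (e 0) (\<lambda>k. e (Suc k))) \<Longrightarrow> fdef MN (\<lambda>e. \<exists>x\<le>f e. \<psi> x e)"
  using fdef_leq[of MN f g] fdef_all[of MN f \<psi>] fdef_ex[of MN f \<psi>] by (simp_all add: fdef_eq)

lemmas vdef = vnat_tdef vnat_fdef fdef_imp fdef_conj fdef_disj fdef_not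

lemma vnat_less_1: "x < y + 1 \<longleftrightarrow> x \<le> (y :: vnat)"
  using basic(11) by simp

lemma vnat_refl: "x \<le> (x :: vnat)"
  using basic(8)[of x 0] by (simp only: basic(3))

lemma vnat_lessD: assumes "x < y" shows "x + 1 \<le> (y :: vnat)"
proof (rule ccontr)
  assume n: "\<not> x + 1 \<le> y"
  then have "y \<le> x + 1" "y \<noteq> x + 1" using basic(10)[of y "x + 1"] vnat_refl by auto
  then have "y \<le> x" using vnat_less_1[of y x] by (simp add: less_vnat_def)
  then show False using assms basic(7)[of x y] by (simp add: less_vnat_def)
qed

lemma vnat_le_cancel1: assumes "x + 1 \<le> y + 1" shows "x \<le> (y :: vnat)"
proof (rule ccontr)
  assume "\<not> x \<le> y"
  then have "y < x" using basic(10)[of x y] vnat_refl by (auto simp: less_vnat_def)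
  then have "y + 1 \<le> x" by (rule vnat_lessD)
  then have "y + 1 < x + 1" by (simp add: vnat_less_1)
  then show False using assms basic(7)[of "x + 1" "y + 1"] by (simp add: less_vnat_def)
qed

text \<open>Sigma^B_0 induction from comprehension and the length axioms. If \<phi> fails at
  \<open>x\<close>, collect the \<open>a \<le> x\<close> up to which \<phi> holds throughout. The
  predecessor of the length of this set is its largest element, yet the induction step puts the next
  number into it as well.\<close>

lemma vnat_induct:
  assumes "fdef MN (\<lambda>e. \<phi> (e 0))" "\<phi> 0" "\<And>x. \<phi> x \<Longrightarrow> \<phi> (x + 1)"
  shows "\<phi> x"
proof (rule ccontr)
  assume x: "\<not> \<phi> x"
  have "fdef MN (\<lambda>e. \<forall>y\<le>e 0. \<phi> y)"
    by (rule vdef, rule vdef, rule assms(1))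
  from comprehension[OF MN(1) this, of "x + 1"] obtain X where X: "X \<in> DS MN" "len MN X \<le> x + 1"
    and mem': "\<And>a. a < x + 1 \<Longrightarrow> mem MN a X \<longleftrightarrow> (\<forall>y\<le>a. \<phi> y)"
    unfolding less_vnat_def by auto
  have mem: "mem MN a X \<longleftrightarrow> (\<forall>y\<le>a. \<phi> y)" if "a \<le> x" for a
    by (rule mem') (simp add: vnat_less_1 that)
  note L = BASIC(13,14)[OF X(1) X(1)]
  have 0: "y = 0" if "y \<le> 0" for y :: vnat using that basic(7)[of y 0] basic(9)[of y] by simp
  have "mem MN 0 X" unfolding mem[OF basic(9)] using 0 assms(2) by metis
  then have "len MN X \<noteq> 0" using L(1)[of 0] by (auto simp: less_vnat_def)
  then obtain y where y: "y + 1 = len MN X" using basic(12) by blast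
  have yX: "mem MN y X" "y \<le> x" by (rule L(2)[OF y], rule vnat_le_cancel1) (use X(2) y in simp)
  then have \<phi>y: "\<And>z. z \<le> y \<Longrightarrow> \<phi> z" using mem[OF yX(2)] by simp
  then have "y \<noteq> x" using x vnat_refl by blast
  then have y1: "y + 1 \<le> x" using yX(2) by (simp add: vnat_lessD less_vnat_def)
  have "\<phi> z" if "z \<le> y + 1" for z
  proof (cases "z = y + 1")
    case True
    then show ?thesis using \<phi>y[OF vnat_refl] assms(3) by simp
  next
    case False
    then have "z < y + 1" using that by (simp add: less_vnat_def)
    then show ?thesis using \<phi>y by (simp add: vnat_less_1)
  qed
  then have "mem MN (y + 1) X" using mem[OF y1] by blast
  then show False using L(1) y by (auto simp: less_vnat_def)
qed

section \<open>The ordered semiring laws\<close>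

lemma vnat_add_0: "0 + x = (x :: vnat)"
  by (rule vnat_induct[of "\<lambda>x. 0 + x = x"]) ((intro vdef)[1], simp_all add: basic(3-6))
lemma vnat_add_1_left: "x + 1 + y = x + y + (1 :: vnat)"
  by (rule vnat_induct[of "\<lambda>y. x + 1 + y = x + y + 1"]) ((intro vdef)[1], simp_all add: basic(3-6))
lemma vnat_add_commute: "x + y = y + (x :: vnat)"
  by (rule vnat_induct[of "\<lambda>y. x + y = y + x"]) ((intro vdef)[1], simp_all add: basic(3-6) vnat_add_0 vnat_add_1_left)
lemma vnat_add_assoc: "x + y + z = x + (y + z :: vnat)"
  by (rule vnat_induct[of "\<lambda>z. x + y + z = x + (y + z)"]) ((intro vdef)[1], simp_all add: basic(3-6))

instance vnat :: comm_monoid_add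
  by standard (rule vnat_add_assoc vnat_add_commute vnat_add_0)+

lemma vnat_mult_0: "0 * x = (0 :: vnat)"
  by (rule vnat_induct[of "\<lambda>x. 0 * x = 0"]) ((intro vdef)[1], simp_all add: basic(3-6))
lemma vnat_distrib1: "(x + 1) * y = x * y + (y :: vnat)"
  by (rule vnat_induct[of "\<lambda>y. (x + 1) * y = x * y + y"]) ((intro vdef)[1], simp_all add: basic(3-6) ac_simps)
lemma vnat_mult_commute: "x * y = y * (x :: vnat)"
  by (rule vnat_induct[of "\<lambda>y. x * y = y * x"]) ((intro vdef)[1], simp_all add: basic(3-6) vnat_mult_0 vnat_distrib1)
lemma vnat_distrib: "x * (y + z) = x * y + x * (z :: vnat)"
  by (rule vnat_induct[of "\<lambda>z. x * (y + z) = x * y + x * z"])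
    ((intro vdef)[1], simp_all add: basic(3-6) flip: add.assoc)
lemma vnat_mult_1: "x * 1 = (x :: vnat)"
  using basic(6)[of x 0] by (simp add: basic(5))
lemma vnat_mult_assoc: "x * y * z = x * (y * z :: vnat)"
  by (rule vnat_induct[of "\<lambda>z. x * y * z = x * (y * z)"]) ((intro vdef)[1], simp_all add: basic(3-6) vnat_distrib vnat_mult_1)
lemma vnat_add_cancel: "x + z = y + z \<longleftrightarrow> x = (y :: vnat)"
  by (rule vnat_induct[of "\<lambda>z. x + z = y + z \<longleftrightarrow> x = y"])
    ((intro vdef fdef_iff fdef_const)[1], use basic(2) in \<open>auto simp: basic(3) simp flip: basic(4)\<close>)
text \<open>The bound on \<open>z\<close> keeps the induction statement Sigma^B_0.\<close>

lemma vnat_le_ex: "x \<le> y \<Longrightarrow> \<exists>z\<le>y. x + z = (y :: vnat)"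
proof -
  have "x \<le> y \<longrightarrow> (\<exists>z\<le>y. x + z = y)"
  proof (rule vnat_induct[of "\<lambda>y. x \<le> y \<longrightarrow> (\<exists>z\<le>y. x + z = y)"])
    show "fdef MN (\<lambda>e. x \<le> e 0 \<longrightarrow> (\<exists>z\<le>e 0. x + z = e 0))" by (intro vdef)
    show "x \<le> 0 \<longrightarrow> (\<exists>z\<le>0. x + z = 0)" using basic(7)[of x 0] basic(9)[of x] vnat_refl by auto
    fix y assume IH: "x \<le> y \<longrightarrow> (\<exists>z\<le>y. x + z = y)"
    show "x \<le> y + 1 \<longrightarrow> (\<exists>z\<le>y + 1. x + z = y + 1)"
    proof
      assume le: "x \<le> y + 1"
      show "\<exists>z\<le>y + 1. x + z = y + 1"
      proof (cases "x = y + 1")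
        case True
        then show ?thesis by (intro exI[of _ 0]) (simp add: basic(9))
      next
        case False
        then have "x < y + 1" using le by (simp add: less_vnat_def)
        then have "x \<le> y" by (simp only: vnat_less_1)
        then obtain z where "x + z = y" using IH by blast
        then have "x + (z + 1) = y + 1" by (simp add: ac_simps)
        moreover have "z + 1 \<le> x + (z + 1)" using basic(8)[of "z + 1" x] by (simp only: add.commute)
        ultimately show ?thesis by (intro exI[of _ "z + 1"]) simp
      qed
    qed
  qed
  then show "x \<le> y \<Longrightarrow> \<exists>z\<le>y. x + z = y" by blast
qed

lemma vnat_le_iff: "x \<le> y \<longleftrightarrow> (\<exists>z. y = x + (z :: vnat))"
  using vnat_le_ex[of x y] basic(8) by auto

instance vnat :: linorder
proof
  fix x y z :: vnat
  show "x < y \<longleftrightarrow> x \<le> y \<and> \<not> y \<le> x"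
    unfolding less_vnat_def using basic(7)[of x y] vnat_refl by blast
  show "x \<le> x" by (rule vnat_refl)
  show "x \<le> z" if "x \<le> y" "y \<le> z" using that by (auto simp: vnat_le_iff add.assoc)
  show "x = y" if "x \<le> y" "y \<le> x" using that basic(7)[of x y] by simp
  show "x \<le> y \<or> y \<le> x" by (rule basic)
qed

lemma vnat_minus_add: "b + c - b = (c :: vnat)"
proof -
  have "b + (SOME d. b + d = b + c) = b + c" by (rule someI[of _ c]) simp
  then show ?thesis using vnat_add_cancel by (simp add: minus_vnat_def basic(8) ac_simps)
qed
lemma vnat_minus_le: "a \<le> b \<Longrightarrow> a - b = (0 :: vnat)"
  using vnat_minus_add[of a 0] by (auto simp: minus_vnat_def)

lemma vnat_mult_nonzero: assumes "c \<noteq> 0" "d \<noteq> 0" shows "c * d \<noteq> (0 :: vnat)"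
proof -
  obtain c' d' where "c = c' + 1" "d = d' + 1" using assms basic(12) by metis
  then have "c * d = (c' * d' + d') + (c' * 1 + 1)" by (simp only: vnat_distrib vnat_distrib1 vnat_mult_1)
  then have "c * d = c' * d' + c' + d' + 1" by (simp add: vnat_mult_1 ac_simps)
  then show ?thesis by (metis basic(1))
qed

instance vnat :: linordered_semidom
proof
  fix a b c :: vnat
  show "a * b \<noteq> 0" if "a \<noteq> 0" "b \<noteq> 0" using that by (rule vnat_mult_nonzero)
  show "a * (b + c) = a * b + a * c" by (rule vnat_distrib)
  show "(0 :: vnat) < 1" using basic(1)[of 0] basic(9)[of 1] by (auto simp: less_vnat_def)
  show "a * b * c = a * (b * c)" by (rule vnat_mult_assoc)
  show "a * b = b * a" by (rule vnat_mult_commute)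
  show "1 * a = a" using vnat_distrib1[of 0 a] by (simp add: vnat_mult_0)
  show "0 * a = 0" "a * 0 = 0" by (simp_all add: vnat_mult_0 basic)
  show "(a + b) * c = a * c + b * c" using vnat_distrib[of c a b] by (simp add: vnat_mult_commute)
  show "a + b - a = b" by (rule vnat_minus_add)
  show "a - b - c = a - (b + c)"
  proof (cases "b \<le> a")
    case True
    then obtain d where d: "a = b + d" by (auto simp: vnat_le_iff)
    show ?thesis
    proof (cases "c \<le> d")
      case True
      then obtain f where "d = c + f" by (auto simp: vnat_le_iff)
      then show ?thesis using vnat_minus_add[of "b + c" f] by (simp add: d vnat_minus_add add.assoc)
    next
      case False
      then have "d \<le> c" using linear by blast
      moreover from this have "b + d \<le> b + c" by (auto simp: vnat_le_iff add.assoc)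
      ultimately show ?thesis by (simp add: d vnat_minus_add vnat_minus_le)
    qed
  next
    case False
    then have "a \<le> b" by simp
    then have "a \<le> b + c" by (auto simp: vnat_le_iff add.assoc)
    then show ?thesis using \<open>a \<le> b\<close> by (simp add: vnat_minus_le basic(9))
  qed
  show "a * (b - c) = a * b - a * c"
  proof (cases "c \<le> b")
    case True
    then obtain d where "b = c + d" by (auto simp: vnat_le_iff)
    then show ?thesis by (simp add: vnat_distrib vnat_minus_add)
  next
    case False
    then have "b \<le> c" by simp
    then have "a * b \<le> a * c" by (auto simp: vnat_le_iff vnat_distrib)
    then show ?thesis using \<open>b \<le> c\<close> by (simp add: vnat_minus_le basic)
  qed
  show "(0 :: vnat) \<noteq> 1" using basic(1)[of 0] by simp
  show "c + a \<le> c + b" if "a \<le> b" using that by (auto simp: vnat_le_iff add.assoc)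
  show "a - b + b = a" if "b \<le> a"
    using that by (auto simp: vnat_le_iff vnat_minus_add) (rule add.commute)?
  show "c * a < c * b" if "a < b" "0 < c"
  proof -
    obtain d where d: "b = a + d" using \<open>a < b\<close> vnat_le_iff less_imp_le by blast
    then have "d \<noteq> 0" using \<open>a < b\<close> by auto
    then have "c * d \<noteq> 0" using \<open>0 < c\<close> by (intro vnat_mult_nonzero) auto
    then have "c * a \<noteq> c * b" using vnat_add_cancel[of 0 "c * a" "c * d"] by (simp add: d vnat_distrib ac_simps)
    moreover have "c * a \<le> c * b" by (auto simp: d vnat_distrib vnat_le_iff)
    ultimately show ?thesis by simp
  qed
qed

\<comment> \<open>From here on \<open>vnat\<close> is abstract; otherwise \<open>transfer\<close>
  for the quotient below could also descend to elements of \<open>M0\<close>.\<close>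
lifting_forget vnat.lifting

section \<open>The ring of differences\<close>

definition difference_rel :: "vnat \<times> vnat \<Rightarrow> vnat \<times> vnat \<Rightarrow> bool" where
  "difference_rel = (\<lambda>(x, y) (u, v). x + v = u + y)"

lemma difference_rel_iff [simp]: "difference_rel (x, y) (u, v) \<longleftrightarrow> x + v = u + y"
  by (simp add: difference_rel_def)

quotient_type vint = "vnat \<times> vnat" / difference_rel morphisms Rep_vint Abs_vint
proof (rule equivpI)
  show "reflp difference_rel" by (auto simp: reflp_def)
  show "symp difference_rel" by (auto simp: symp_def)
  show "transp difference_rel"
  proof (rule transpI, clarsimp)
    fix a b c d e f :: vnat
    assume "a + d = c + b" "c + f = e + d"
    then have "(a + f) + (c + d) = (e + b) + (c + d)" by (metis (no_types, opaque_lifting) add.assoc add.commute)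
    then show "a + f = e + b" by simp
  qed
qed

instantiation vint :: comm_ring_1
begin

lift_definition zero_vint :: vint is "(0, 0)" .
lift_definition one_vint :: vint is "(1, 0)" .
lift_definition plus_vint :: "vint \<Rightarrow> vint \<Rightarrow> vint" is "\<lambda>(x, y) (u, v). (x + u, y + v)"
  by (clarsimp simp: algebra_simps) (metis (no_types, opaque_lifting) add.assoc add.commute)
lift_definition uminus_vint :: "vint \<Rightarrow> vint" is "\<lambda>(x, y). (y, x)"
  by (auto simp: add.commute)
lift_definition minus_vint :: "vint \<Rightarrow> vint \<Rightarrow> vint" is "\<lambda>(x, y) (u, v). (x + v, y + u)"
  by (clarsimp simp: algebra_simps) (metis (no_types, opaque_lifting) add.assoc add.commute)
lift_definition times_vint :: "vint \<Rightarrow> vint \<Rightarrow> vint" is "\<lambda>(x, y) (u, v). (x*u + y*v, x*v + y*u)"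
proof (clarsimp)
  fix s t u v w x y z :: vnat
  assume "s + v = u + t" "w + z = y + x"
  \<comment> \<open>Multiples of the two hypotheses are added up so that, after expansion, both
    sides share a summand that can be cancelled.\<close>
  then have "(s + v) * w + (u + t) * x + u * (w + z) + v * (y + x) =
      (u + t) * w + (s + v) * x + u * (y + x) + v * (w + z)" by simp
  then have "(s * w + t * x + (u * z + v * y)) + (u * w + u * x + v * w + v * x) =
      (u * y + v * z + (s * x + t * w)) + (u * w + u * x + v * w + v * x)"
    by (simp add: algebra_simps)
  then show "s * w + t * x + (u * z + v * y) = u * y + v * z + (s * x + t * w)"
    by (simp only: add_right_cancel)
qed

instance
  by standard (transfer; clarsimp simp: algebra_simps)+

end

instantiation vint :: linordered_idom
begin

lift_definition less_eq_vint :: "vint \<Rightarrow> vint \<Rightarrow> bool" is "\<lambda>(x, y) (u, v). x + v \<le> u + y"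
proof clarsimp
  fix a b c d x y z w :: vnat
  assume e: "a + d = c + b" "x + w = z + y"
  have "a + y \<le> x + b \<longleftrightarrow> (a + y) + (d + w) \<le> (x + b) + (d + w)" by simp
  also have "(a + y) + (d + w) = (c + w) + (b + y)" using e by (simp add: ac_simps) (metis add.assoc add.commute)
  also have "(x + b) + (d + w) = (z + d) + (b + y)" using e by (simp add: ac_simps)
  finally show "(a + y \<le> x + b) = (c + w \<le> z + d)" by simp
qed

definition less_vint :: "vint \<Rightarrow> vint \<Rightarrow> bool" where "less_vint x y \<longleftrightarrow> x \<le> y \<and> \<not> y \<le> x"
definition abs_vint :: "vint \<Rightarrow> vint" where "abs_vint x = (if x < 0 then - x else x)"
definition sgn_vint :: "vint \<Rightarrow> vint" where "sgn_vint x = (if x = 0 then 0 else if 0 < x then 1 else - 1)"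

instance
proof
  fix a b c :: vint
  show "a < b \<longleftrightarrow> a \<le> b \<and> \<not> b \<le> a" by (rule less_vint_def)
  show "a \<le> a" by transfer auto
  show "a \<le> c" if "a \<le> b" "b \<le> c"
  proof (use that in transfer, clarsimp)
    fix a b c d e f :: vnat
    assume "a + d \<le> c + b" "c + f \<le> e + d"
    then have "(a + d) + (c + f) \<le> (c + b) + (e + d)" by (rule add_mono)
    then have "(a + f) + (c + d) \<le> (e + b) + (c + d)" by (simp add: ac_simps)
    then show "a + f \<le> e + b" by simp
  qed
  show "a = b" if "a \<le> b" "b \<le> a" using that by transfer auto
  show "a \<le> b \<or> b \<le> a" by transfer auto
  show "c + a \<le> c + b" if "a \<le> b"
  proof (use that in transfer, clarsimp)
    fix a b c d e f :: vnat
    assume "a + d \<le> c + b"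
    then have "(a + d) + (e + f) \<le> (c + b) + (e + f)" by simp
    then show "e + a + (f + d) \<le> e + c + (f + b)" by (simp add: ac_simps)
  qed
  show "c * a < c * b" if "a < b" "0 < c"
    unfolding less_vint_def
  proof (use that[unfolded less_vint_def] in transfer, clarsimp simp: not_le)
    fix a b c d e f :: vnat
    assume "a + d \<le> c + b" "c + b \<noteq> a + d" "f \<le> e" "e \<noteq> f"
    then have "a + d < c + b" "f < e" by auto
    then obtain g where e: "e = f + g" using vnat_le_iff less_imp_le by blast
    then have g: "0 < g" using \<open>f < e\<close> by simp
    have "g * (a + d) < g * (c + b)" using \<open>a + d < c + b\<close> g by (rule mult_strict_left_mono)
    then have "g * (a + d) + f * (a + b + c + d) < g * (c + b) + f * (a + b + c + d)"
      by (rule add_strict_right_mono)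
    then have "e * a + f * b + (e * d + f * c) < e * c + f * d + (e * b + f * a)"
      by (simp only: e distrib_left distrib_right ac_simps)
    then show "e * a + f * b + (e * d + f * c) \<le> e * c + f * d + (e * b + f * a) \<and>
       e * a + f * b + (e * d + f * c) < e * c + f * d + (e * b + f * a)" by simp
  qed
  show "\<bar>a\<bar> = (if a < 0 then - a else a)" by (rule abs_vint_def)
  show "sgn a = (if a = 0 then 0 else if 0 < a then 1 else - 1)" by (rule sgn_vint_def)
qed

end

lift_definition of_vnat :: "vnat \<Rightarrow> vint" is "\<lambda>x. (x, 0)" .

lemma of_vnat_simps [simp]:
  "of_vnat 0 = 0" "of_vnat 1 = 1" "of_vnat (x + y) = of_vnat x + of_vnat y"
  "of_vnat (x * y) = of_vnat x * of_vnat y" "of_vnat x \<le> of_vnat y \<longleftrightarrow> x \<le> y" "of_vnat x = of_vnat y \<longleftrightarrow> x = y"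
  by (transfer; simp)+

lemma vint_diff: "\<exists>a b. x = of_vnat a - of_vnat b"
  by transfer (auto, metis add.commute)

lemma range_of_vnat: "range of_vnat = {0..}"
proof (intro equalityI subsetI)
  fix x :: vint assume "x \<in> {0..}"
  moreover obtain a b where x: "x = of_vnat a - of_vnat b" using vint_diff by blast
  ultimately have "b \<le> a" by (simp flip: of_vnat_simps(5))
  then obtain c where "a = b + c" by (auto simp: vnat_le_iff)
  then show "x \<in> range of_vnat" using x by simp
next
  fix x assume "x \<in> range of_vnat"
  then obtain a where "x = of_vnat a" by blast
  then show "x \<in> {0..}" using of_vnat_simps(5)[of 0 a] basic(9) by simp
qed

text \<open>Parameters are named by codes of elements, so definability over this type presupposes
  countability.\<close>

instance vint :: countable
proof
  let ?f = "\<lambda>x :: vint. to_nat (SOME p. x = of_vnat (fst p) - of_vnat (snd p))"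
  have "inj ?f"
  proof (rule injI)
    fix x y assume *: "?f x = ?f y"
    have "z = of_vnat (fst (SOME p. z = of_vnat (fst p) - of_vnat (snd p))) -
      of_vnat (snd (SOME p. z = of_vnat (fst p) - of_vnat (snd p)))" for z
      by (rule someI_ex) (use vint_diff[of z] in simp)
    from this[of x] this[of y] * show "x = y" by simp
  qed
  then show "\<exists>f :: vint \<Rightarrow> nat. inj f" by (rule exI[of inj])
qed

text \<open>Still the same model of V^0, since the number quantifiers range over the nonnegative
  part; HOL arguments about it may subtract freely.\<close>

definition MZ :: "(vint, nat) struc" where
  "MZ = \<lparr>DN = {0..}, DS = DS MN, zer = 0, one = 1, add = (+), mul = (*), leq = (\<le>),
     len = (\<lambda>X. of_vnat (len MN X)), mem = (\<lambda>a X. mem MN (inv of_vnat a) X)\<rparr>"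

lemma iso_MZ: "iso of_vnat MN MZ"
proof -
  have "inj of_vnat" by (auto simp: inj_def)
  then show ?thesis using MN(2)
    by (simp add: iso_def MZ_def range_of_vnat)
qed

subsection \<open>The theorem is closed\<close>

lemma pair_simps [simp]:
  "lvN i j (pair t u) \<longleftrightarrow> lvN i j t \<and> lvN i j u" "fvN_ntm (pair t u) = fvN_ntm t \<union> fvN_ntm u"
  "fvS_ntm (pair t u) = fvS_ntm t \<union> fvS_ntm u"
  by (auto simp: pair_def)

abbreviation lcP :: "pt \<Rightarrow> bool" where "lcP p \<equiv> lcN (fst p) \<and> lcN (snd p)"
abbreviation fvN_pt :: "pt \<Rightarrow> string set" where "fvN_pt p \<equiv> fvN_ntm (fst p) \<union> fvN_ntm (snd p)"
abbreviation fvS_pt :: "pt \<Rightarrow> string set" where "fvS_pt p \<equiv> fvS_ntm (fst p) \<union> fvS_ntm (snd p)"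

lemma at_closed [simp]:
  "lv 0 0 (point_at Q i p) \<longleftrightarrow> lcN i \<and> lcP p \<and> lcS Q"
  "fvN (point_at Q i p) = fvN_ntm i \<union> fvN_pt p"
  "fvS (point_at Q i p) = fvS_ntm i \<union> fvS_pt p \<union> fvS_stm Q"
  "lv 0 0 (edge_at E i p q) \<longleftrightarrow> lcN i \<and> lcP p \<and> lcP q \<and> lcS E"
  "fvN (edge_at E i p q) = fvN_ntm i \<union> fvN_pt p \<union> fvN_pt q"
  "fvS (edge_at E i p q) = fvS_ntm i \<union> fvS_pt p \<union> fvS_pt q \<union> fvS_stm E"
  by (auto simp: point_at_def edge_at_def code_def simp flip: lvN_0 lvS_0)

lemma simple_closed [simp]:
  "lv 0 0 (in_grid n p) \<longleftrightarrow> lcN n \<and> lcP p"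
  "fvN (in_grid n p) = fvN_ntm n \<union> fvN_pt p" "fvS (in_grid n p) = fvS_ntm n \<union> fvS_pt p"
  "lv 0 0 (on_border n p) \<longleftrightarrow> lcN n \<and> lcP p"
  "fvN (on_border n p) = fvN_ntm n \<union> fvN_pt p" "fvS (on_border n p) = fvS_ntm n \<union> fvS_pt p"
  "lv 0 0 (p \<^bold>=\<^sub>P q) \<longleftrightarrow> lcP p \<and> lcP q"
  "fvN (p \<^bold>=\<^sub>P q) = fvN_pt p \<union> fvN_pt q" "fvS (p \<^bold>=\<^sub>P q) = fvS_pt p \<union> fvS_pt q"
  "lv 0 0 (adjacent p q) \<longleftrightarrow> lcP p \<and> lcP q"
  "fvN (adjacent p q) = fvN_pt p \<union> fvN_pt q" "fvS (adjacent p q) = fvS_pt p \<union> fvS_pt q"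
  by (auto simp: in_grid_def on_border_def Eq_pt_def adjacent_def)

lemma seq_closed:
  "lcN n \<Longrightarrow> lcN t \<Longrightarrow> lcS Q \<Longrightarrow> lv 0 0 (point_seq n t Q)"
  "fvN (point_seq n t Q) \<subseteq> fvN_ntm n \<union> fvN_ntm t"
  "fvS (point_seq n t Q) \<subseteq> fvS_ntm n \<union> fvS_ntm t \<union> fvS_stm Q"
  "lcN n \<Longrightarrow> lcN t \<Longrightarrow> lcS Q \<Longrightarrow> lv 0 0 (edge_seq n t Q)"
  "fvN (edge_seq n t Q) \<subseteq> fvN_ntm n \<union> fvN_ntm t"
  "fvS (edge_seq n t Q) \<subseteq> fvS_ntm n \<union> fvS_ntm t \<union> fvS_stm Q"
  by (auto simp: point_seq_def edge_seq_def Let_def)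

lemma curve_closed:
  "lcN n \<Longrightarrow> lcN t \<Longrightarrow> lcS E \<Longrightarrow> lv 0 0 (closed_curve n t E)"
  "fvN (closed_curve n t E) \<subseteq> fvN_ntm n \<union> fvN_ntm t"
  "fvS (closed_curve n t E) \<subseteq> fvS_ntm n \<union> fvS_ntm t \<union> fvS_stm E"
  "lcN n \<Longrightarrow> lcN s \<Longrightarrow> lcS R \<Longrightarrow> lcP a \<Longrightarrow> lcP b \<Longrightarrow> lv 0 0 (connects n s R a b)"
  "fvN (connects n s R a b) \<subseteq> fvN_ntm n \<union> fvN_ntm s \<union> fvN_pt a \<union> fvN_pt b"
  "fvS (connects n s R a b) \<subseteq> fvS_ntm n \<union> fvS_ntm s \<union> fvS_stm R \<union> fvS_pt a \<union> fvS_pt b"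
  using seq_closed(2,3)[of n t "SV ''_Q''"] seq_closed(5,6)[of n t E]
    seq_closed(2,3)[of n "s \<^bold>+ \<^bold>1" "SV ''_Q''"] seq_closed(5,6)[of n s R]
  by (auto simp: closed_curve_def connects_def Let_def seq_closed(1,4))

lemma incident_closed [simp]:
  "lcN i \<Longrightarrow> lcS E \<Longrightarrow> lcP a \<Longrightarrow> lv 0 0 (incident E i a)"
  "fvN (incident E i a) = fvN_ntm i \<union> fvN_pt a - {''_bx'', ''_by''}"
  "fvS (incident E i a) = fvS_ntm i \<union> fvS_pt a \<union> fvS_stm E"
  by (auto simp: incident_def Let_def)

lemma degree_closed:
  "lcN t \<Longrightarrow> lcS E \<Longrightarrow> lcP a \<Longrightarrow> lv 0 0 (degree0 t E a)"
  "fvN (degree0 t E a) \<subseteq> fvN_ntm t \<union> fvN_pt a"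
  "fvS (degree0 t E a) \<subseteq> fvS_ntm t \<union> fvS_pt a \<union> fvS_stm E"
  "lcN t \<Longrightarrow> lcS E \<Longrightarrow> lcP a \<Longrightarrow> lv 0 0 (degree2 t E a)"
  "fvN (degree2 t E a) \<subseteq> fvN_ntm t \<union> fvN_pt a"
  "fvS (degree2 t E a) \<subseteq> fvS_ntm t \<union> fvS_pt a \<union> fvS_stm E"
  by (auto simp: degree0_def degree2_def Let_def)

lemma config_closed:
  "lcN n \<Longrightarrow> lcN t \<Longrightarrow> lcS E \<Longrightarrow> lv 0 0 (avoids_border n t E)"
  "fvN (avoids_border n t E) \<subseteq> fvN_ntm n \<union> fvN_ntm t"
  "fvS (avoids_border n t E) \<subseteq> fvS_ntm n \<union> fvS_ntm t \<union> fvS_stm E"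
  "lcN t \<Longrightarrow> lcS E \<Longrightarrow> lcP a \<Longrightarrow> lcP b \<Longrightarrow> lv 0 0 (different_sides t E a b)"
  "fvN (different_sides t E a b) \<subseteq> fvN_ntm t \<union> fvN_pt a \<union> fvN_pt b"
  "fvS (different_sides t E a b) \<subseteq> fvS_ntm t \<union> fvS_pt a \<union> fvS_pt b \<union> fvS_stm E"
  "lcN s \<Longrightarrow> lcN t \<Longrightarrow> lcS R \<Longrightarrow> lcS E \<Longrightarrow> lv 0 0 (intersect s R t E)"
  "fvN (intersect s R t E) \<subseteq> fvN_ntm s \<union> fvN_ntm t"
  "fvS (intersect s R t E) \<subseteq> fvS_ntm s \<union> fvS_ntm t \<union> fvS_stm R \<union> fvS_stm E"
  "lcN n \<Longrightarrow> lcN t \<Longrightarrow> lcS E \<Longrightarrow> lcS E' \<Longrightarrow> lv 0 0 (tripled n t E E')"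
  "fvN (tripled n t E E') \<subseteq> fvN_ntm n \<union> fvN_ntm t"
  "fvS (tripled n t E E') \<subseteq> fvS_ntm n \<union> fvS_ntm t \<union> fvS_stm E \<union> fvS_stm E'"
  using degree_closed(2,3)[of t E "(NV ''_x'', NV ''_y'')"] degree_closed(2,3)[of s R "(NV ''_x'', NV ''_y'')"]
    degree_closed(2,3)[of t E a] degree_closed(2,3)[of t E b] degree_closed(5,6)[of t E "(fst a, NV ''_m'')"]
    seq_closed(5,6)[of "thrice n" "thrice t" E']
  by (auto simp: avoids_border_def different_sides_def intersect_def tripled_def Let_def degree_closed(1,4) seq_closed(4))

text \<open>Required by the completeness theorem and by the transfer of truth along
  isomorphisms.\<close>

lemma jct_closed: "lv 0 0 jct" "fvN jct = {}" "fvS jct = {}"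
proof -
  let ?n = "NV ''n''" and ?t = "NV ''t''" and ?P = "SV ''P''" and ?P' = "SV ''P3''" and ?s = "NV ''s''" and ?R = "SV ''R''"
    and ?p1 = "(NV ''x1'', NV ''y1'')" and ?p2 = "(NV ''x2'', NV ''y2'')" and ?p = "(NV ''x'', NV ''y'')"
  note c = curve_closed(2,3)[of ?n ?t ?P] config_closed(2,3)[of ?n ?t ?P] config_closed(11,12)[of ?n ?t ?P ?P']
    config_closed(5,6)[of "thrice ?t" ?P' ?p1 ?p2] degree_closed(2,3)[of "thrice ?t" ?P' ?p]
    curve_closed(5,6)[of "thrice ?n" ?s ?R ?p ?p1] curve_closed(5,6)[of "thrice ?n" ?s ?R ?p ?p2]
    config_closed(8,9)[of ?s ?R "thrice ?t" ?P']
  show "lv 0 0 jct"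
    by (simp add: jct_def Let_def curve_closed(1,4) degree_closed(1) config_closed(1,4,7,10))
  show "fvN jct = {}" "fvS jct = {}" using c by (auto simp: jct_def Let_def)
qed

lemma MZ: "models MZ V0"
  using models_iso[OF iso_MZ lv_V0] MN by simp

text \<open>Truth is carried back along both isomorphisms to the fixed model; if the statement holds
  there, no model on \<open>nat\<close> refutes it.\<close>

lemma jct_if_MZ: assumes "models MZ {jct}" shows "V0 \<^bold>\<turnstile> jct"
proof -
  have "models M0 {jct}"
    using models_iso[OF iso_MZ, of "{jct}"] models_iso[OF iso_MN, of "{jct}"] jct_closed(1) assms by simp
  then show ?thesis unfolding M0_def by (intro provable_if_countermodel jct_closed)
qed

lemma vint_discrete: assumes "0 < x" shows "1 \<le> (x :: vint)"
proof -
  obtain a where a: "x = of_vnat a" using assms range_of_vnat by (metis atLeast_iff imageE less_imp_le)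
  then have "a \<noteq> 0" using assms by auto
  then have "0 < a" using basic(9)[of a] by (simp add: less_vnat_def)
  then have "1 \<le> a" using vnat_lessD[of 0 a] by simp
  then show ?thesis using of_vnat_simps(5)[of 1 a] a by simp
qed

section \<open>Arithmetic over the nonnegative part of an ordered ring\<close>

text \<open>An expression with integer values is represented by two terms, a positive and a negative
  part, because terms cannot subtract.\<close>

definition zdef :: "('z::{linordered_idom,countable}, 'b::countable) struc \<Rightarrow> ((nat \<Rightarrow> 'z) \<Rightarrow> 'z) \<Rightarrow> bool" where
  "zdef M f \<longleftrightarrow> (\<exists>g h. tdef M g \<and> tdef M h \<and>
     (\<forall>e. (\<forall>k. 0 \<le> e k) \<longrightarrow> 0 \<le> g e \<and> 0 \<le> h e \<and> f e = g e - h e))"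

text \<open>Outside the number domain \<open>mem\<close> is unconstrained; the guard makes
  membership of negative numbers false.\<close>

definition zmem :: "('z::linordered_idom, 'b) struc \<Rightarrow> 'z \<Rightarrow> 'b \<Rightarrow> bool" where
  "zmem M a X \<longleftrightarrow> 0 \<le> a \<and> mem M a X"

definition zex :: "'z::linordered_idom \<Rightarrow> ('z \<Rightarrow> bool) \<Rightarrow> bool" where
  "zex b \<phi> \<longleftrightarrow> (\<exists>a. 0 \<le> a \<and> a \<le> b \<and> \<phi> a)"

definition zpair :: "'z::linordered_idom \<Rightarrow> 'z \<Rightarrow> 'z" where
  "zpair a b = (a + b) * (a + b + 1) + 2 * b"

text \<open>Abstracts from the construction of the model: the geometry needs an ordered ring,
  discreteness, and V^0 on the nonnegative part.\<close>

locale arith_model =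
  fixes M :: "('z::{linordered_idom,countable}, 'b::countable) struc"
  assumes V0: "models M V0"
    and ops [simp]: "DN M = {0..}" "zer M = 0" "one M = 1" "add M = (+)" "mul M = (*)" "leq M = (\<le>)"
    and discrete: "0 < (x :: 'z) \<Longrightarrow> 1 \<le> x"
begin

lemma zless_iff: "a < b \<longleftrightarrow> a + 1 \<le> (b :: 'z)"
  using discrete[of "b - a"] by (auto simp: algebra_simps)

lemma zdef_var: "zdef M (\<lambda>e. e k)"
  unfolding zdef_def by (intro exI[of _ "\<lambda>e. e k"] exI[of _ "\<lambda>_. 0"]) (simp add: tdef_var tdef_const)

lemma zdef_const: "zdef M (\<lambda>e. c)"
proof (cases "0 \<le> c")
  case True
  then show ?thesis unfolding zdef_def
    by (intro exI[of _ "\<lambda>_. c"] exI[of _ "\<lambda>_. 0"]) (simp add: tdef_const)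
next
  case False
  then show ?thesis unfolding zdef_def
    by (intro exI[of _ "\<lambda>_. 0"] exI[of _ "\<lambda>_. - c"]) (simp add: tdef_const)
qed

lemma tdef_ring: assumes "tdef M f" "tdef M g"
  shows "tdef M (\<lambda>e. f e + g e)" "tdef M (\<lambda>e. f e * g e)"
  using tdef_add[OF assms] tdef_mul[OF assms] by simp_all

lemma zdef_add: assumes "zdef M f" "zdef M g" shows "zdef M (\<lambda>e. f e + g e)"
proof -
  obtain a b where 1: "tdef M a" "tdef M b" "\<forall>e. (\<forall>k. 0 \<le> e k) \<longrightarrow> 0 \<le> a e \<and> 0 \<le> b e \<and> f e = a e - b e"
    using assms(1) unfolding zdef_def by blast
  obtain c d where 2: "tdef M c" "tdef M d" "\<forall>e. (\<forall>k. 0 \<le> e k) \<longrightarrow> 0 \<le> c e \<and> 0 \<le> d e \<and> g e = c e - d e"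
    using assms(2) unfolding zdef_def by blast
  note * = 1(1,2) 2(1,2) and ** = 1(3) 2(3)
  show ?thesis unfolding zdef_def
    by (intro exI[of _ "\<lambda>e. a e + c e"] exI[of _ "\<lambda>e. b e + d e"]) (simp add: * ** tdef_ring)
qed

lemma zdef_mult: assumes "zdef M f" "zdef M g" shows "zdef M (\<lambda>e. f e * g e)"
proof -
  obtain a b where 1: "tdef M a" "tdef M b" "\<forall>e. (\<forall>k. 0 \<le> e k) \<longrightarrow> 0 \<le> a e \<and> 0 \<le> b e \<and> f e = a e - b e"
    using assms(1) unfolding zdef_def by blast
  obtain c d where 2: "tdef M c" "tdef M d" "\<forall>e. (\<forall>k. 0 \<le> e k) \<longrightarrow> 0 \<le> c e \<and> 0 \<le> d e \<and> g e = c e - d e"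
    using assms(2) unfolding zdef_def by blast
  note * = 1(1,2) 2(1,2) and ** = 1(3) 2(3)
  show ?thesis unfolding zdef_def
    by (intro exI[of _ "\<lambda>e. a e * c e + b e * d e"] exI[of _ "\<lambda>e. a e * d e + b e * c e"])
      (simp add: * ** tdef_ring algebra_simps)
qed

lemma zdef_uminus: assumes "zdef M f" shows "zdef M (\<lambda>e. - f e)"
  using zdef_mult[OF zdef_const[of "- 1"] assms] by simp

lemma zdef_minus: assumes "zdef M f" "zdef M g" shows "zdef M (\<lambda>e. f e - g e)"
  using zdef_add[OF assms(1) zdef_uminus[OF assms(2)]] by simp

text \<open>Negative parts are moved to the other side, which leaves a comparison of two
  terms.\<close>

lemma fdef_zle: assumes "zdef M f" "zdef M g" shows "fdef M (\<lambda>e. f e \<le> g e)"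
proof -
  obtain a b where 1: "tdef M a" "tdef M b" "\<forall>e. (\<forall>k. 0 \<le> e k) \<longrightarrow> 0 \<le> a e \<and> 0 \<le> b e \<and> f e = a e - b e"
    using assms(1) unfolding zdef_def by blast
  obtain c d where 2: "tdef M c" "tdef M d" "\<forall>e. (\<forall>k. 0 \<le> e k) \<longrightarrow> 0 \<le> c e \<and> 0 \<le> d e \<and> g e = c e - d e"
    using assms(2) unfolding zdef_def by blast
  note * = 1(1,2) 2(1,2) and ** = 1(3) 2(3)
  have "fdef M (\<lambda>e. a e + d e \<le> c e + b e)"
    using fdef_leq[OF tdef_ring(1)[OF *(1,4)] tdef_ring(1)[OF *(3,2)]] by simp
  then show ?thesis by (rule fdef_cong) (simp add: ** algebra_simps)
qed

lemma fdef_zeq: assumes "zdef M f" "zdef M g" shows "fdef M (\<lambda>e. f e = g e)"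
  using fdef_conj[OF fdef_zle[OF assms] fdef_zle[OF assms(2,1)]] by (simp add: order_eq_iff)

lemma fdef_zless: assumes "zdef M f" "zdef M g" shows "fdef M (\<lambda>e. f e < g e)"
  using fdef_not[OF fdef_zle[OF assms(2,1)]] by (simp add: not_le)

lemma fdef_zex:
  assumes "zdef M f" "fdef M (\<lambda>e. \<psi> (e 0) (\<lambda>k. e (Suc k)))"
  shows "fdef M (\<lambda>e. zex (f e) (\<lambda>x. \<psi> x e))"
proof -
  obtain g h where *: "tdef M g" "tdef M h" and **: "\<forall>e. (\<forall>k. 0 \<le> e k) \<longrightarrow> 0 \<le> g e \<and> 0 \<le> h e \<and> f e = g e - h e"
    using assms(1) unfolding zdef_def by blast
  \<comment> \<open>The bound \<open>f e\<close> is not a term. Its positive part \<open>g e\<close>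
    serves as the bounding term, and \<open>x + h e \<le> g e\<close> restores the actual
    bound.\<close>
  have "fdef M (\<lambda>e. e 0 + h (\<lambda>k. e (Suc k)) \<le> g (\<lambda>k. e (Suc k)) \<and> \<psi> (e 0) (\<lambda>k. e (Suc k)))"
    using fdef_leq[OF tdef_ring(1)[OF tdef_var[of M 0] tdef_rename[OF *(2), of Suc]] tdef_rename[OF *(1), of Suc]]
    by (intro fdef_conj assms(2)) simp
  from fdef_ex[OF *(1), of "\<lambda>x e. x + h e \<le> g e \<and> \<psi> x e", OF this]
  have "fdef M (\<lambda>e. \<exists>x\<in>{0..}. x \<le> g e \<and> x + h e \<le> g e \<and> \<psi> x e)" by simp
  then show ?thesis
  proof (rule fdef_cong)
    fix e :: "nat \<Rightarrow> 'z" assume e: "\<forall>k. e k \<in> DN M"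
    then have "x \<le> g e \<and> x + h e \<le> g e \<longleftrightarrow> x \<le> f e" for x
      using **[rule_format, of e] by (auto simp: le_diff_eq intro: order_trans[of x "x + h e"])
    then show "(\<exists>x\<in>{0..}. x \<le> g e \<and> x + h e \<le> g e \<and> \<psi> x e) = zex (f e) (\<lambda>x. \<psi> x e)"
      unfolding zex_def by auto
  qed
qed

lemma zdef_shift: assumes "zdef M f" shows "zdef M (\<lambda>e. f (\<lambda>k. e (Suc k)))"
proof -
  obtain g h where *: "tdef M g" "tdef M h" and **: "\<forall>e. (\<forall>k. 0 \<le> e k) \<longrightarrow> 0 \<le> g e \<and> 0 \<le> h e \<and> f e = g e - h e"
    using assms(1) unfolding zdef_def by blast
  show ?thesis unfolding zdef_def
    by (intro exI[of _ "\<lambda>e. g (\<lambda>k. e (Suc k))"] exI[of _ "\<lambda>e. h (\<lambda>k. e (Suc k))"])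
      (simp add: * ** tdef_rename)
qed

lemma fdef_zmem: assumes "zdef M f" "X \<in> DS M" shows "fdef M (\<lambda>e. zmem M (f e) X)"
proof -
  \<comment> \<open>Membership is available for terms only, so a bounded variable stands for the
    value of \<open>f e\<close>. For a negative value both sides are false.\<close>
  have "fdef M (\<lambda>e. zex (f e) (\<lambda>x. x = f e \<and> mem M x X))"
    by (intro fdef_zex[where \<psi> = "\<lambda>x e. x = f e \<and> mem M x X"] fdef_conj fdef_zeq zdef_var zdef_shift
      fdef_mem tdef_var assms)
  then show ?thesis by (rule fdef_cong) (auto simp: zex_def zmem_def)
qed

lemma fdef_if: "fdef M \<phi> \<Longrightarrow> fdef M \<psi> \<Longrightarrow> fdef M \<chi> \<Longrightarrow> fdef M (\<lambda>e. if \<phi> e then \<psi> e else \<chi> e)"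
  using fdef_conj[OF fdef_imp[of M \<phi> \<psi>] fdef_imp[OF fdef_not[of M \<phi>], of \<chi>]] by (simp add: if_bool_eq_conj)

lemmas zdefs = zdef_var zdef_const zdef_add zdef_minus zdef_uminus zdef_mult
lemmas fdefs = zdefs fdef_zle fdef_zless fdef_zeq fdef_zex fdef_zmem fdef_not fdef_conj fdef_disj fdef_imp fdef_iff fdef_if

lemma len_axioms:
  assumes "X \<in> DS M"
  shows "0 \<le> len M X" "0 \<le> a \<Longrightarrow> mem M a X \<Longrightarrow> a < len M X" "0 \<le> a \<Longrightarrow> a + 1 = len M X \<Longrightarrow> mem M a X"
proof -
  have "struc_ok M" using V0 by (simp add: models_def)
  then show "0 \<le> len M X" using struc_okD(5)[of M X] assms by simp
  have *: "sat M (\<lambda>_. a) (\<lambda>_. X) undefined undefined A" if "A \<in> two_BASIC" "0 \<le> a" for A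
    using that assms by (intro modelsD[OF V0]) (auto simp: V0_def)
  show "a < len M X" if "0 \<le> a" "mem M a X"
    using *[of "NV ''y'' \<^bold>\<in> SV ''X'' \<^bold>\<longrightarrow> NV ''y'' \<^bold>< \<^bold>|SV ''X''\<^bold>|"] that by (simp add: two_BASIC_def Let_def)
  show "mem M a X" if "0 \<le> a" "a + 1 = len M X"
    using *[of "NV ''y'' \<^bold>+ \<^bold>1 \<^bold>= \<^bold>|SV ''X''\<^bold>| \<^bold>\<longrightarrow> NV ''y'' \<^bold>\<in> SV ''X''"] that by (simp add: two_BASIC_def Let_def)
qed

text \<open>The comprehension axiom also bounds the length, which excludes members from
  \<open>b\<close> on; thus the set is determined exactly.\<close>

lemma zcomprehension:
  assumes "fdef M (\<lambda>e. \<phi> (e 0))" "0 \<le> b"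
  obtains X where "X \<in> DS M" "\<And>a. zmem M a X \<longleftrightarrow> 0 \<le> a \<and> a < b \<and> \<phi> a"
proof -
  obtain X where X: "X \<in> DS M" "len M X \<le> b" "\<And>a. 0 \<le> a \<Longrightarrow> a < b \<Longrightarrow> mem M a X \<longleftrightarrow> \<phi> a"
    using comprehension[OF V0 assms(1), of b] assms(2) by auto
  have "zmem M a X \<longleftrightarrow> 0 \<le> a \<and> a < b \<and> \<phi> a" for a
    using len_axioms(2)[OF X(1), of a] X(2,3) unfolding zmem_def by (meson less_le_trans)
  then show ?thesis using that X(1) by blast
qed

text \<open>The numbers up to which \<phi> fails form an initial segment \<open>X\<close>, whose
  length would be the least solution. If there were no least solution, \<phi> would fail at the
  length of \<open>X\<close> too, and \<open>X\<close> would contain its own length.\<close>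

lemma least_number:
  assumes "fdef M (\<lambda>e. \<phi> (e 0))" "0 \<le> a" "\<phi> a"
  obtains m where "0 \<le> m" "m \<le> a" "\<phi> m" "\<And>k. 0 \<le> k \<Longrightarrow> k < m \<Longrightarrow> \<not> \<phi> k"
proof (rule ccontr)
  assume "\<not> thesis"
  then have none: "\<not> (0 \<le> m \<and> m \<le> a \<and> \<phi> m \<and> (\<forall>k. 0 \<le> k \<longrightarrow> k < m \<longrightarrow> \<not> \<phi> k))" for m
    using that by blast
  have "fdef M (\<lambda>e. \<not> zex (e 0) \<phi>)"
    by (intro fdef_not fdef_zex[where \<psi> = "\<lambda>x e. \<phi> x"] zdef_var assms(1))
  from zcomprehension[OF this, of "a + 1"] assms(2) obtain X where X: "X \<in> DS M"
    and mem: "\<And>b. zmem M b X \<longleftrightarrow> 0 \<le> b \<and> b < a + 1 \<and> \<not> zex b \<phi>" by auto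
  have least: "\<exists>k. 0 \<le> k \<and> k < m \<and> \<phi> k" if "0 \<le> m" "m \<le> a" "\<phi> m" for m
    using that none[of m] by blast
  have "\<not> \<phi> 0" using least[of 0] assms(2) by auto
  then have "\<not> zex 0 \<phi>" by (auto simp: zex_def dest: order_antisym)
  then have "zmem M 0 X" using mem assms(2) by simp
  then have "0 < len M X" using len_axioms(2)[OF X, of 0] by (simp add: zmem_def)
  then have l: "0 \<le> len M X - 1" using discrete by (simp add: algebra_simps)
  then have "zmem M (len M X - 1) X" using len_axioms(3)[OF X, of "len M X - 1"] by (simp add: zmem_def)
  then have *: "len M X - 1 < a + 1" "\<not> zex (len M X - 1) \<phi>" using mem by auto
  then have "len M X - 1 \<noteq> a" using assms(2,3) by (auto simp: zex_def)
  then have "len M X - 1 < a" using *(1) zless_iff[of a "len M X - 1"] by (simp add: not_less[symmetric])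
  then have la: "len M X \<le> a" by (simp add: zless_iff)
  have no: "\<not> \<phi> k" if "0 \<le> k" "k < len M X" for k
  proof -
    have "k \<le> len M X - 1" using that(2) zless_iff[of k "len M X"] by simp
    then show ?thesis using *(2) that(1) unfolding zex_def by blast
  qed
  have "\<not> \<phi> (len M X)" using least[OF _ la] no l by fastforce
  then have "\<not> zex (len M X) \<phi>" using no unfolding zex_def by (metis le_less)
  then have "zmem M (len M X) X" using mem la l by simp
  then show False using len_axioms(2)[OF X, of "len M X"] by (simp add: zmem_def)
qed

text \<open>With \<open>s = a + b\<close>, the code lies between \<open>s * (s + 1)\<close> and
  \<open>s * (s + 1) + 2 * s\<close>, and these intervals are disjoint for different
  \<open>s\<close>. The function is twice Cantor's pairing.\<close>

lemma zpair_less: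
  assumes "0 \<le> a" "0 \<le> b" "0 \<le> c" "0 \<le> d" "a + b < c + d" shows "zpair a b < zpair c (d :: 'z)"
proof -
  let ?s = "a + b" and ?t = "c + d"
  have "?s + 1 \<le> ?t" using assms by (simp add: zless_iff)
  then have "(?s + 1) * (?s + 2) \<le> ?t * (?t + 1)" by (intro mult_mono) (use assms in auto)
  moreover have "?s * (?s + 1) + 2 * b < (?s + 1) * (?s + 2)"
  proof -
    have "(?s + 1) * (?s + 2) = ?s * (?s + 1) + 2 * ?s + 2" by (simp add: algebra_simps)
    then show ?thesis using assms(1) by simp
  qed
  ultimately show ?thesis using assms by (simp add: zpair_def)
qed

lemma zpair_inj [simp]:
  assumes "0 \<le> a" "0 \<le> b" "0 \<le> c" "0 \<le> (d :: 'z)" shows "zpair a b = zpair c d \<longleftrightarrow> a = c \<and> b = d"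
proof
  assume *: "zpair a b = zpair c d"
  then have s: "a + b = c + d" using zpair_less[of a b c d] zpair_less[of c d a b] assms by force
  then have "b = d" using * by (simp add: zpair_def)
  then show "a = c \<and> b = d" using s by simp
qed simp

lemma zpair_nonneg [simp]: "0 \<le> a \<Longrightarrow> 0 \<le> b \<Longrightarrow> 0 \<le> zpair a (b :: 'z)"
  by (simp add: zpair_def)

lemma zpair_mono: "0 \<le> a \<Longrightarrow> 0 \<le> b \<Longrightarrow> a \<le> c \<Longrightarrow> b \<le> d \<Longrightarrow> zpair a b \<le> zpair c (d :: 'z)"
  unfolding zpair_def by (intro add_mono mult_mono) auto

lemma zdef_zpair: "zdef M f \<Longrightarrow> zdef M g \<Longrightarrow> zdef M (\<lambda>e. zpair (f e) (g e))"
  unfolding zpair_def by (intro zdefs)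

text \<open>The quotient is the least \<open>q\<close> with \<open>k < d * (q + 1)\<close>. Since
  \<open>k\<close> is a candidate, \<open>q \<le> k\<close> comes for free, as needed for bounded
  quantifiers.\<close>

lemma div_exists: assumes "0 \<le> k" "0 < d"
  obtains q where "0 \<le> q" "q \<le> k" "d * q \<le> k" "k < d * (q + 1 :: 'z)"
proof -
  have "1 * (k + 1) \<le> d * (k + 1)"
    using discrete[OF assms(2)] assms(1) by (intro mult_right_mono) auto
  then have k: "k < d * (k + 1)" by (simp add: zless_iff)
  have "fdef M (\<lambda>e. k < d * (e 0 + 1))" by (intro fdefs)
  then obtain m where m: "0 \<le> m" "m \<le> k" "k < d * (m + 1)" and min: "\<And>j. 0 \<le> j \<Longrightarrow> j < m \<Longrightarrow> \<not> k < d * (j + 1)"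
    using least_number[where \<phi> = "\<lambda>m. k < d * (m + 1)", OF _ assms(1) k] by blast
  have "d * m \<le> k"
  proof (cases "m = 0")
    case False
    then have "0 \<le> m - 1" using m(1) discrete[of m] by simp
    then show ?thesis using min[of "m - 1"] by simp
  qed (use assms in simp)
  then show ?thesis using that m by blast
qed

section \<open>Definable paths\<close>

text \<open>\<open>g\<close> is an arbitrary HOL function on the ring; only its part within the
  number sort can be defined in the model.\<close>

definition grel :: "('z \<Rightarrow> 'z \<times> 'z) \<Rightarrow> 'z \<Rightarrow> 'z \<Rightarrow> 'z \<Rightarrow> bool" where
  "grel g i x y \<longleftrightarrow> 0 \<le> i \<and> 0 \<le> x \<and> 0 \<le> y \<and> g i = (x, y)"

definition fgraph :: "('z \<Rightarrow> 'z \<times> 'z) \<Rightarrow> bool" where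
  "fgraph g \<longleftrightarrow> fdef M (\<lambda>e. grel g (e 0) (e 1) (e 2))"

lemma fgraphI:
  assumes "fdef M (\<lambda>e. \<phi> (e 0) (e 1) (e 2))"
    and "\<And>i x y. 0 \<le> i \<Longrightarrow> 0 \<le> x \<Longrightarrow> 0 \<le> y \<Longrightarrow> g i = (x, y) \<longleftrightarrow> \<phi> i x y"
  shows "fgraph g"
  unfolding fgraph_def grel_def by (rule fdef_cong[OF assms(1)]) (simp add: assms(2))

lemma fdef_grel:
  assumes g: "fgraph g" and f: "zdef M f" "zdef M u" "zdef M v"
  shows "fdef M (\<lambda>e. grel g (f e) (u e) (v e))"
proof -
  \<comment> \<open>Under the nested quantifiers below, the innermost variable \<open>y\<close> has
    index 0, so the three positions are reversed.\<close>
  have *: "fdef M (\<lambda>e. grel g (e 2) (e 1) (e 0))"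
    using fdef_rename[OF g[unfolded fgraph_def], of "\<lambda>k. if k = 0 then 2 else if k = 1 then 1 else 0"] by simp
  have "fdef M (\<lambda>e. zex (f e) (\<lambda>i. zex (u e) (\<lambda>x. zex (v e) (\<lambda>y. i = f e \<and> x = u e \<and> y = v e \<and> grel g i x y))))"
    by (intro fdef_zex fdef_conj fdef_zeq zdef_var zdef_shift f) (use * in \<open>simp add: numeral_2_eq_2\<close>)
  then show ?thesis by (rule fdef_cong) (auto simp: zex_def grel_def)
qed

end

definition unit :: "'z::linordered_idom \<times> 'z \<Rightarrow> bool" where
  "unit d \<longleftrightarrow> d \<in> {(1, 0), (- 1, 0), (0, 1), (0, - 1)}"

definition adj :: "'z::linordered_idom \<times> 'z \<Rightarrow> 'z \<times> 'z \<Rightarrow> bool" where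
  "adj p q \<longleftrightarrow> unit (fst q - fst p, snd q - snd p)"

lemma adj_sym: "adj p q \<Longrightarrow> adj q p"
  by (auto simp: adj_def unit_def algebra_simps)

context arith_model
begin

text \<open>No set is involved: the path becomes a coded sequence only in
  \<open>path_realized\<close>.\<close>

definition path :: "('z \<times> 'z \<Rightarrow> bool) \<Rightarrow> ('z \<Rightarrow> 'z \<times> 'z) \<Rightarrow> 'z \<Rightarrow> bool" where
  "path F g s \<longleftrightarrow> fgraph g \<and> 0 \<le> s \<and> (\<forall>i. 0 \<le> i \<and> i \<le> s \<longrightarrow> F (g i)) \<and>
     (\<forall>i. 0 \<le> i \<and> i < s \<longrightarrow> adj (g i) (g (i + 1)))"

definition conn :: "('z \<times> 'z \<Rightarrow> bool) \<Rightarrow> 'z \<times> 'z \<Rightarrow> 'z \<times> 'z \<Rightarrow> bool" where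
  "conn F a b \<longleftrightarrow> (\<exists>g s. path F g s \<and> g 0 = a \<and> g s = b)"

lemma connI: "path F g s \<Longrightarrow> g 0 = a \<Longrightarrow> g s = b \<Longrightarrow> conn F a b"
  unfolding conn_def by blast

lemma conn_free: "conn F a b \<Longrightarrow> F a \<and> F b"
  unfolding conn_def path_def by auto

lemma fgraph_linear: "fgraph (\<lambda>i. (a + i * b, c + i * d))"
  by (rule fgraphI[where \<phi> = "\<lambda>i x y. a + i * b = x \<and> c + i * d = y"]) (intro fdefs, simp)

lemma conn_adj: assumes "F a" "F b" "adj a b" shows "conn F a b"
proof (rule connI[of F "\<lambda>i. (fst a + i * (fst b - fst a), snd a + i * (snd b - snd a))" 1])
  have *: "i = 0 \<or> i = 1" if "0 \<le> i" "i \<le> 1" for i :: 'z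
    using that zless_iff[of 0 i] by (cases "i = 0") auto
  have **: "i = 0" if "0 \<le> i" "i < 1" for i :: 'z
    using that zless_iff[of i 1] by simp
  show "path F (\<lambda>i. (fst a + i * (fst b - fst a), snd a + i * (snd b - snd a))) 1"
    unfolding path_def using assms by (auto simp: fgraph_linear dest: * **)
qed simp_all

lemma conn_sym: assumes "conn F a b" shows "conn F b a"
proof -
  obtain g s where g: "path F g s" "g 0 = a" "g s = b" using assms unfolding conn_def by blast
  have gr: "fgraph g" and s: "0 \<le> s" using g(1) by (simp_all add: path_def)
  \<comment> \<open>Beyond \<open>s\<close> the argument \<open>s - i\<close> is negative, where
    nothing is known about the graph of \<open>g\<close>; the default \<open>a\<close> keeps the
    reversed graph definable.\<close>
  have "fgraph (\<lambda>i. if i \<le> s then g (s - i) else a)"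
  proof (rule fgraphI)
    show "fdef M (\<lambda>e. if e 0 \<le> s then grel g (s - e 0) (e 1) (e 2) else fst a = e 1 \<and> snd a = e 2)"
      by (intro fdefs fdef_grel gr)
  qed (auto simp: grel_def)
  moreover have "adj (g (s - i)) (g (s - (i + 1)))" if "0 \<le> i" "i < s" for i
  proof -
    have "i + 1 \<le> s" using that by (simp add: zless_iff)
    then have "0 \<le> s - (i + 1)" "s - (i + 1) < s" using that by auto
    then have "adj (g (s - (i + 1))) (g (s - (i + 1) + 1))"
      using g(1) unfolding path_def by blast
    moreover have "s - (i + 1) + 1 = s - i" by simp
    ultimately show ?thesis by (simp add: adj_sym)
  qed
  ultimately have "path F (\<lambda>i. if i \<le> s then g (s - i) else a) s"
    using g(1) unfolding path_def by (auto simp: zless_iff)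
  then show ?thesis by (rule connI) (use g s in auto)
qed

text \<open>Usable a fixed number of times only: \<open>conn\<close> quantifies over functions with
  definable graph, so it cannot be iterated along a curve by induction.\<close>

lemma conn_trans: assumes "conn F a b" "conn F b c" shows "conn F a c"
proof -
  obtain g s where g: "path F g s" "g 0 = a" "g s = b" using assms unfolding conn_def by blast
  obtain h t where h: "path F h t" "h 0 = b" "h t = c" using assms unfolding conn_def by blast
  have gr: "fgraph g" "fgraph h" and s: "0 \<le> s" "0 \<le> t" using g(1) h(1) by (simp_all add: path_def)
  let ?k = "\<lambda>i. if i \<le> s then g i else h (i - s)"
  have "fgraph ?k"
  proof (rule fgraphI)
    show "fdef M (\<lambda>e. if e 0 \<le> s then grel g (e 0) (e 1) (e 2) else grel h (e 0 - s) (e 1) (e 2))"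
      by (intro fdefs fdef_grel gr)
  qed (auto simp: grel_def)
  moreover have "adj (?k i) (?k (i + 1))" if i: "0 \<le> i" "i < s + t" for i
  proof -
    consider "i < s" | "i = s" | "s < i" by force
    then show ?thesis
    proof cases
      case 1
      then show ?thesis using g(1) i unfolding path_def by (auto simp: zless_iff)
    next
      case 2
      then have "0 < t" using i by simp
      then have "adj (h 0) (h (0 + 1))" using h(1) unfolding path_def by blast
      then show ?thesis using 2 g(3) h(2) by simp
    next
      case 3
      then have "adj (h (i - s)) (h (i - s + 1))" using h(1) i unfolding path_def by (simp add: less_diff_eq)
      then show ?thesis using 3 by (simp add: algebra_simps)
    qed
  qed
  moreover have "F (?k i)" if i: "0 \<le> i" "i \<le> s + t" for i
    using g(1) h(1) i unfolding path_def by (auto simp: algebra_simps)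
  ultimately have "path F ?k (s + t)" unfolding path_def using s by simp
  then show ?thesis by (rule connI) (use g h s in auto)
qed

text \<open>Concatenates \<open>m\<close> segments by a single definition, where \<open>m\<close>
  may be nonstandard. Index \<open>5 * q + r\<close> is sent to the \<open>r\<close>-th of the five
  functions at \<open>q\<close>, and the graph finds \<open>q\<close> by a quantifier bounded by the
  index.\<close>

lemma conn_chain:
  assumes gr: "fgraph g0" "fgraph g1" "fgraph g2" "fgraph g3" "fgraph g4" and m: "0 \<le> m" and Fm: "F (g0 m)"
    and F: "\<And>i. 0 \<le> i \<Longrightarrow> i < m \<Longrightarrow> F (g0 i) \<and> F (g1 i) \<and> F (g2 i) \<and> F (g3 i) \<and> F (g4 i)"
    and adj: "\<And>i. 0 \<le> i \<Longrightarrow> i < m \<Longrightarrow> adj (g0 i) (g1 i) \<and> adj (g1 i) (g2 i) \<and> adj (g2 i) (g3 i) \<and>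
      adj (g3 i) (g4 i) \<and> adj (g4 i) (g0 (i + 1))"
  shows "conn F (g0 0) (g0 m)"
proof -
  \<comment> \<open>The quotient by five as a total function, so that \<open>h\<close> is total; its
    defining property is used for indices of the form \<open>5 * q + r\<close>.\<close>
  define dv where "dv k = (THE q. 5 * q \<le> k \<and> k < 5 * (q + 1))" for k :: 'z
  have dv: "dv k = q" if "5 * q \<le> k" "k < 5 * (q + 1)" for k q
    unfolding dv_def
  proof (rule the_equality)
    fix p assume p: "5 * p \<le> k \<and> k < 5 * (p + 1)"
    have "\<not> p < q"
    proof
      assume "p < q"
      then have "p + 1 \<le> q" by (simp add: zless_iff)
      then show False using p that unfolding distrib_left by linarith
    qed
    moreover have "\<not> q < p"
    proof
      assume "q < p"
      then have "q + 1 \<le> p" by (simp add: zless_iff)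
      then show False using p that unfolding distrib_left by linarith
    qed
    ultimately show "p = q" by simp
  qed (use that in simp)
  define h where "h k = (let q = dv k in if k = 5 * q then g0 q else if k = 5 * q + 1 then g1 q
    else if k = 5 * q + 2 then g2 q else if k = 5 * q + 3 then g3 q else g4 q)" for k
  have h: "h (5 * q) = g0 q" "h (5 * q + 1) = g1 q" "h (5 * q + 2) = g2 q" "h (5 * q + 3) = g3 q" "h (5 * q + 4) = g4 q" for q
    using dv[of q "5 * q"] dv[of q "5 * q + 1"] dv[of q "5 * q + 2"] dv[of q "5 * q + 3"] dv[of q "5 * q + 4"]
    by (simp_all add: h_def)
  have split: "\<exists>q. 0 \<le> q \<and> q \<le> k \<and> k \<in> {5 * q, 5 * q + 1, 5 * q + 2, 5 * q + 3, 5 * q + 4}" if k: "0 \<le> k" for k :: 'z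
  proof -
    obtain q where q: "0 \<le> q" "q \<le> k" "5 * q \<le> k" "k < 5 * (q + 1)"
      using div_exists[OF k, of 5] by auto
    have step: "a = k \<or> a + 1 \<le> k" if "a \<le> k" for a using that zless_iff[of a k] by auto
    have "k \<in> {5 * q, 5 * q + 1, 5 * q + 2, 5 * q + 3, 5 * q + 4}"
      using q(3,4) step[of "5 * q"] step[of "5 * q + 1"] step[of "5 * q + 2"] step[of "5 * q + 3"] step[of "5 * q + 4"]
      unfolding distrib_left by (simp add: add.assoc) linarith
    then show ?thesis using q by blast
  qed
  have "fgraph h"
  proof (rule fgraphI)
    show "fdef M (\<lambda>e. zex (e 0) (\<lambda>q. e 0 = 5 * q \<and> grel g0 q (e 1) (e 2) \<or> e 0 = 5 * q + 1 \<and> grel g1 q (e 1) (e 2) \<or>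
        e 0 = 5 * q + 2 \<and> grel g2 q (e 1) (e 2) \<or> e 0 = 5 * q + 3 \<and> grel g3 q (e 1) (e 2) \<or>
        e 0 = 5 * q + 4 \<and> grel g4 q (e 1) (e 2)))"
      by (intro fdefs fdef_grel gr)
    show "h k = (x, y) \<longleftrightarrow> zex k (\<lambda>q. k = 5 * q \<and> grel g0 q x y \<or> k = 5 * q + 1 \<and> grel g1 q x y \<or>
        k = 5 * q + 2 \<and> grel g2 q x y \<or> k = 5 * q + 3 \<and> grel g3 q x y \<or> k = 5 * q + 4 \<and> grel g4 q x y)" (is "_ = ?R")
      if "0 \<le> k" "0 \<le> x" "0 \<le> y" for k x y
    proof
      assume hk: "h k = (x, y)"
      obtain q where q: "0 \<le> q" "q \<le> k" "k \<in> {5 * q, 5 * q + 1, 5 * q + 2, 5 * q + 3, 5 * q + 4}"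
        using split[OF \<open>0 \<le> k\<close>] by blast
      then show ?R unfolding zex_def using hk that by (intro exI[of _ q]) (auto simp: grel_def h)
    next
      assume ?R
      then show "h k = (x, y)" by (auto simp: zex_def grel_def h)
    qed
  qed
  moreover have "F (h k) \<and> (k < 5 * m \<longrightarrow> adj (h k) (h (k + 1)))" if k: "0 \<le> k" "k \<le> 5 * m" for k
  proof (cases "k = 5 * m")
    case True
    then show ?thesis using Fm by (simp add: h)
  next
    case False
    obtain q where q: "0 \<le> q" "q \<le> k" "k \<in> {5 * q, 5 * q + 1, 5 * q + 2, 5 * q + 3, 5 * q + 4}"
      using split[OF \<open>0 \<le> k\<close>] by blast
    have "k < 5 * m" using k False by simp
    moreover have "5 * q \<le> k" using q(3) by auto
    ultimately have "q < m" by linarith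
    note FA = F[OF q(1) \<open>q < m\<close>] adj[OF q(1) \<open>q < m\<close>]
    from q(3) consider "k = 5 * q" | "k = 5 * q + 1" | "k = 5 * q + 2" | "k = 5 * q + 3" | "k = 5 * q + 4" by blast
    then show ?thesis
    proof cases
      case 1
      then show ?thesis using FA by (simp add: h)
    next
      case 2
      then have "k + 1 = 5 * q + 2" by simp
      then show ?thesis using FA 2 by (simp only: h simp_thms)
    next
      case 3
      then have "k + 1 = 5 * q + 3" by simp
      then show ?thesis using FA 3 by (simp only: h simp_thms)
    next
      case 4
      then have "k + 1 = 5 * q + 4" by simp
      then show ?thesis using FA 4 by (simp only: h simp_thms)
    next
      case 5
      then have "k + 1 = 5 * (q + 1)" by simp
      then show ?thesis using FA 5 by (simp only: h simp_thms)
    qed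
  qed
  ultimately have "path F h (5 * m)" using m unfolding path_def by auto
  then show ?thesis by (rule connI) (use h(1)[of 0] h(1)[of m] in simp_all)
qed

end

section \<open>The two sides of a tripled curve\<close>

lemma unit_cases:
  assumes "unit d"
  obtains "d = (1, 0)" | "d = (- 1, 0)" | "d = (0, 1)" | "d = (0, - 1)"
  using assms by (auto simp: unit_def)

text \<open>\<open>interior\<close> has no upper bound on \<open>i\<close>: the vertex function
  continues inside the grid beyond \<open>t\<close>, so that vertices \<open>i + 1\<close> and
  \<open>i + 2\<close> can be quantified with bound \<open>n\<close> for every index. By
  \<open>closed\<close> the last edge is treated like the others.\<close>

locale curve = arith_model M for M :: "('z::{linordered_idom,countable}, 'b::countable) struc" +
  fixes n t :: 'z and c :: "'z \<Rightarrow> 'z \<times> 'z"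
  assumes graph: "fgraph c" and t: "4 \<le> t" and closed: "c t = c 0"
    and inj: "\<And>i j. 0 \<le> i \<Longrightarrow> i < t \<Longrightarrow> 0 \<le> j \<Longrightarrow> j < t \<Longrightarrow> c i = c j \<Longrightarrow> i = j"
    and interior: "\<And>i. 0 \<le> i \<Longrightarrow> 1 \<le> fst (c i) \<and> fst (c i) + 1 \<le> n \<and> 1 \<le> snd (c i) \<and> snd (c i) + 1 \<le> n"
    and adjacent: "\<And>i. 0 \<le> i \<Longrightarrow> i < t \<Longrightarrow> adj (c i) (c (i + 1))"
begin

definition X :: "'z \<Rightarrow> 'z" where "X i = fst (c i)"
definition Y :: "'z \<Rightarrow> 'z" where "Y i = snd (c i)"
definition DX :: "'z \<Rightarrow> 'z" where "DX i = X (i + 1) - X i"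
definition DY :: "'z \<Rightarrow> 'z" where "DY i = Y (i + 1) - Y i"

definition on_curve :: "'z \<times> 'z \<Rightarrow> bool" where
  "on_curve p \<longleftrightarrow> (\<exists>i. 0 \<le> i \<and> i < t \<and>
     (p = (3 * X i, 3 * Y i) \<or> p = (3 * X i + DX i, 3 * Y i + DY i) \<or> p = (3 * X i + 2 * DX i, 3 * Y i + 2 * DY i)))"

definition free :: "'z \<times> 'z \<Rightarrow> bool" where
  "free p \<longleftrightarrow> 0 \<le> fst p \<and> fst p \<le> 3 * n \<and> 0 \<le> snd p \<and> snd p \<le> 3 * n \<and> \<not> on_curve p"

lemma unit_D: "0 \<le> i \<Longrightarrow> i < t \<Longrightarrow> unit (DX i, DY i)"
  using adjacent[of i] by (simp add: adj_def DX_def DY_def X_def Y_def)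

lemma bounds:
  assumes "0 \<le> i" shows "1 \<le> X i" "X i + 1 \<le> n" "1 \<le> Y i" "Y i + 1 \<le> n"
  using interior[OF assms] by (simp_all add: X_def Y_def)

lemma c_eq_iff: "c i = c j \<longleftrightarrow> X i = X j \<and> Y i = Y j"
  by (simp add: X_def Y_def prod_eq_iff)

lemma le_t: "i < t \<Longrightarrow> i + 1 < t \<or> i + 1 = t"
  using zless_iff[of i t] by auto

text \<open>Uniqueness of the balanced remainder modulo 3. It recovers vertex and offset from a
  point of the tripled grid.\<close>

lemma mod3: assumes "3 * a + k = 3 * b + (l :: 'z)" "\<bar>k\<bar> \<le> 1" "\<bar>l\<bar> \<le> 1" shows "a = b \<and> k = l"
proof -
  have k: "- 1 \<le> k" "k \<le> 1" "- 1 \<le> l" "l \<le> 1" using assms(2,3) by (auto simp: abs_le_iff)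
  have "\<not> a < b"
  proof
    assume "a < b"
    then have "a + 1 \<le> b" by (simp add: zless_iff)
    then show False using assms(1) k by linarith
  qed
  moreover have "\<not> b < a"
  proof
    assume "b < a"
    then have "b + 1 \<le> a" by (simp add: zless_iff)
    then show False using assms(1) k by linarith
  qed
  ultimately show ?thesis using assms(1) by simp
qed

lemma succ_inj:
  assumes "0 \<le> i" "i < t" "0 \<le> j" "j < t" "c (i + 1) = c (j + 1)" shows "i = j"
proof -
  consider "i + 1 < t" "j + 1 < t" | "i + 1 = t" "j + 1 < t" | "i + 1 < t" "j + 1 = t" | "i + 1 = t" "j + 1 = t"
    using le_t assms by blast
  then show ?thesis
  proof cases
    case 1 then show ?thesis using inj[of "i + 1" "j + 1"] assms by simp
  next
    case 2 then show ?thesis using inj[of 0 "j + 1"] assms closed t by auto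
  next
    case 3 then show ?thesis using inj[of "i + 1" 0] assms closed t by auto
  next
    case 4 then show ?thesis by (metis add_right_cancel)
  qed
qed

lemma succ_eq: assumes "0 \<le> i" "i < t" "0 \<le> j" "j < t" "c (j + 1) = c i"
  shows "i = j + 1 \<or> i = 0 \<and> j + 1 = t"
proof -
  consider "j + 1 < t" | "j + 1 = t" using le_t assms by blast
  then show ?thesis
  proof cases
    case 1 then show ?thesis using inj[of "j + 1" i] assms by simp
  next
    case 2 then show ?thesis using inj[of 0 i] assms closed t by auto
  qed
qed

lemma pred_exists: assumes "0 \<le> i" "i < t"
  obtains j where "0 \<le> j" "j < t" "c (j + 1) = c i"
proof (cases "i = 0")
  case True
  then show ?thesis using that[of "t - 1"] closed t by simp
next
  case False
  then have "0 \<le> i - 1" using zless_iff[of 0 i] assms by simp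
  then show ?thesis using that[of "i - 1"] assms by auto
qed

text \<open>The curve does not turn back on itself, because it has at least three edges.\<close>

lemma no_backtrack: assumes "0 \<le> i" "i < t" "0 \<le> j" "j < t" "c (j + 1) = c i"
  shows "(DX i, DY i) \<noteq> (- DX j, - DY j)"
proof
  assume "(DX i, DY i) = (- DX j, - DY j)"
  then have *: "c (i + 1) = c j" using assms(5) by (simp add: c_eq_iff DX_def DY_def)
  have "j = i + 1 \<or> j = 0 \<and> i + 1 = t" by (rule succ_eq) (use assms * in auto)
  moreover have "i = j + 1 \<or> i = 0 \<and> j + 1 = t" by (rule succ_eq) (use assms in auto)
  ultimately show False using t by auto
qed

text \<open>Edges are parallel to an axis, so every point of the tripled curve has a coordinate
  divisible by 3.\<close>

lemma not_on_diagonal: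
  assumes "\<bar>k\<bar> = 1" "\<bar>l\<bar> = 1" shows "\<not> on_curve (3 * a + k, 3 * b + l)"
proof
  assume "on_curve (3 * a + k, 3 * b + l)"
  then obtain i where i: "0 \<le> i" "i < t" and
    "(3 * a + k, 3 * b + l) = (3 * X i, 3 * Y i) \<or> (3 * a + k, 3 * b + l) = (3 * X i + DX i, 3 * Y i + DY i) \<or>
     (3 * a + k, 3 * b + l) = (3 * X i + 2 * DX i, 3 * Y i + 2 * DY i)" by (auto simp: on_curve_def)
  moreover have "DX i = 0 \<or> DY i = 0" using unit_D[OF i] by (auto simp: unit_def)
  ultimately consider "3 * a + k = 3 * X i + 0" | "3 * b + l = 3 * Y i + 0" by auto
  then show False using mod3[of a k "X i" 0] mod3[of b l "Y i" 0] assms by cases auto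
qed

lemma on_vertex: "0 \<le> i \<Longrightarrow> i \<le> t \<Longrightarrow> on_curve (3 * X i, 3 * Y i)"
  unfolding on_curve_def using closed t
  by (cases "i = t") (force intro: exI[of _ 0] exI[of _ i] simp: c_eq_iff)+

lemma on_edge1: "0 \<le> i \<Longrightarrow> i < t \<Longrightarrow> on_curve (3 * X i + DX i, 3 * Y i + DY i)"
  unfolding on_curve_def by blast
lemma on_edge2: "0 \<le> i \<Longrightarrow> i < t \<Longrightarrow> on_curve (3 * X i + 2 * DX i, 3 * Y i + 2 * DY i)"
  unfolding on_curve_def by blast

text \<open>Balanced remainders identify the vertex and the direction for each of the three kinds of
  points. A point two thirds along an edge is counted from the end of that edge, where its offset is
  \<open>- DX k\<close> and \<open>- DY k\<close>.\<close>

lemma near_vertex: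
  assumes i: "0 \<le> i" "i < t" and j: "0 \<le> j" "j < t" "c (j + 1) = c i" and e: "unit e"
    and on: "on_curve (3 * X i + fst e, 3 * Y i + snd e)"
  shows "e = (DX i, DY i) \<or> e = (- DX j, - DY j)"
proof -
  obtain k where k: "0 \<le> k" "k < t" and disj:
    "(3 * X i + fst e, 3 * Y i + snd e) = (3 * X k, 3 * Y k) \<or>
     (3 * X i + fst e, 3 * Y i + snd e) = (3 * X k + DX k, 3 * Y k + DY k) \<or>
     (3 * X i + fst e, 3 * Y i + snd e) = (3 * X k + 2 * DX k, 3 * Y k + 2 * DY k)"
    using on by (auto simp: on_curve_def)
  have ab: "\<bar>fst e\<bar> \<le> 1" "\<bar>snd e\<bar> \<le> 1" "\<bar>DX k\<bar> \<le> 1" "\<bar>DY k\<bar> \<le> 1" "e \<noteq> (0, 0)"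
    using e unit_D[OF k] by (auto simp: unit_def)
  from disj show ?thesis
  proof (elim disjE)
    assume "(3 * X i + fst e, 3 * Y i + snd e) = (3 * X k, 3 * Y k)"
    then show ?thesis using mod3[of "X i" "fst e" "X k" 0] mod3[of "Y i" "snd e" "Y k" 0] ab by (cases e) auto
  next
    assume "(3 * X i + fst e, 3 * Y i + snd e) = (3 * X k + DX k, 3 * Y k + DY k)"
    then have "X i = X k \<and> fst e = DX k" "Y i = Y k \<and> snd e = DY k"
      using mod3[of "X i" "fst e" "X k" "DX k"] mod3[of "Y i" "snd e" "Y k" "DY k"] ab by auto
    moreover from this have "i = k" using inj[of i k] i k by (simp add: c_eq_iff)
    ultimately show ?thesis by (simp add: prod_eq_iff)
  next
    assume *: "(3 * X i + fst e, 3 * Y i + snd e) = (3 * X k + 2 * DX k, 3 * Y k + 2 * DY k)"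
    have "3 * X i + fst e = 3 * X (k + 1) + - DX k" "3 * Y i + snd e = 3 * Y (k + 1) + - DY k"
      using * by (simp_all add: DX_def DY_def algebra_simps)
    then have **: "X i = X (k + 1) \<and> fst e = - DX k" "Y i = Y (k + 1) \<and> snd e = - DY k"
      using mod3[of "X i" "fst e" "X (k + 1)" "- DX k"] mod3[of "Y i" "snd e" "Y (k + 1)" "- DY k"] ab by auto
    then have "c (k + 1) = c (j + 1)" using j by (simp add: c_eq_iff)
    then have "k = j" using succ_inj k j by blast
    then show ?thesis using ** by (simp add: prod_eq_iff)
  qed
qed

lemma free_diagonal:
  assumes "\<bar>k\<bar> = 1" "\<bar>l\<bar> = 1" "1 \<le> a" "a + 1 \<le> n" "1 \<le> b" "b + 1 \<le> n"
  shows "free (3 * a + k, 3 * b + l)"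
proof -
  have "- 1 \<le> k \<and> k \<le> 1" "- 1 \<le> l \<and> l \<le> 1" using assms(1,2) by (auto simp: abs_if split: if_splits)
  then have "0 \<le> 3 * a + k" "3 * a + k \<le> 3 * n" "0 \<le> 3 * b + l" "3 * b + l \<le> 3 * n" using assms(3-) by linarith+
  then show ?thesis using not_on_diagonal[OF assms(1,2)] by (simp add: free_def)
qed

lemma free_near_vertex:
  assumes "0 \<le> i" "i < t" "0 \<le> j" "j < t" "c (j + 1) = c i" "unit e" "e \<noteq> (DX i, DY i)" "e \<noteq> (- DX j, - DY j)"
  shows "free (3 * X i + fst e, 3 * Y i + snd e)"
proof -
  have "- 1 \<le> fst e \<and> fst e \<le> 1" "- 1 \<le> snd e \<and> snd e \<le> 1" using assms(6) by (auto simp: unit_def)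
  then have "0 \<le> 3 * X i + fst e" "3 * X i + fst e \<le> 3 * n" "0 \<le> 3 * Y i + snd e" "3 * Y i + snd e \<le> 3 * n"
    using bounds[OF assms(1)] by linarith+
  then show ?thesis using near_vertex[OF assms(1-6)] assms(7,8) by (auto simp: free_def)
qed

text \<open>The points on the two sides of the tripled edges, for \<open>\<sigma> = 1\<close> to the left and for \<open>\<sigma> = - 1\<close> to the right.\<close>

definition side :: "'z \<Rightarrow> 'z \<Rightarrow> 'z \<times> 'z" where
  "side \<sigma> i = (3 * X i + DX i - \<sigma> * DY i, 3 * Y i + DY i + \<sigma> * DX i)"

text \<open>Both points are diagonal neighbours of tripled vertices, the first of vertex
  \<open>i\<close> and the second of vertex \<open>i + 1\<close>.\<close>

lemma free_side: assumes "\<sigma> = 1 \<or> \<sigma> = - 1" "0 \<le> i" "i < t"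
  shows "free (side \<sigma> i)" "free (fst (side \<sigma> i) + DX i, snd (side \<sigma> i) + DY i)"
proof -
  have "\<bar>DX i - \<sigma> * DY i\<bar> = 1" "\<bar>DY i + \<sigma> * DX i\<bar> = 1" "\<bar>- DX i - \<sigma> * DY i\<bar> = 1" "\<bar>- DY i + \<sigma> * DX i\<bar> = 1"
    using unit_D[OF assms(2,3)] assms(1) by (auto simp: unit_def)
  note * = this
  show "free (side \<sigma> i)"
    using free_diagonal[OF *(1,2) bounds[OF assms(2)]] by (simp add: side_def add_diff_eq add.assoc)
  have "0 \<le> i + 1" using assms(2) by simp
  from free_diagonal[OF *(3,4) bounds[OF this]]
  show "free (fst (side \<sigma> i) + DX i, snd (side \<sigma> i) + DY i)"
    by (simp add: side_def DX_def DY_def algebra_simps)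
qed

lemma zexI: "0 \<le> a \<Longrightarrow> a \<le> b \<Longrightarrow> \<phi> a \<Longrightarrow> zex b \<phi>"
  unfolding zex_def by blast

text \<open>A segment of a side path depends on two consecutive edges, hence on three vertices;
  their coordinates are fetched from the graph of \<open>c\<close> by quantifiers bounded by
  \<open>n\<close>.\<close>

lemma fgraph_six:
  assumes "fdef M (\<lambda>e. F (e 0) (e 1) (e 2) (e 3) (e 4) (e 5) = (e 6, e 7))"
  shows "fgraph (\<lambda>i. F (X i) (Y i) (X (i + 1)) (Y (i + 1)) (X (i + 2)) (Y (i + 2)))"
proof (rule fgraphI)
  \<comment> \<open>Index 0 is the innermost of the six quantified coordinates and index 6 is the
    argument \<open>i\<close>; hence the reversal and the shift.\<close>
  have *: "fdef M (\<lambda>e. F (e 5) (e 4) (e 3) (e 2) (e 1) (e 0) = (e 7, e 8))"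
    using fdef_rename[OF assms, of "\<lambda>k. if k < 6 then 5 - k else k + 1"] by simp
  show "fdef M (\<lambda>e. zex n (\<lambda>x. zex n (\<lambda>y. zex n (\<lambda>x'. zex n (\<lambda>y'. zex n (\<lambda>x''. zex n (\<lambda>y''.
      grel c (e 0) x y \<and> grel c (e 0 + 1) x' y' \<and> grel c (e 0 + 2) x'' y'' \<and> F x y x' y' x'' y'' = (e 1, e 2))))))))"
    by (intro fdefs fdef_grel graph) (use * in \<open>simp add: eval_nat_numeral\<close>)
  show "F (X i) (Y i) (X (i + 1)) (Y (i + 1)) (X (i + 2)) (Y (i + 2)) = (x, y) \<longleftrightarrow>
    zex n (\<lambda>x0. zex n (\<lambda>y0. zex n (\<lambda>x'. zex n (\<lambda>y'. zex n (\<lambda>x''. zex n (\<lambda>y''.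
      grel c i x0 y0 \<and> grel c (i + 1) x' y' \<and> grel c (i + 2) x'' y'' \<and> F x0 y0 x' y' x'' y'' = (x, y)))))))"
    (is "?l \<longleftrightarrow> ?r") if i: "0 \<le> i" for i x y
  proof
    have b: "0 \<le> X k \<and> X k \<le> n \<and> 0 \<le> Y k \<and> Y k \<le> n \<and> grel c k (X k) (Y k)" if "0 \<le> k" for k
    proof -
      have "0 \<le> X k \<and> X k \<le> n \<and> 0 \<le> Y k \<and> Y k \<le> n" using bounds[OF that] by linarith
      then show ?thesis using that by (simp add: grel_def X_def Y_def)
    qed
    have "0 \<le> i + 1" "0 \<le> i + 2" using i by simp_all
    note b = b[OF i] b[OF this(1)] b[OF this(2)]
    assume l: ?l
    show ?r
      by (rule zexI[of "X i", rotated 2], rule zexI[of "Y i", rotated 2], rule zexI[of "X (i + 1)", rotated 2],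
          rule zexI[of "Y (i + 1)", rotated 2], rule zexI[of "X (i + 2)", rotated 2],
          rule zexI[of "Y (i + 2)", rotated 2]) (use b l in simp_all)
  next
    assume ?r
    then show ?l unfolding zex_def grel_def X_def Y_def by (elim exE conjE) simp
  qed
qed

lemma if_pair_eq: "(if P then p else q) = r \<longleftrightarrow> (if P then p = r else q = r)"
  by simp

text \<open>
  Getting from one edge to the next takes one step along the edge and then two steps past a straight
  vertex, four around an outer corner and none at an inner corner. Steps back and forth bring this up
  to five in all cases, which makes the position of a point on the path definable from its index.
\<close>

lemma conn_side: assumes \<sigma>: "\<sigma> = 1 \<or> \<sigma> = - 1" and m: "0 \<le> m" "m < t"
  shows "conn free (side \<sigma> 0) (side \<sigma> m)"
proof -
  \<comment> \<open>The left normal of edge \<open>i\<close> is \<open>(- DY i, DX i)\<close>. At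
    the next vertex, \<open>inner\<close> is a turn towards side \<sigma> and \<open>outer\<close> a
    turn away from it.\<close>
  define inner where "inner i \<longleftrightarrow> DX (i + 1) = - \<sigma> * DY i \<and> DY (i + 1) = \<sigma> * DX i" for i
  define outer where "outer i \<longleftrightarrow> DX (i + 1) = \<sigma> * DY i \<and> DY (i + 1) = - \<sigma> * DX i" for i
  \<comment> \<open>Straight on, \<open>g2\<close> and \<open>g4\<close> both lie beside the vertex,
    with a step back to \<open>g1\<close> between them. At an inner corner the path oscillates
    between \<open>side \<sigma> i\<close> and \<open>g1\<close>, which is already
    \<open>side \<sigma> (i + 1)\<close>. At an outer corner all points differ.\<close>
  define g1 where "g1 i = (3 * X (i + 1) - DX i - \<sigma> * DY i, 3 * Y (i + 1) - DY i + \<sigma> * DX i)" for i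
  define g2 where "g2 i = (if inner i then (3 * X i + DX i - \<sigma> * DY i, 3 * Y i + DY i + \<sigma> * DX i)
    else (3 * X (i + 1) - \<sigma> * DY i, 3 * Y (i + 1) + \<sigma> * DX i))" for i
  define g3 where "g3 i = (if outer i then (3 * X (i + 1) + DX i - \<sigma> * DY i, 3 * Y (i + 1) + DY i + \<sigma> * DX i)
    else (3 * X (i + 1) - DX i - \<sigma> * DY i, 3 * Y (i + 1) - DY i + \<sigma> * DX i))" for i
  define g4 where "g4 i = (if outer i then (3 * X (i + 1) + DX i, 3 * Y (i + 1) + DY i)
    else if inner i then (3 * X i + DX i - \<sigma> * DY i, 3 * Y i + DY i + \<sigma> * DX i)
    else (3 * X (i + 1) - \<sigma> * DY i, 3 * Y (i + 1) + \<sigma> * DX i))" for i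
  have i2: "i + 1 + 1 = i + 2" for i :: 'z by simp
  have "fgraph (side \<sigma>)" unfolding side_def[abs_def] inner_def outer_def DX_def DY_def i2
    by (rule fgraph_six[where F = "\<lambda>x y x' y' x'' y''. (3 * x + (x' - x) - \<sigma> * (y' - y), 3 * y + (y' - y) + \<sigma> * (x' - x))"])
      (unfold if_pair_eq prod.inject, intro fdefs)
  moreover have "fgraph g1" unfolding g1_def[abs_def] inner_def outer_def DX_def DY_def i2
    by (rule fgraph_six[where F = "\<lambda>x y x' y' x'' y''. (3 * x' - (x' - x) - \<sigma> * (y' - y), 3 * y' - (y' - y) + \<sigma> * (x' - x))"])
      (unfold if_pair_eq prod.inject, intro fdefs)
  moreover have "fgraph g2" unfolding g2_def[abs_def] inner_def outer_def DX_def DY_def i2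
    by (rule fgraph_six[where F = "\<lambda>x y x' y' x'' y''. if x'' - x' = - \<sigma> * (y' - y) \<and> y'' - y' = \<sigma> * (x' - x)
      then (3 * x + (x' - x) - \<sigma> * (y' - y), 3 * y + (y' - y) + \<sigma> * (x' - x))
      else (3 * x' - \<sigma> * (y' - y), 3 * y' + \<sigma> * (x' - x))"])
      (unfold if_pair_eq prod.inject, intro fdefs)
  moreover have "fgraph g3" unfolding g3_def[abs_def] inner_def outer_def DX_def DY_def i2
    by (rule fgraph_six[where F = "\<lambda>x y x' y' x'' y''. if x'' - x' = \<sigma> * (y' - y) \<and> y'' - y' = - \<sigma> * (x' - x)
      then (3 * x' + (x' - x) - \<sigma> * (y' - y), 3 * y' + (y' - y) + \<sigma> * (x' - x))
      else (3 * x' - (x' - x) - \<sigma> * (y' - y), 3 * y' - (y' - y) + \<sigma> * (x' - x))"])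
      (unfold if_pair_eq prod.inject, intro fdefs)
  moreover have "fgraph g4" unfolding g4_def[abs_def] inner_def outer_def DX_def DY_def i2
    by (rule fgraph_six[where F = "\<lambda>x y x' y' x'' y''. if x'' - x' = \<sigma> * (y' - y) \<and> y'' - y' = - \<sigma> * (x' - x)
      then (3 * x' + (x' - x), 3 * y' + (y' - y))
      else if x'' - x' = - \<sigma> * (y' - y) \<and> y'' - y' = \<sigma> * (x' - x)
      then (3 * x + (x' - x) - \<sigma> * (y' - y), 3 * y + (y' - y) + \<sigma> * (x' - x))
      else (3 * x' - \<sigma> * (y' - y), 3 * y' + \<sigma> * (x' - x))"])
      (unfold if_pair_eq prod.inject, intro fdefs)
  moreover have "(free (side \<sigma> i) \<and> free (g1 i) \<and> free (g2 i) \<and> free (g3 i) \<and> free (g4 i)) \<and>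
      adj (side \<sigma> i) (g1 i) \<and> adj (g1 i) (g2 i) \<and> adj (g2 i) (g3 i) \<and> adj (g3 i) (g4 i) \<and> adj (g4 i) (side \<sigma> (i + 1))"
    if i: "0 \<le> i" "i < m" for i
  proof -
    have it: "i < t" "0 \<le> i + 1" "i + 1 < t" using i m by (auto simp: zless_iff)
    have X: "X i = X (i + 1) - DX i" "Y i = Y (i + 1) - DY i" by (simp_all add: DX_def DY_def)
    note free = free_side[OF \<sigma> i(1) it(1)]
    note near = free_near_vertex[OF it(2,3) i(1) it(1) refl]
    have f0: "free (side \<sigma> i)" and f1: "free (g1 i)"
      using free by (simp_all add: g1_def side_def X algebra_simps)
    have u: "unit (DX i, DY i)" and u': "unit (DX (i + 1), DY (i + 1))" using unit_D i it by auto
    have nb: "(DX (i + 1), DY (i + 1)) \<noteq> (- DX i, - DY i)" by (rule no_backtrack) (use i it in auto)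
    have f2: "free (3 * X (i + 1) - \<sigma> * DY i, 3 * Y (i + 1) + \<sigma> * DX i)" if "\<not> inner i"
      using near[of "(- \<sigma> * DY i, \<sigma> * DX i)"] that u \<sigma> by (auto simp: inner_def unit_def)
    have f4: "free (3 * X (i + 1) + DX i, 3 * Y (i + 1) + DY i)" if "outer i"
      using near[of "(DX i, DY i)"] that u \<sigma> by (auto simp: outer_def unit_def)
    have f3: "free (3 * X (i + 1) + DX i - \<sigma> * DY i, 3 * Y (i + 1) + DY i + \<sigma> * DX i)"
      using free_diagonal[OF _ _ bounds[OF it(2)], of "DX i - \<sigma> * DY i" "DY i + \<sigma> * DX i"] u \<sigma>
      by (auto simp: unit_def algebra_simps)
    have "free (g2 i)" "free (g3 i)" "free (g4 i)"
      using f0 f1 f2 f3 f4 by (auto simp: g1_def g2_def g3_def g4_def side_def)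
    \<comment> \<open>The fourth possibility, a reversal, is excluded by \<open>nb\<close>.\<close>
    moreover have "DX (i + 1) = DX i \<and> DY (i + 1) = DY i \<and> \<not> inner i \<and> \<not> outer i \<or> inner i \<and> \<not> outer i \<or> outer i \<and> \<not> inner i"
      using \<sigma> nb unfolding inner_def outer_def
      by (elim disjE; cases rule: unit_cases[OF u]; cases rule: unit_cases[OF u']; simp)
    then have "adj (side \<sigma> i) (g1 i) \<and> adj (g1 i) (g2 i) \<and> adj (g2 i) (g3 i) \<and> adj (g3 i) (g4 i) \<and>
        adj (g4 i) (side \<sigma> (i + 1))"
    proof (elim disjE conjE)
      assume "DX (i + 1) = DX i" "DY (i + 1) = DY i" "\<not> inner i" "\<not> outer i"
      then show ?thesis
        unfolding g1_def g2_def g3_def g4_def side_def X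
        using \<sigma> by (elim disjE; cases rule: unit_cases[OF u]; simp add: adj_def unit_def)
    next
      assume "inner i" "\<not> outer i"
      then show ?thesis
        unfolding g1_def g2_def g3_def g4_def side_def X
        using \<sigma> by (elim disjE; cases rule: unit_cases[OF u]; simp add: adj_def unit_def inner_def)
    next
      assume "outer i" "\<not> inner i"
      then show ?thesis
        unfolding g1_def g2_def g3_def g4_def side_def X
        using \<sigma> by (elim disjE; cases rule: unit_cases[OF u]; simp add: adj_def unit_def outer_def)
    qed
    ultimately show ?thesis using f0 f1 by blast
  qed
  ultimately show ?thesis
    by (intro conn_chain[of "side \<sigma>" g1 g2 g3 g4] m(1) free_side(1)[OF \<sigma> m]) blast+
qed

section \<open>Points connected to one side of the curve\<close>

definition beside :: "'z \<Rightarrow> 'z \<times> 'z \<Rightarrow> bool" where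
  "beside \<sigma> p \<longleftrightarrow> conn free p (side \<sigma> 0)"

lemma beside_side: "\<sigma> = 1 \<or> \<sigma> = - 1 \<Longrightarrow> 0 \<le> i \<Longrightarrow> i < t \<Longrightarrow> beside \<sigma> (side \<sigma> i)"
  unfolding beside_def by (rule conn_sym, rule conn_side)

lemma beside_adj: "beside \<sigma> q \<Longrightarrow> free p \<Longrightarrow> adj p q \<Longrightarrow> beside \<sigma> p"
  unfolding beside_def by (rule conn_trans[OF conn_adj]) (auto dest: conn_free)

text \<open>\<open>side \<sigma> i\<close> is the point for \<open>k = 1\<close>, and the other two
  are its neighbours in the direction of the edge.\<close>

lemma beside_normal:
  assumes \<sigma>: "\<sigma> = 1 \<or> \<sigma> = - 1" and i: "0 \<le> i" "i < t" and k: "k = 0 \<or> k = 1 \<or> k = 2"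
    and p: "p = (3 * X i + k * DX i - \<sigma> * DY i, 3 * Y i + k * DY i + \<sigma> * DX i)" "free p"
  shows "beside \<sigma> p"
  using k
proof (elim disjE)
  assume k: "k = 0"
  have "adj p (side \<sigma> i)" using unit_D[OF i] by (simp add: adj_def p k side_def)
  with beside_side[OF \<sigma> i] p(2) show ?thesis by (rule beside_adj)
next
  assume k: "k = 1"
  then have "p = side \<sigma> i" by (simp add: side_def p)
  then show ?thesis using beside_side \<sigma> i by simp
next
  assume k: "k = 2"
  have "adj (side \<sigma> i) p" using unit_D[OF i] by (simp add: adj_def p k side_def algebra_simps)
  with beside_side[OF \<sigma> i] p(2) show ?thesis by (blast intro: beside_adj adj_sym)
qed

lemma normal_or_parallel:
  assumes d: "unit d" and e: "unit e"
  obtains "e = d" | "e = (- fst d, - snd d)" | \<sigma> where "\<sigma> = 1 \<or> \<sigma> = - 1" "e = (- \<sigma> * snd d, \<sigma> * fst d)"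
proof -
  have "e = d \<or> e = (- fst d, - snd d) \<or> e = (- 1 * snd d, 1 * fst d) \<or> e = (- (- 1) * snd d, - 1 * fst d)"
    by (cases rule: unit_cases[OF d]; cases rule: unit_cases[OF e]; simp)
  then show ?thesis using that(1,2) that(3)[of 1] that(3)[of "- 1"] by blast
qed

lemma on_curveE:
  assumes "on_curve w"
  obtains i k where "0 \<le> i" "i < t" "k = 0 \<or> k = 1 \<or> k = 2" "w = (3 * X i + k * DX i, 3 * Y i + k * DY i)"
proof -
  obtain i where "0 \<le> i" "i < t" "w = (3 * X i, 3 * Y i) \<or> w = (3 * X i + DX i, 3 * Y i + DY i) \<or>
     w = (3 * X i + 2 * DX i, 3 * Y i + 2 * DY i)" using assms unfolding on_curve_def by blast
  then show ?thesis using that[of i 0] that[of i 1] that[of i 2] by auto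
qed

lemma on_edge: "0 \<le> i \<Longrightarrow> i < t \<Longrightarrow> k = 0 \<or> k = 1 \<or> k = 2 \<or> k = 3 \<Longrightarrow> on_curve (3 * X i + k * DX i, 3 * Y i + k * DY i)"
  using on_vertex[of i] on_edge1[of i] on_edge2[of i] on_vertex[of "i + 1"] le_t[of i]
  by (auto simp: DX_def DY_def algebra_simps)

text \<open>The step \<open>e\<close> is compared with the edge through \<open>w\<close>. A normal
  step is covered by \<open>beside_normal\<close>. A parallel step stays on the curve, unless it
  goes backwards from the start of the edge; then the preceding edge takes over.\<close>

lemma neighbour_beside:
  assumes w: "on_curve w" and p: "free p" and e: "unit e" "p = (fst w + fst e, snd w + snd e)"
  shows "beside 1 p \<or> beside (- 1) p"
proof -
  have off: "\<not> on_curve p" using p by (simp add: free_def)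
  obtain i k where i: "0 \<le> i" "i < t" and k: "k = 0 \<or> k = 1 \<or> k = 2"
    and w: "w = (3 * X i + k * DX i, 3 * Y i + k * DY i)" using on_curveE[OF w] .
  show ?thesis
    using unit_D[OF i] e(1)
  proof (cases rule: normal_or_parallel)
    case 1
    then have "p = (3 * X i + (k + 1) * DX i, 3 * Y i + (k + 1) * DY i)" by (simp add: e(2) w algebra_simps)
    moreover have "k + 1 = 1 \<or> k + 1 = 2 \<or> k + 1 = 3" using k by auto
    ultimately show ?thesis using on_edge[OF i, of "k + 1"] off by auto
  next
    case 2
    then have pe: "p = (3 * X i + (k - 1) * DX i, 3 * Y i + (k - 1) * DY i)" by (simp add: e(2) w algebra_simps)
    show ?thesis
    proof (cases "k = 0")
      case False
      then have "k - 1 = 0 \<or> k - 1 = 1" using k by auto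
      then show ?thesis using on_edge[OF i, of "k - 1"] off pe by auto
    next
      case True
      obtain j where j: "0 \<le> j" "j < t" "c (j + 1) = c i" using pred_exists[OF i] .
      have ij: "X i = X j + DX j" "Y i = Y j + DY j" using j(3) by (simp_all add: c_eq_iff DX_def DY_def)
      show ?thesis
        using unit_D[OF j(1,2)] e(1)
      proof (cases rule: normal_or_parallel)
        case 1
        then show ?thesis using no_backtrack[OF i j] 2 by auto
      next
        case 2
        then have "p = (3 * X j + 2 * DX j, 3 * Y j + 2 * DY j)" by (simp add: e(2) w True ij algebra_simps)
        then show ?thesis using off on_edge2[OF j(1,2)] by simp
      next
        case (3 \<sigma>)
        \<comment> \<open>Two thirds along the preceding edge, moved to side \<sigma>: diagonal to
          the vertex and hence free, and one step away from \<open>p\<close>.\<close>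
        let ?q = "(3 * X j + 2 * DX j - \<sigma> * DY j, 3 * Y j + 2 * DY j + \<sigma> * DX j)"
        have "free ?q" using free_side(2)[OF 3(1) j(1,2)] by (simp add: side_def algebra_simps)
        then have "beside \<sigma> ?q" by (intro beside_normal[OF 3(1) j(1,2), of 2]) auto
        moreover have "adj ?q p" using unit_D[OF j(1,2)] 3(2) by (simp add: adj_def e(2) w True ij algebra_simps)
        ultimately have "beside \<sigma> p" using beside_adj[of \<sigma> ?q p] adj_sym[of ?q p] p by blast
        then show ?thesis using 3(1) by auto
      qed
    qed
  next
    case (3 \<sigma>)
    have "beside \<sigma> p"
      by (rule beside_normal[OF 3(1) i k _ p]) (simp add: e(2) w 3(2))
    then show ?thesis using 3(1) by auto
  qed
qed

text \<open>If \<open>e\<close> were parallel to the edge through \<open>w\<close>, one of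
  \<open>p\<close> and \<open>q\<close> would be on the curve. So \<open>e\<close> is normal to that
  edge, and the two points are displaced with opposite signs.\<close>

lemma opposite_beside:
  assumes w: "on_curve w" and e: "unit e"
    and p: "free p" "p = (fst w + fst e, snd w + snd e)" and q: "free q" "q = (fst w - fst e, snd w - snd e)"
  obtains \<sigma> where "\<sigma> = 1 \<or> \<sigma> = - 1" "beside \<sigma> p" "beside (- \<sigma>) q"
proof -
  have off: "\<not> on_curve p" "\<not> on_curve q" using p q by (simp_all add: free_def)
  obtain i k where i: "0 \<le> i" "i < t" and k: "k = 0 \<or> k = 1 \<or> k = 2"
    and w: "w = (3 * X i + k * DX i, 3 * Y i + k * DY i)" using on_curveE[OF w] .
  have "k + 1 = 1 \<or> k + 1 = 2 \<or> k + 1 = 3" using k by auto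
  then have on: "on_curve (3 * X i + (k + 1) * DX i, 3 * Y i + (k + 1) * DY i)" using on_edge[OF i] by blast
  show ?thesis
    using unit_D[OF i] e
  proof (cases rule: normal_or_parallel)
    case 1
    then show ?thesis using on off by (simp add: p(2) w algebra_simps)
  next
    case 2
    then show ?thesis using on off by (simp add: q(2) w algebra_simps)
  next
    case (3 \<sigma>)
    have "beside \<sigma> p" by (rule beside_normal[OF 3(1) i k _ p(1)]) (simp add: p(2) w 3(2))
    moreover have "beside (- \<sigma>) q" by (rule beside_normal[OF _ i k _ q(1)]) (use 3(1) in \<open>auto simp: q(2) w 3(2)\<close>)
    ultimately show ?thesis using that 3(1) by blast
  qed
qed

section \<open>Straight walks and the separation theorem\<close>

lemma fdef_on_curve: assumes "zdef M f" "zdef M g" shows "fdef M (\<lambda>e. on_curve (f e, g e))"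
proof -
  have sh: "zdef M (\<lambda>e. h (\<lambda>k. e (Suc (Suc (Suc (Suc (Suc k)))))))" if "zdef M h" for h
    using that by (intro zdef_shift)
  have "fdef M (\<lambda>e. zex t (\<lambda>i. zex n (\<lambda>x. zex n (\<lambda>y. zex n (\<lambda>x'. zex n (\<lambda>y'. i < t \<and> grel c i x y \<and> grel c (i + 1) x' y' \<and>
    (f e = 3 * x \<and> g e = 3 * y \<or> f e = 2 * x + x' \<and> g e = 2 * y + y' \<or> f e = x + 2 * x' \<and> g e = y + 2 * y')))))))"
    by (intro fdefs fdef_grel graph sh assms)
  then show ?thesis
  proof (rule fdef_cong)
    fix e :: "nat \<Rightarrow> 'z"
    have b: "0 \<le> X i \<and> X i \<le> n \<and> 0 \<le> Y i \<and> Y i \<le> n \<and> grel c i (X i) (Y i)" if "0 \<le> i" for i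
    proof -
      have "0 \<le> X i \<and> X i \<le> n \<and> 0 \<le> Y i \<and> Y i \<le> n" using bounds[OF that] by linarith
      then show ?thesis using that by (simp add: grel_def X_def Y_def)
    qed
    have "zex t (\<lambda>i. zex n (\<lambda>x. zex n (\<lambda>y. zex n (\<lambda>x'. zex n (\<lambda>y'. i < t \<and> grel c i x y \<and> grel c (i + 1) x' y' \<and> Q x y x' y')))))
      \<longleftrightarrow> (\<exists>i. 0 \<le> i \<and> i < t \<and> Q (X i) (Y i) (X (i + 1)) (Y (i + 1)))" (is "?l \<longleftrightarrow> ?r") for Q
    proof
      assume ?l
      then show ?r unfolding zex_def grel_def
      proof (elim exE conjE)
        fix i x y x' y'
        assume "0 \<le> i" "i < t" "c i = (x, y)" "c (i + 1) = (x', y')" "Q x y x' y'"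
        then show ?r by (intro exI[of _ i]) (simp add: X_def Y_def)
      qed
    next
      assume ?r
      then obtain i where i: "0 \<le> i" "i < t" "Q (X i) (Y i) (X (i + 1)) (Y (i + 1))" by blast
      have "0 \<le> i + 1" using i(1) by simp
      note b = b[OF i(1)] b[OF this]
      show ?l
        by (rule zexI[of i, rotated 2], rule zexI[of "X i", rotated 2], rule zexI[of "Y i", rotated 2],
            rule zexI[of "X (i + 1)", rotated 2], rule zexI[of "Y (i + 1)", rotated 2]) (use b i in simp_all)
    qed
    then show "zex t (\<lambda>i. zex n (\<lambda>x. zex n (\<lambda>y. zex n (\<lambda>x'. zex n (\<lambda>y'. i < t \<and> grel c i x y \<and> grel c (i + 1) x' y' \<and>
      (f e = 3 * x \<and> g e = 3 * y \<or> f e = 2 * x + x' \<and> g e = 2 * y + y' \<or> f e = x + 2 * x' \<and> g e = y + 2 * y')))))) \<longleftrightarrow>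
      on_curve (f e, g e)"
      by (simp add: on_curve_def DX_def DY_def algebra_simps)
  qed
qed

text \<open>If the curve is met, the point just before the first contact is free and adjacent to the
  curve, so \<open>neighbour_beside\<close> applies to it.\<close>

lemma walk:
  assumes p: "free p" and u: "unit u" and s: "0 \<le> s"
    and q: "q = (fst p + s * fst u, snd p + s * snd u)" "0 \<le> fst q" "fst q \<le> 3 * n" "0 \<le> snd q" "snd q \<le> 3 * n"
  shows "conn free p q \<or> (\<exists>r. conn free p r \<and> (beside 1 r \<or> beside (- 1) r))"
proof -
  let ?g = "\<lambda>i. (fst p + i * fst u, snd p + i * snd u)"
  have grid: "0 \<le> fst (?g i) \<and> fst (?g i) \<le> 3 * n \<and> 0 \<le> snd (?g i) \<and> snd (?g i) \<le> 3 * n" if "0 \<le> i" "i \<le> s" for i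
  proof -
    \<comment> \<open>Each coordinate changes monotonically along the walk, so it stays between its
      values at the two ends.\<close>
    have between: "0 \<le> a + i * k \<and> a + i * k \<le> N"
      if "k = 0 \<or> k = 1 \<or> k = - 1" "0 \<le> a" "a \<le> N" "0 \<le> a + s * k" "a + s * k \<le> N" for a k N
      using that(1)
    proof (elim disjE)
      assume "k = 1"
      then show ?thesis using that \<open>0 \<le> i\<close> \<open>i \<le> s\<close> by auto
    next
      assume "k = - 1"
      then show ?thesis using that \<open>0 \<le> i\<close> \<open>i \<le> s\<close> by auto
    qed (use that in simp)
    have "fst u = 0 \<or> fst u = 1 \<or> fst u = - 1" "snd u = 0 \<or> snd u = 1 \<or> snd u = - 1"
      using u by (auto simp: unit_def)
    then show ?thesis
      using between[of "fst u" "fst p" "3 * n"] between[of "snd u" "snd p" "3 * n"] p q by (simp add: free_def)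
  qed
  have adj: "adj (?g i) (?g (i + 1))" for i using u by (simp add: adj_def algebra_simps)
  show ?thesis
  proof (cases "\<exists>i. 0 \<le> i \<and> i \<le> s \<and> on_curve (?g i)")
    case False
    then have "path free ?g s" unfolding path_def using s grid adj by (auto simp: free_def fgraph_linear)
    then have "conn free p q" by (rule connI) (simp_all add: q)
    then show ?thesis ..
  next
    case True
    then obtain i where i: "0 \<le> i" "i \<le> s" "on_curve (?g i)" by blast
    \<comment> \<open>Definability of the curve is what guarantees a first point of contact.\<close>
    have "fdef M (\<lambda>e. on_curve (?g (e 0)))" by (intro fdef_on_curve fdefs)
    then obtain m where m: "0 \<le> m" "m \<le> i" "on_curve (?g m)" and least: "\<And>k. 0 \<le> k \<Longrightarrow> k < m \<Longrightarrow> \<not> on_curve (?g k)"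
      using least_number[where \<phi> = "\<lambda>i. on_curve (?g i)", OF _ i(1,3)] by blast
    have ms: "m \<le> s" using m(2) i(2) by simp
    have "m \<noteq> 0" using m(3) p by (auto simp: free_def)
    then have m1: "0 \<le> m - 1" using m zless_iff[of 0 m] by simp
    have "free (?g i)" if "0 \<le> i" "i \<le> m - 1" for i
      using grid[of i] least[of i] that ms zless_iff[of i m] by (auto simp: free_def)
    then have P: "path free ?g (m - 1)" unfolding path_def using m1 adj by (auto simp: fgraph_linear)
    then have "conn free p (?g (m - 1))" by (rule connI) simp_all
    moreover have "beside 1 (?g (m - 1)) \<or> beside (- 1) (?g (m - 1))"
    proof (rule neighbour_beside[OF m(3), of _ "(- fst u, - snd u)"])
      show "free (?g (m - 1))" using P m1 unfolding path_def by auto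
      show "unit (- fst u, - snd u)" using u by (auto simp: unit_def)
    qed (simp add: algebra_simps)
    ultimately show ?thesis by blast
  qed
qed

theorem separation:
  assumes p: "free p" and w: "on_curve (x, y)" and a: "free a" and b: "free b"
    and ab: "a = (x, y + 1) \<and> b = (x, y - 1) \<or> a = (x, y - 1) \<and> b = (x, y + 1)"
  shows "conn free p a \<or> conn free p b"
proof -
  have "\<exists>\<sigma>. (\<sigma> = 1 \<or> \<sigma> = - 1) \<and> beside \<sigma> a \<and> beside (- \<sigma>) b"
    using ab
  proof (elim disjE conjE)
    assume *: "a = (x, y + 1)" "b = (x, y - 1)"
    show ?thesis
      by (rule opposite_beside[OF w _ a _ b, of "(0, 1)"]) (use * in \<open>auto simp: unit_def\<close>)
  next
    assume *: "a = (x, y - 1)" "b = (x, y + 1)"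
    show ?thesis
      by (rule opposite_beside[OF w _ a _ b, of "(0, - 1)"]) (use * in \<open>auto simp: unit_def\<close>)
  qed
  then obtain \<sigma> where \<sigma>: "\<sigma> = 1 \<or> \<sigma> = - 1" "beside \<sigma> a" "beside (- \<sigma>) b" by blast
  \<comment> \<open>\<open>a\<close> and \<open>b\<close> take up both signs, so a point beside
    either side is connected to one of them through \<open>side \<tau> 0\<close>, where \<tau> is
    its sign.\<close>
  have via: ?thesis if r: "conn free p r" "beside 1 r \<or> beside (- 1) r" for r
  proof -
    have "conn free p q" if "beside \<tau> r" "beside \<tau> q" for \<tau> q
      using conn_trans[OF r(1) conn_trans[OF that(1)[unfolded beside_def] conn_sym[OF that(2)[unfolded beside_def]]]] .
    moreover have "beside \<sigma> r \<or> beside (- \<sigma>) r" using r(2) \<sigma>(1) by auto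
    ultimately show ?thesis using \<sigma>(2,3) by blast
  qed
  have straight: "conn free p' q \<or> (\<exists>r. conn free p' r \<and> (beside 1 r \<or> beside (- 1) r))"
    if st: "free p'" "fst p' = fst q \<or> snd p' = snd q" "0 \<le> fst q" "fst q \<le> 3 * n" "0 \<le> snd q" "snd q \<le> 3 * n" for p' q
  proof -
    consider "fst p' = fst q" "snd p' \<le> snd q" | "fst p' = fst q" "snd q \<le> snd p'" |
      "snd p' = snd q" "fst p' \<le> fst q" | "snd p' = snd q" "fst q \<le> fst p'"
      using st(2) linear by blast
    then show ?thesis
    proof cases
      case 1
      show ?thesis
        by (rule walk[OF st(1), where u = "(0, 1)" and s = "snd q - snd p'"]) (use st 1 in \<open>simp_all add: unit_def prod_eq_iff\<close>)
    next
      case 2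
      show ?thesis
        by (rule walk[OF st(1), where u = "(0, - 1)" and s = "snd p' - snd q"]) (use st 2 in \<open>simp_all add: unit_def prod_eq_iff\<close>)
    next
      case 3
      show ?thesis
        by (rule walk[OF st(1), where u = "(1, 0)" and s = "fst q - fst p'"]) (use st 3 in \<open>simp_all add: unit_def prod_eq_iff\<close>)
    next
      case 4
      show ?thesis
        by (rule walk[OF st(1), where u = "(- 1, 0)" and s = "fst p' - fst q"]) (use st 4 in \<open>simp_all add: unit_def prod_eq_iff\<close>)
    qed
  qed
  \<comment> \<open>The corner of the route: in one row with \<open>p\<close> and in one column with
    \<open>a\<close>.\<close>
  let ?q = "(fst a, snd p)"
  have "conn free p ?q \<or> (\<exists>r. conn free p r \<and> (beside 1 r \<or> beside (- 1) r))"
    by (rule straight[OF p]) (use p a in \<open>simp_all add: free_def\<close>)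
  then show ?thesis
  proof (elim disjE exE conjE)
    assume pq: "conn free p ?q"
    then have q: "free ?q" using conn_free[OF pq] by blast
    have "conn free ?q a \<or> (\<exists>r. conn free ?q r \<and> (beside 1 r \<or> beside (- 1) r))"
      by (rule straight[OF q]) (use q a in \<open>simp_all add: free_def\<close>)
    then consider "conn free ?q a" | r where "conn free ?q r" "beside 1 r \<or> beside (- 1) r" by blast
    then show ?thesis
    proof cases
      case 1
      show ?thesis using conn_trans[OF pq 1] ..
    next
      case (2 r)
      show ?thesis by (rule via[OF conn_trans[OF pq 2(1)] 2(2)])
    qed
  next
    fix r assume "conn free p r" "beside 1 r" then show ?thesis using via[of r] by simp
  next
    fix r assume "conn free p r" "beside (- 1) r" then show ?thesis using via[of r] by simp
  qed
qed

end

section \<open>The meaning of the formulas\<close>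

definition pt_at :: "('z::linordered_idom, 'b) struc \<Rightarrow> 'b \<Rightarrow> 'z \<Rightarrow> 'z \<times> 'z \<Rightarrow> bool" where
  "pt_at M Q i p \<longleftrightarrow> mem M (zpair i (zpair (fst p) (snd p))) Q"

definition ed_at :: "('z::linordered_idom, 'b) struc \<Rightarrow> 'b \<Rightarrow> 'z \<Rightarrow> 'z \<times> 'z \<Rightarrow> 'z \<times> 'z \<Rightarrow> bool" where
  "ed_at M E i p q \<longleftrightarrow> mem M (zpair i (zpair (zpair (fst p) (snd p)) (zpair (fst q) (snd q)))) E"

definition pts :: "'z::linordered_idom \<Rightarrow> ('z \<times> 'z) set" where
  "pts n = {p. 0 \<le> fst p \<and> fst p \<le> n \<and> 0 \<le> snd p \<and> snd p \<le> n}"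

definition quadrant :: "('z::linordered_idom \<times> 'z) set" where
  "quadrant = {p. 0 \<le> fst p \<and> 0 \<le> snd p}"

text \<open>The equivalence merges existence and uniqueness in \<open>point_seq\<close>. Competing
  points range over the whole quadrant, since the formula quantifies over all pairs of
  numbers.\<close>

definition pt_seq :: "('z::linordered_idom, 'b) struc \<Rightarrow> 'z \<Rightarrow> 'z \<Rightarrow> 'b \<Rightarrow> bool" where
  "pt_seq M n t Q \<longleftrightarrow> (\<forall>i. 0 \<le> i \<and> i < t \<longrightarrow> (\<exists>p\<in>pts n. \<forall>p'\<in>quadrant. pt_at M Q i p' \<longleftrightarrow> p' = p))"

definition ed_seq :: "('z::linordered_idom, 'b) struc \<Rightarrow> 'z \<Rightarrow> 'z \<Rightarrow> 'b \<Rightarrow> bool" where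
  "ed_seq M n t E \<longleftrightarrow> (\<forall>i. 0 \<le> i \<and> i < t \<longrightarrow> (\<exists>p\<in>pts n. \<exists>q\<in>pts n. adj p q \<and>
     (\<forall>p'\<in>quadrant. \<forall>q'\<in>quadrant. ed_at M E i p' q' \<longleftrightarrow> p' = p \<and> q' = q)))"

definition inc :: "('z::linordered_idom, 'b) struc \<Rightarrow> 'b \<Rightarrow> 'z \<Rightarrow> 'z \<times> 'z \<Rightarrow> bool" where
  "inc M E i p \<longleftrightarrow> (\<exists>q\<in>quadrant. ed_at M E i p q \<or> ed_at M E i q p)"

text \<open>Positive degree, the form in which incidence enters the geometric argument.\<close>

definition touches :: "('z::linordered_idom, 'b) struc \<Rightarrow> 'z \<Rightarrow> 'b \<Rightarrow> 'z \<times> 'z \<Rightarrow> bool" where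
  "touches M t E p \<longleftrightarrow> (\<exists>i. 0 \<le> i \<and> i < t \<and> inc M E i p)"

text \<open>
  The names bound in the formulas start with an underscore; terms without such names keep their
  value under these binders.
\<close>

definition plain :: "ntm \<Rightarrow> bool" where
  "plain s \<longleftrightarrow> lcN s \<and> fvS_ntm s = {} \<and> (\<forall>x\<in>fvN_ntm s. hd x \<noteq> CHR ''_'')"

lemma plain_simps [simp]:
  "plain (NV x) \<longleftrightarrow> hd x \<noteq> CHR ''_''" "plain \<^bold>0" "plain \<^bold>1"
  "plain (s \<^bold>+ u) \<longleftrightarrow> plain s \<and> plain u" "plain (s \<^bold>* u) \<longleftrightarrow> plain s \<and> plain u"
  "\<not> plain (NB k)" "\<not> plain \<^bold>|X\<^bold>|"
  by (auto simp: plain_def, cases X, auto)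

lemma evN_plain [simp]:
  "plain s \<Longrightarrow> evN M (e(CHR ''_'' # x := d)) es bn bs s = evN M e es bn bs s"
  "plain s \<Longrightarrow> evN M e (es(X := S)) bn bs s = evN M e es bn bs s"
  "plain s \<Longrightarrow> evN M e es (case_nat d bn) bs s = evN M e es bn bs s"
  "plain s \<Longrightarrow> evN M e es bn (case_nat S bs) s = evN M e es bn bs s"
  by (induction s) auto

abbreviation evP :: "('a, 'b) struc \<Rightarrow> (string \<Rightarrow> 'a) \<Rightarrow> (string \<Rightarrow> 'b) \<Rightarrow> (nat \<Rightarrow> 'a) \<Rightarrow> (nat \<Rightarrow> 'b) \<Rightarrow> pt \<Rightarrow> 'a \<times> 'a" where
  "evP M e es bn bs p \<equiv> (evN M e es bn bs (fst p), evN M e es bn bs (snd p))"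

lemma adj_iff: "adj (x, y) (u, v) \<longleftrightarrow> x = u \<and> (y + 1 = v \<or> v + 1 = y) \<or> y = v \<and> (x + 1 = u \<or> u + 1 = x)"
  unfolding adj_def unit_def by (auto simp: algebra_simps)

lemma ex_quadrant: "(\<exists>p\<in>quadrant. \<phi> p) \<longleftrightarrow> (\<exists>x\<ge>0. \<exists>y\<ge>0. \<phi> (x, y))"
  and all_quadrant: "(\<forall>p\<in>quadrant. \<phi> p) \<longleftrightarrow> (\<forall>x\<ge>0. \<forall>y\<ge>0. \<phi> (x, y))"
  by (auto simp: quadrant_def)

lemma bounded_atLeast:
  fixes a :: "'a::linorder"
  shows "(\<forall>x\<in>{a..}. \<phi> x) \<longleftrightarrow> (\<forall>x\<ge>a. \<phi> x)" "(\<exists>x\<in>{a..}. \<phi> x) \<longleftrightarrow> (\<exists>x\<ge>a. \<phi> x)"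
  by auto

lemma pts_quadrant: "p \<in> pts n \<longleftrightarrow> p \<in> quadrant \<and> fst p \<le> n \<and> snd p \<le> n"
  by (auto simp: pts_def quadrant_def)

context arith_model
begin

lemma sat_Lt [simp]: "sat M e es bn bs (s \<^bold>< u) \<longleftrightarrow> evN M e es bn bs s < evN M e es bn bs u"
  by (simp add: less_le)

declare sat_connectives(5) [simp del]

lemma evN_pair [simp]: "evN M e es bn bs (pair s u) = zpair (evN M e es bn bs s) (evN M e es bn bs u)"
  by (simp add: pair_def zpair_def)

lemma sat_at [simp]:
  "sat M e es bn bs (point_at Q i p) \<longleftrightarrow> pt_at M (evS es bs Q) (evN M e es bn bs i) (evP M e es bn bs p)"
  "sat M e es bn bs (edge_at Q i p q) \<longleftrightarrow>
     ed_at M (evS es bs Q) (evN M e es bn bs i) (evP M e es bn bs p) (evP M e es bn bs q)"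
  by (simp_all add: point_at_def edge_at_def pt_at_def ed_at_def code_def)

lemma sat_points [simp]:
  "sat M e es bn bs (p \<^bold>=\<^sub>P q) \<longleftrightarrow> evP M e es bn bs p = evP M e es bn bs q"
  "sat M e es bn bs (adjacent p q) \<longleftrightarrow> adj (evP M e es bn bs p) (evP M e es bn bs q)"
  "sat M e es bn bs (in_grid s p) \<longleftrightarrow>
     evN M e es bn bs (fst p) \<le> evN M e es bn bs s \<and> evN M e es bn bs (snd p) \<le> evN M e es bn bs s"
  by (simp_all add: Eq_pt_def adjacent_def in_grid_def adj_iff)

lemma sat_point_seq:
  assumes "plain n" "plain t"
  shows "sat M e es bn bs (point_seq n t (SV Q)) \<longleftrightarrow> pt_seq M (evN M e es bn bs n) (evN M e es bn bs t) (es Q)"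
proof -
  have "sat M e es bn bs (point_seq n t (SV Q)) \<longleftrightarrow>
    (\<forall>i\<ge>0. i < evN M e es bn bs t \<longrightarrow> (\<exists>p\<in>quadrant. pt_at M (es Q) i p \<and>
      (fst p \<le> evN M e es bn bs n \<and> snd p \<le> evN M e es bn bs n) \<and> (\<forall>p'\<in>quadrant. pt_at M (es Q) i p' \<longrightarrow> p' = p)))"
    using assms by (simp add: point_seq_def Let_def ex_quadrant all_quadrant bounded_atLeast)
  also have "\<dots> \<longleftrightarrow> pt_seq M (evN M e es bn bs n) (evN M e es bn bs t) (es Q)"
    unfolding pt_seq_def Bex_def pts_quadrant by blast
  finally show ?thesis .
qed

lemma sat_edge_seq:
  assumes "plain n" "plain t"
  shows "sat M e es bn bs (edge_seq n t (SV E)) \<longleftrightarrow> ed_seq M (evN M e es bn bs n) (evN M e es bn bs t) (es E)"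
proof -
  have "sat M e es bn bs (edge_seq n t (SV E)) \<longleftrightarrow>
    (\<forall>i\<ge>0. i < evN M e es bn bs t \<longrightarrow> (\<exists>p\<in>quadrant. \<exists>q\<in>quadrant. ed_at M (es E) i p q \<and>
      (fst p \<le> evN M e es bn bs n \<and> snd p \<le> evN M e es bn bs n) \<and>
      (fst q \<le> evN M e es bn bs n \<and> snd q \<le> evN M e es bn bs n) \<and> adj p q \<and>
      (\<forall>p'\<in>quadrant. \<forall>q'\<in>quadrant. ed_at M (es E) i p' q' \<longrightarrow> p' = p \<and> q' = q)))"
    using assms by (simp add: edge_seq_def Let_def ex_quadrant all_quadrant bounded_atLeast)
  also have "\<dots> \<longleftrightarrow> ed_seq M (evN M e es bn bs n) (evN M e es bn bs t) (es E)"
  proof -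
    have *: "(\<forall>p'\<in>quadrant. \<forall>q'\<in>quadrant. \<phi> p' q' \<longleftrightarrow> p' = p \<and> q' = q) \<longleftrightarrow>
        \<phi> p q \<and> (\<forall>p'\<in>quadrant. \<forall>q'\<in>quadrant. \<phi> p' q' \<longrightarrow> p' = p \<and> q' = q)"
      if "p \<in> quadrant" "q \<in> quadrant" for p q :: "'z \<times> 'z" and \<phi> using that by blast
    have "(\<exists>p\<in>pts b. \<exists>q\<in>pts b. \<phi> p q) \<longleftrightarrow> (\<exists>p\<in>quadrant. \<exists>q\<in>quadrant.
        (fst p \<le> b \<and> snd p \<le> b) \<and> (fst q \<le> b \<and> snd q \<le> b) \<and> \<phi> p q)" for b :: 'z and \<phi>
      unfolding Bex_def pts_quadrant by blast
    then show ?thesis unfolding ed_seq_def by (simp add: * conj_ac imp_conjL cong: bex_cong)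
  qed
  finally show ?thesis .
qed

lemma evN_avoid:
  assumes "lcN s" "fvS_ntm s = {}"
  shows "x \<notin> fvN_ntm s \<Longrightarrow> evN M (e(x := d)) es bn bs s = evN M e es bn bs s"
    "evN M e es (case_nat d bn) bs s = evN M e es bn bs s"
  using assms evN_lc[OF assms(1)] by (auto intro!: evN_cong[of 0 0])

text \<open>\<open>plain\<close> would be too strong: index and point may be underscore variables
  bound by an enclosing formula such as \<open>degree0\<close> or \<open>avoids_border\<close>. They
  must only avoid the two names bound here.\<close>

lemma sat_incident:
  assumes "lcN i" "lcP a" "fvS_ntm i = {}" "fvS_pt a = {}" "''_bx'' \<notin> fvN_ntm i \<union> fvN_pt a" "''_by'' \<notin> fvN_ntm i \<union> fvN_pt a"
  shows "sat M e es bn bs (incident (SV E) i a) \<longleftrightarrow> inc M (es E) (evN M e es bn bs i) (evP M e es bn bs a)"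
  using assms by (simp add: incident_def inc_def Let_def ex_quadrant bounded_atLeast evN_avoid)

lemma sat_degree0:
  assumes "plain t" "lcP a" "fvS_pt a = {}" "''_bx'' \<notin> fvN_pt a" "''_by'' \<notin> fvN_pt a" "''_i'' \<notin> fvN_pt a"
  shows "sat M e es bn bs (degree0 t (SV E) a) \<longleftrightarrow> \<not> touches M (evN M e es bn bs t) (es E) (evP M e es bn bs a)"
  using assms by (auto simp: degree0_def touches_def Let_def bounded_atLeast sat_incident evN_avoid)

text \<open>Either of the two edge indices supplied by the formula witnesses the contact.\<close>

lemma sat_degree2:
  assumes "plain t" "lcP a" "fvS_pt a = {}" "''_bx'' \<notin> fvN_pt a" "''_by'' \<notin> fvN_pt a" "''_i'' \<notin> fvN_pt a" "''_j'' \<notin> fvN_pt a"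
    and "sat M e es bn bs (degree2 t (SV E) a)"
  shows "touches M (evN M e es bn bs t) (es E) (evP M e es bn bs a)"
proof -
  have "\<exists>i\<ge>0. i < evN M e es bn bs t \<and> inc M (es E) i (evP M e es bn bs a)"
    using assms by (simp add: degree2_def Let_def bounded_atLeast sat_incident evN_avoid) blast
  then show ?thesis by (auto simp: touches_def)
qed

lemma sat_avoids_border:
  assumes "plain n" "plain t"
  shows "sat M e es bn bs (avoids_border n t (SV E)) \<longleftrightarrow>
    (\<forall>p\<in>pts (evN M e es bn bs n). fst p = 0 \<or> fst p = evN M e es bn bs n \<or> snd p = 0 \<or> snd p = evN M e es bn bs n \<longrightarrow>
       \<not> touches M (evN M e es bn bs t) (es E) p)"
proof -
  have *: "(\<forall>p\<in>pts b. \<phi> p) \<longleftrightarrow> (\<forall>x\<ge>0. \<forall>y\<ge>0. x \<le> b \<and> y \<le> b \<longrightarrow> \<phi> (x, y))" for b :: 'z and \<phi>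
    by (auto simp: pts_def)
  show ?thesis unfolding *
    using assms by (simp add: avoids_border_def on_border_def Let_def bounded_atLeast sat_degree0) blast
qed

text \<open>The formula describes the midpoint by doubling it. Together with the difference 2 of the
  ordinates, this places the points at distance 1 above and below it.\<close>

lemma sat_different_sides:
  assumes "plain t" "plain (fst a)" "plain (snd a)" "plain (fst b)" "plain (snd b)"
    and "sat M e es bn bs (different_sides t (SV E) a b)"
  obtains x y where "touches M (evN M e es bn bs t) (es E) (x, y)"
    "\<not> touches M (evN M e es bn bs t) (es E) (evP M e es bn bs a)" "\<not> touches M (evN M e es bn bs t) (es E) (evP M e es bn bs b)"
    "evP M e es bn bs a = (x, y - 1) \<and> evP M e es bn bs b = (x, y + 1) \<or>
     evP M e es bn bs a = (x, y + 1) \<and> evP M e es bn bs b = (x, y - 1)"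
proof -
  have nu: "''_i'' \<notin> fvN_ntm s" "''_j'' \<notin> fvN_ntm s" "''_m'' \<notin> fvN_ntm s" "''_bx'' \<notin> fvN_ntm s" "''_by'' \<notin> fvN_ntm s"
    "lcN s" "fvS_ntm s = {}" if "plain s" for s
    using that unfolding plain_def by (auto dest: bspec)
  note nus = nu[OF assms(2)] nu[OF assms(3)] nu[OF assms(4)] nu[OF assms(5)]
  have S: "evN M e es bn bs (fst a) = evN M e es bn bs (fst b) \<and>
    (evN M e es bn bs (snd a) + 2 = evN M e es bn bs (snd b) \<or> evN M e es bn bs (snd b) + 2 = evN M e es bn bs (snd a)) \<and>
    sat M e es bn bs (degree0 t (SV E) a) \<and> sat M e es bn bs (degree0 t (SV E) b) \<and>
    (\<exists>m\<ge>0. 2 * m = evN M e es bn bs (snd a) + evN M e es bn bs (snd b) \<and>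
      sat M (e(''_m'' := m)) es (case_nat m bn) bs (degree2 t (SV E) (fst a, NV ''_m'')))"
    using assms by (simp add: different_sides_def Let_def bounded_atLeast)
  then have D: "evN M e es bn bs (fst a) = evN M e es bn bs (fst b)"
    "evN M e es bn bs (snd a) + 2 = evN M e es bn bs (snd b) \<or> evN M e es bn bs (snd b) + 2 = evN M e es bn bs (snd a)" by blast+
  have "\<not> touches M (evN M e es bn bs t) (es E) (evP M e es bn bs a)"
    using S by (subst sat_degree0[symmetric]) (use assms(1) nus in simp_all)
  moreover have "\<not> touches M (evN M e es bn bs t) (es E) (evP M e es bn bs b)"
    using S by (subst sat_degree0[symmetric]) (use assms(1) nus in simp_all)
  moreover obtain m where m: "2 * m = evN M e es bn bs (snd a) + evN M e es bn bs (snd b)"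
    "sat M (e(''_m'' := m)) es (case_nat m bn) bs (degree2 t (SV E) (fst a, NV ''_m''))"
    using S by blast
  have "touches M (evN M (e(''_m'' := m)) es (case_nat m bn) bs t) (es E)
      (evP M (e(''_m'' := m)) es (case_nat m bn) bs (fst a, NV ''_m''))"
    by (rule sat_degree2[OF _ _ _ _ _ _ _ m(2)]) (use assms(1) nus in simp_all)
  then have "touches M (evN M e es bn bs t) (es E) (evN M e es bn bs (fst a), m)" using assms(1,2) by simp
  moreover have "evN M e es bn bs (snd a) = m - 1 \<and> evN M e es bn bs (snd b) = m + 1 \<or>
      evN M e es bn bs (snd a) = m + 1 \<and> evN M e es bn bs (snd b) = m - 1"
    using D(2) m(1) by auto
  ultimately show ?thesis using D(1) by (intro that[of "evN M e es bn bs (fst a)" m]) simp_all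
qed

lemma sat_intersect:
  assumes "plain s" "plain t"
  shows "sat M e es bn bs (intersect s (SV R) t (SV E)) \<longleftrightarrow>
    (\<exists>p\<in>quadrant. touches M (evN M e es bn bs s) (es R) p \<and> touches M (evN M e es bn bs t) (es E) p)"
  using assms by (simp add: intersect_def Let_def ex_quadrant bounded_atLeast sat_degree0)

lemma sat_connects:
  assumes "plain n" "plain s" "plain (fst a)" "plain (snd a)" "plain (fst b)" "plain (snd b)" "hd R \<noteq> CHR ''_''"
  shows "sat M e es bn bs (connects n s (SV R) a b) \<longleftrightarrow>
    ed_seq M (evN M e es bn bs n) (evN M e es bn bs s) (es R) \<and>
    (\<exists>Q\<in>DS M. pt_seq M (evN M e es bn bs n) (evN M e es bn bs s + 1) Q \<and>
      pt_at M Q 0 (evP M e es bn bs a) \<and> pt_at M Q (evN M e es bn bs s) (evP M e es bn bs b) \<and>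
      (\<forall>i\<ge>0. \<forall>p\<in>quadrant. \<forall>q\<in>quadrant.
        i < evN M e es bn bs s \<and> pt_at M Q i p \<and> pt_at M Q (i + 1) q \<longrightarrow> ed_at M (es R) i p q))"
proof -
  have "R \<noteq> ''_Q''" using assms(7) by auto
  then show ?thesis using assms
    by (simp add: connects_def Let_def all_quadrant bounded_atLeast sat_point_seq sat_edge_seq)
qed

lemma sat_closed_curve:
  assumes "plain n" "plain t" "hd E \<noteq> CHR ''_''"
  shows "sat M e es bn bs (closed_curve n t (SV E)) \<longleftrightarrow>
    ed_seq M (evN M e es bn bs n) (evN M e es bn bs t) (es E) \<and> 4 \<le> evN M e es bn bs t \<and>
    (\<exists>Q\<in>DS M. pt_seq M (evN M e es bn bs n) (evN M e es bn bs t) Q \<and>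
      (\<forall>i\<ge>0. \<forall>j\<ge>0. i < evN M e es bn bs t \<and> j < evN M e es bn bs t \<and>
        (\<exists>p\<in>quadrant. pt_at M Q i p \<and> pt_at M Q j p) \<longrightarrow> i = j) \<and>
      (\<forall>i\<ge>0. \<forall>p\<in>quadrant. \<forall>q\<in>quadrant.
        i + 1 < evN M e es bn bs t \<and> pt_at M Q i p \<and> pt_at M Q (i + 1) q \<longrightarrow> ed_at M (es E) i p q) \<and>
      (\<forall>i\<ge>0. \<forall>p\<in>quadrant. \<forall>q\<in>quadrant.
        i + 1 = evN M e es bn bs t \<and> pt_at M Q i p \<and> pt_at M Q 0 q \<longrightarrow> ed_at M (es E) i p q))"
proof -
  have "E \<noteq> ''_Q''" using assms(3) by auto
  then show ?thesis using assms
    by (simp add: closed_curve_def Let_def ex_quadrant all_quadrant bounded_atLeast sat_point_seq sat_edge_seq)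
qed

lemma sat_tripled:
  assumes "plain n" "plain t"
  shows "sat M e es bn bs (tripled n t (SV E) (SV E')) \<longleftrightarrow>
    ed_seq M (3 * evN M e es bn bs n) (3 * evN M e es bn bs t) (es E') \<and>
    (\<forall>i\<ge>0. \<forall>x\<ge>0. \<forall>y\<ge>0. \<forall>u\<ge>0. \<forall>v\<ge>0. i < evN M e es bn bs t \<and> ed_at M (es E) i (x, y) (u, v) \<longrightarrow>
      ed_at M (es E') (3 * i) (3 * x, 3 * y) (x + x + u, y + y + v) \<and>
      ed_at M (es E') (3 * i + 1) (x + x + u, y + y + v) (x + u + u, y + v + v) \<and>
      ed_at M (es E') (3 * i + 2) (x + u + u, y + v + v) (3 * u, 3 * v))"
  using assms by (simp add: tripled_def Let_def bounded_atLeast sat_edge_seq)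

end

section \<open>Coded sequences versus functions with definable graph\<close>

context arith_model
begin

lemma mem_zpair:
  "0 \<le> i \<Longrightarrow> p \<in> quadrant \<Longrightarrow> pt_at M Q i p \<longleftrightarrow> zmem M (zpair i (zpair (fst p) (snd p))) Q"
  "0 \<le> i \<Longrightarrow> p \<in> quadrant \<Longrightarrow> q \<in> quadrant \<Longrightarrow>
    ed_at M Q i p q \<longleftrightarrow> zmem M (zpair i (zpair (zpair (fst p) (snd p)) (zpair (fst q) (snd q)))) Q"
  by (simp_all add: pt_at_def ed_at_def zmem_def quadrant_def)

text \<open>Pairing is monotone, so all codes are bounded by the code of the largest components.
  Comprehension up to that bound collects the points in \<open>Q\<close> and the edges in
  \<open>R\<close>.\<close>

lemma path_realized:
  assumes P: "path F g s" and F: "\<And>p. F p \<Longrightarrow> p \<in> pts N"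
  obtains R Q where "R \<in> DS M" "Q \<in> DS M" "ed_seq M N s R" "pt_seq M N (s + 1) Q" "pt_at M Q 0 (g 0)" "pt_at M Q s (g s)"
    "\<forall>i\<ge>0. \<forall>p\<in>quadrant. \<forall>q\<in>quadrant. i < s \<and> pt_at M Q i p \<and> pt_at M Q (i + 1) q \<longrightarrow> ed_at M R i p q"
    "\<And>p. p \<in> quadrant \<Longrightarrow> touches M s R p \<Longrightarrow> F p"
proof -
  have gr: "fgraph g" and s: "0 \<le> s" and Fg: "\<And>i. 0 \<le> i \<Longrightarrow> i \<le> s \<Longrightarrow> F (g i)"
    and ad: "\<And>i. 0 \<le> i \<Longrightarrow> i < s \<Longrightarrow> adj (g i) (g (i + 1))" using P by (auto simp: path_def)
  have g: "g i \<in> pts N" "g i \<in> quadrant" if "0 \<le> i" "i \<le> s" for i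
    using F[OF Fg[OF that]] by (simp_all add: pts_quadrant)
  have N: "0 \<le> N" using g[of 0] s by (auto simp: pts_def)
  let ?\<phi> = "\<lambda>a. zex s (\<lambda>i. zex N (\<lambda>x. zex N (\<lambda>y. grel g i x y \<and> a = zpair i (zpair x y))))"
  let ?\<psi> = "\<lambda>a. zex s (\<lambda>i. i < s \<and> zex N (\<lambda>x. zex N (\<lambda>y. zex N (\<lambda>u. zex N (\<lambda>v.
        grel g i x y \<and> grel g (i + 1) u v \<and> a = zpair i (zpair (zpair x y) (zpair u v)))))))"
  have fdQ: "fdef M (\<lambda>e. ?\<phi> (e 0))"
    by (intro fdefs fdef_grel gr zdef_zpair)
  obtain Q where Q: "Q \<in> DS M" and Qz: "\<And>a. zmem M a Q \<longleftrightarrow> 0 \<le> a \<and> a < zpair s (zpair N N) + 1 \<and>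
      ?\<phi> a"
    using zcomprehension[where \<phi> = ?\<phi>,
      OF fdQ, of "zpair s (zpair N N) + 1"] s N by auto
  have Qi: "pt_at M Q i p \<longleftrightarrow> i \<le> s \<and> g i = p" if ip: "0 \<le> i" "p \<in> quadrant" for i p
  proof
    assume "pt_at M Q i p"
    then obtain j x y where "0 \<le> j" "j \<le> s" "grel g j x y" "zpair i (zpair (fst p) (snd p)) = zpair j (zpair x y)"
      unfolding mem_zpair(1)[OF ip] Qz zex_def by blast
    moreover from this have "i = j \<and> fst p = x \<and> snd p = y" using ip by (simp add: quadrant_def grel_def)
    ultimately show "i \<le> s \<and> g i = p" by (auto simp: grel_def)
  next
    assume *: "i \<le> s \<and> g i = p"
    then have p: "0 \<le> fst p" "fst p \<le> N" "0 \<le> snd p" "snd p \<le> N" using g[of i] ip by (auto simp: pts_def)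
    have "zpair i (zpair (fst p) (snd p)) \<le> zpair s (zpair N N)"
      using p ip * by (intro zpair_mono) auto
    moreover have "?\<phi> (zpair i (zpair (fst p) (snd p)))"
      unfolding zex_def using p ip *
      by (intro exI[of _ i] exI[of _ "fst p"] exI[of _ "snd p"] conjI) (simp_all add: grel_def)
    ultimately show "pt_at M Q i p" unfolding mem_zpair(1)[OF ip] Qz using p ip by (simp add: zless_iff)
  qed
  have fdR: "fdef M (\<lambda>e. ?\<psi> (e 0))"
    by (intro fdefs fdef_grel gr zdef_zpair)
  obtain R where R: "R \<in> DS M" and Rz: "\<And>a. zmem M a R \<longleftrightarrow> 0 \<le> a \<and> a < zpair s (zpair (zpair N N) (zpair N N)) + 1 \<and>
      ?\<psi> a"
    using zcomprehension[where \<phi> = ?\<psi>,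
      OF fdR, of "zpair s (zpair (zpair N N) (zpair N N)) + 1"] s N by auto
  have Ri: "ed_at M R i p q \<longleftrightarrow> i < s \<and> g i = p \<and> g (i + 1) = q" if ip: "0 \<le> i" "p \<in> quadrant" "q \<in> quadrant" for i p q
  proof
    assume "ed_at M R i p q"
    then obtain j x y u v where "0 \<le> j" "j < s" "grel g j x y" "grel g (j + 1) u v"
      "zpair i (zpair (zpair (fst p) (snd p)) (zpair (fst q) (snd q))) = zpair j (zpair (zpair x y) (zpair u v))"
      unfolding mem_zpair(2)[OF ip] Rz zex_def by blast
    moreover from this have "i = j \<and> fst p = x \<and> snd p = y \<and> fst q = u \<and> snd q = v"
      using ip by (simp add: quadrant_def grel_def)
    ultimately show "i < s \<and> g i = p \<and> g (i + 1) = q" by (auto simp: grel_def)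
  next
    assume *: "i < s \<and> g i = p \<and> g (i + 1) = q"
    then have i1: "0 \<le> i + 1" "i + 1 \<le> s" using ip by (auto simp: zless_iff)
    have p: "0 \<le> fst p" "fst p \<le> N" "0 \<le> snd p" "snd p \<le> N" "0 \<le> fst q" "fst q \<le> N" "0 \<le> snd q" "snd q \<le> N"
      using g(1)[of i] g(1)[OF i1] ip * by (auto simp: pts_def)
    have "zpair i (zpair (zpair (fst p) (snd p)) (zpair (fst q) (snd q))) \<le> zpair s (zpair (zpair N N) (zpair N N))"
      using p ip * by (intro zpair_mono zpair_nonneg) auto
    moreover have "?\<psi> (zpair i (zpair (zpair (fst p) (snd p)) (zpair (fst q) (snd q))))"
      unfolding zex_def using p ip * i1
      by (intro exI[of _ i] exI[of _ "fst p"] exI[of _ "snd p"] exI[of _ "fst q"] exI[of _ "snd q"] conjI) (simp_all add: grel_def)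
    ultimately show "ed_at M R i p q" unfolding mem_zpair(2)[OF ip] Rz using p ip by (simp add: zless_iff)
  qed
  show ?thesis
  proof (rule that[OF R Q])
    show "ed_seq M N s R" unfolding ed_seq_def
    proof (intro allI impI)
      fix i assume i: "0 \<le> i \<and> i < s"
      then have i1: "0 \<le> i + 1" "i + 1 \<le> s" by (auto simp: zless_iff)
      show "\<exists>p\<in>pts N. \<exists>q\<in>pts N. adj p q \<and> (\<forall>p'\<in>quadrant. \<forall>q'\<in>quadrant. ed_at M R i p' q' \<longleftrightarrow> p' = p \<and> q' = q)"
        using i Ri ad[of i] g(1)[OF i1] g(1)[of i] by (intro bexI[of _ "g i"] bexI[of _ "g (i + 1)"]) auto
    qed
    show "pt_seq M N (s + 1) Q" unfolding pt_seq_def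
    proof (intro allI impI)
      fix i assume "0 \<le> i \<and> i < s + 1"
      then have i: "0 \<le> i" "i \<le> s" by (auto simp: zless_iff)
      then show "\<exists>p\<in>pts N. \<forall>p'\<in>quadrant. pt_at M Q i p' \<longleftrightarrow> p' = p"
        using Qi g by (intro bexI[of _ "g i"]) auto
    qed
    show "pt_at M Q 0 (g 0)" "pt_at M Q s (g s)" using Qi g(2) s by simp_all
    show "\<forall>i\<ge>0. \<forall>p\<in>quadrant. \<forall>q\<in>quadrant. i < s \<and> pt_at M Q i p \<and> pt_at M Q (i + 1) q \<longrightarrow> ed_at M R i p q"
      using Qi Ri by simp
    show "F p" if p: "p \<in> quadrant" and "touches M s R p" for p
    proof -
      obtain i q where i: "0 \<le> i" "i < s" "q \<in> quadrant" "ed_at M R i p q \<or> ed_at M R i q p"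
        using \<open>touches M s R p\<close> unfolding touches_def inc_def by blast
      then have "p = g i \<or> p = g (i + 1)" using Ri[OF i(1) p i(3)] Ri[OF i(1,3) p] by blast
      moreover have "0 \<le> i + 1" "i + 1 \<le> s" using i by (auto simp: zless_iff)
      ultimately show ?thesis using Fg[of i] Fg[of "i + 1"] i by auto
    qed
  qed
qed

lemma ed_seq_unique:
  assumes "ed_seq M n t E" "0 \<le> i" "i < t" "p \<in> quadrant" "q \<in> quadrant" "ed_at M E i p q"
  shows "p \<in> pts n \<and> q \<in> pts n \<and> adj p q"
    and "p' \<in> quadrant \<Longrightarrow> q' \<in> quadrant \<Longrightarrow> ed_at M E i p' q' \<Longrightarrow> p' = p \<and> q' = q"
proof -
  obtain a b where "a \<in> pts n" "b \<in> pts n" "adj a b" and *: "\<forall>p'\<in>quadrant. \<forall>q'\<in>quadrant. ed_at M E i p' q' \<longleftrightarrow> p' = a \<and> q' = b"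
    using assms(1-3) unfolding ed_seq_def by blast
  moreover from * have "p = a" "q = b" using assms(4-6) by simp_all
  ultimately show "p \<in> pts n \<and> q \<in> pts n \<and> adj p q"
    "p' \<in> quadrant \<Longrightarrow> q' \<in> quadrant \<Longrightarrow> ed_at M E i p' q' \<Longrightarrow> p' = p \<and> q' = q" by simp_all
qed

lemma curve_of_sequence:
  assumes P: "ed_seq M n t P" and t: "4 \<le> t" and Q: "Q \<in> DS M" "pt_seq M n t Q"
    and distinct: "\<forall>i\<ge>0. \<forall>j\<ge>0. i < t \<and> j < t \<and> (\<exists>p\<in>quadrant. pt_at M Q i p \<and> pt_at M Q j p) \<longrightarrow> i = j"
    and edges: "\<forall>i\<ge>0. \<forall>p\<in>quadrant. \<forall>q\<in>quadrant. i + 1 < t \<and> pt_at M Q i p \<and> pt_at M Q (i + 1) q \<longrightarrow> ed_at M P i p q"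
    and last: "\<forall>i\<ge>0. \<forall>p\<in>quadrant. \<forall>q\<in>quadrant. i + 1 = t \<and> pt_at M Q i p \<and> pt_at M Q 0 q \<longrightarrow> ed_at M P i p q"
    and border: "\<forall>p\<in>pts n. fst p = 0 \<or> fst p = n \<or> snd p = 0 \<or> snd p = n \<longrightarrow> \<not> touches M t P p"
  obtains c where "curve M n t c" "\<And>i. 0 \<le> i \<Longrightarrow> i < t \<Longrightarrow> ed_at M P i (c i) (c (i + 1))"
proof -
  have "\<exists>p. p \<in> pts n \<and> (\<forall>p'\<in>quadrant. pt_at M Q i p' \<longleftrightarrow> p' = p)" if "0 \<le> i" "i < t" for i
    using Q(2) that unfolding pt_seq_def by blast
  then obtain d where d: "\<And>i. 0 \<le> i \<Longrightarrow> i < t \<Longrightarrow> d i \<in> pts n \<and> (\<forall>p'\<in>quadrant. pt_at M Q i p' \<longleftrightarrow> p' = d i)"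
    by metis
  \<comment> \<open>The constant continuation from \<open>t\<close> on gives
    \<open>c t = c 0\<close> and keeps all later values inside the grid, as the locale
    demands.\<close>
  define c where "c i = d (if i < t then i else 0)" for i
  have c: "c i = d i" if "i < t" for i using that by (simp add: c_def)
  have ct: "c i = c 0" if "t \<le> i" for i using that t by (simp add: c_def)
  have cQ: "c i \<in> pts n" "c i \<in> quadrant" "pt_at M Q i p \<longleftrightarrow> p = c i" if "0 \<le> i" "i < t" "p \<in> quadrant" for i p
    using d[OF that(1,2)] that(3) by (simp_all add: c that pts_quadrant)
  have c_in: "c i \<in> pts n" "c i \<in> quadrant" if "0 \<le> i" for i
    using d[of "if i < t then i else 0"] that t by (auto simp: c_def pts_quadrant)
  have ptc: "pt_at M Q i (c i)" if "0 \<le> i" "i < t" for i using cQ(3)[OF that c_in(2)[OF that(1)]] by simp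
  have ed: "ed_at M P i (c i) (c (i + 1))" if i: "0 \<le> i" "i < t" for i
  proof -
    consider "i + 1 < t" | "i + 1 = t" using i zless_iff[of i t] by force
    then show ?thesis
    proof cases
      case 1
      then show ?thesis using edges ptc[OF i] ptc[of "i + 1"] c_in[of i] c_in[of "i + 1"] i by simp
    next
      case 2
      then have "c (i + 1) = c 0" by (simp add: ct)
      then show ?thesis using last 2 ptc[OF i] ptc[of 0] c_in[of i] c_in[of 0] i t by simp
    qed
  qed
  have "curve M n t c"
  proof (unfold_locales)
    show "fgraph c"
    proof (rule fgraphI)
      show "fdef M (\<lambda>e. if e 0 < t then zmem M (zpair (e 0) (zpair (e 1) (e 2))) Q else zmem M (zpair 0 (zpair (e 1) (e 2))) Q)"
        by (intro fdefs zdef_zpair Q(1))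
      show "c i = (x, y) \<longleftrightarrow> (if i < t then zmem M (zpair i (zpair x y)) Q else zmem M (zpair 0 (zpair x y)) Q)"
        if "0 \<le> i" "0 \<le> x" "0 \<le> y" for i x y
      proof -
        have p: "(x, y) \<in> quadrant" using that by (simp add: quadrant_def)
        show ?thesis
        proof (cases "i < t")
          case True
          then show ?thesis using cQ(3)[OF that(1) True p] mem_zpair(1)[OF that(1) p, of Q] by auto
        next
          case False
          then show ?thesis using cQ(3)[OF _ _ p, of 0] mem_zpair(1)[OF _ p, of 0 Q] t ct[of i] by auto
        qed
      qed
    qed
    show "4 \<le> t" by (rule t)
    show "c t = c 0" by (rule ct) simp
    show "i = j" if "0 \<le> i" "i < t" "0 \<le> j" "j < t" "c i = c j" for i j
      using distinct ptc[of i] ptc[of j] c_in[of i] that by metis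
    show "adj (c i) (c (i + 1))" if "0 \<le> i" "i < t" for i
      using ed_seq_unique(1)[OF P that c_in(2) c_in(2) ed[OF that]] that by simp
    show "1 \<le> fst (c i) \<and> fst (c i) + 1 \<le> n \<and> 1 \<le> snd (c i) \<and> snd (c i) + 1 \<le> n" if "0 \<le> i" for i
    proof -
      have *: "1 \<le> fst (c i) \<and> fst (c i) + 1 \<le> n \<and> 1 \<le> snd (c i) \<and> snd (c i) + 1 \<le> n" if i: "0 \<le> i" "i < t" for i
      proof -
        \<comment> \<open>Every vertex is an end point of an edge, hence not on the border;
          discreteness turns this into a margin of 1.\<close>
        have "touches M t P (c i)" unfolding touches_def inc_def
          using ed[OF i] c_in(2)[of "i + 1"] i by (intro exI[of _ i]) auto
        then have "fst (c i) \<noteq> 0" "fst (c i) \<noteq> n" "snd (c i) \<noteq> 0" "snd (c i) \<noteq> n"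
          using border c_in(1)[OF i(1)] by blast+
        then show ?thesis using c_in(1)[OF i(1)] zless_iff[of 0 "fst (c i)"] zless_iff[of "fst (c i)" n]
          zless_iff[of 0 "snd (c i)"] zless_iff[of "snd (c i)" n] by (auto simp: pts_def)
      qed
      show ?thesis
      proof (cases "i < t")
        case False
        then show ?thesis using *[of 0] t ct[of i] by simp
      qed (use * that in blast)
    qed
  qed
  then show ?thesis using that ed by blast
qed

end

text \<open>\<open>A\<close>, \<open>B\<close>, \<open>C\<close> are the starting points of the
  three unit edges replacing an edge. Division of an edge index by 3 finds edge and third, and
  uniqueness of the coded edge then identifies its end points; the end of the last third is the next
  vertex.\<close>

lemma (in curve) on_curve_iff_touches:
  assumes P: "\<And>i. 0 \<le> i \<Longrightarrow> i < t \<Longrightarrow> ed_at M P i (c i) (c (i + 1))" and P': "ed_seq M (3 * n) (3 * t) P'"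
    and tripled: "\<forall>i\<ge>0. \<forall>x\<ge>0. \<forall>y\<ge>0. \<forall>u\<ge>0. \<forall>v\<ge>0. i < t \<and> ed_at M P i (x, y) (u, v) \<longrightarrow>
      ed_at M P' (3 * i) (3 * x, 3 * y) (x + x + u, y + y + v) \<and>
      ed_at M P' (3 * i + 1) (x + x + u, y + y + v) (x + u + u, y + v + v) \<and>
      ed_at M P' (3 * i + 2) (x + u + u, y + v + v) (3 * u, 3 * v)"
    and p: "p \<in> quadrant"
  shows "on_curve p \<longleftrightarrow> touches M (3 * t) P' p"
proof -
  define A where "A i = (3 * X i, 3 * Y i)" for i
  define B where "B i = (X i + X i + X (i + 1), Y i + Y i + Y (i + 1))" for i
  define C where "C i = (X i + X (i + 1) + X (i + 1), Y i + Y (i + 1) + Y (i + 1))" for i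
  have on: "on_curve q \<longleftrightarrow> (\<exists>i. 0 \<le> i \<and> i < t \<and> (q = A i \<or> q = B i \<or> q = C i))" for q
    by (simp add: on_curve_def A_def B_def C_def DX_def DY_def algebra_simps)
  have nonneg: "0 \<le> X i" "0 \<le> Y i" if "0 \<le> i" for i using bounds[OF that] by linarith+
  have quad: "A i \<in> quadrant" "B i \<in> quadrant" "C i \<in> quadrant" "A (i + 1) \<in> quadrant" if "0 \<le> i" for i
    using nonneg[OF that] nonneg[of "i + 1"] that by (simp_all add: A_def B_def C_def quadrant_def)
  have ed: "ed_at M P' (3 * i) (A i) (B i)" "ed_at M P' (3 * i + 1) (B i) (C i)" "ed_at M P' (3 * i + 2) (C i) (A (i + 1))"
    if i: "0 \<le> i" "i < t" for i
  proof -
    have "ed_at M P i (X i, Y i) (X (i + 1), Y (i + 1))" using P[OF i] by (simp add: X_def Y_def)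
    then show "ed_at M P' (3 * i) (A i) (B i)" "ed_at M P' (3 * i + 1) (B i) (C i)" "ed_at M P' (3 * i + 2) (C i) (A (i + 1))"
      using tripled i nonneg[OF i(1)] nonneg[of "i + 1"] unfolding A_def B_def C_def by simp_all
  qed
  have idx: "3 * i < 3 * t" "3 * i + 1 < 3 * t" "3 * i + 2 < 3 * t" if "i < t" for i
    using that zless_iff[of i t] by linarith+
  show ?thesis
  proof
    assume "on_curve p"
    then obtain i where i: "0 \<le> i" "i < t" and "p = A i \<or> p = B i \<or> p = C i" using on by blast
    then have "inc M P' (3 * i) p \<or> inc M P' (3 * i + 1) p"
      unfolding inc_def using ed[OF i] quad[OF i(1)] by blast
    moreover have "0 \<le> 3 * i" "0 \<le> 3 * i + 1" using i(1) by simp_all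
    ultimately show "touches M (3 * t) P' p" unfolding touches_def using idx[OF i(2)] by blast
  next
    assume "touches M (3 * t) P' p"
    then obtain k q where k: "0 \<le> k" "k < 3 * t" and q: "q \<in> quadrant" "ed_at M P' k p q \<or> ed_at M P' k q p"
      unfolding touches_def inc_def by blast
    obtain i where i: "0 \<le> i" "i \<le> k" "3 * i \<le> k" "k < 3 * (i + 1)" using div_exists[OF k(1), of 3] by auto
    have it: "i < t" using i(3) k(2) by simp
    note u = ed_seq_unique(2)[OF P']
    have step: "a = k \<or> a + 1 \<le> k" if "a \<le> k" for a using that zless_iff[of a k] by auto
    have "k = 3 * i \<or> k = 3 * i + 1 \<or> k = 3 * i + 2"
      using i(3,4) step[of "3 * i"] step[of "3 * i + 1"] step[of "3 * i + 2"]
      unfolding distrib_left by (simp add: add.assoc) linarith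
    then have "p = A i \<or> p = B i \<or> p = C i \<or> p = A (i + 1)"
    proof (elim disjE)
      assume k: "k = 3 * i"
      show ?thesis
        using u[OF _ _ quad(1)[OF i(1)] quad(2)[OF i(1)] ed(1)[OF i(1) it], of p q] u[OF _ _ quad(1)[OF i(1)] quad(2)[OF i(1)] ed(1)[OF i(1) it], of q p] idx[OF it] i(1) p q k by auto
    next
      assume k: "k = 3 * i + 1"
      show ?thesis
        using u[OF _ _ quad(2)[OF i(1)] quad(3)[OF i(1)] ed(2)[OF i(1) it], of p q] u[OF _ _ quad(2)[OF i(1)] quad(3)[OF i(1)] ed(2)[OF i(1) it], of q p] idx[OF it] i(1) p q k by auto
    next
      assume k: "k = 3 * i + 2"
      show ?thesis
        using u[OF _ _ quad(3)[OF i(1)] quad(4)[OF i(1)] ed(3)[OF i(1) it], of p q] u[OF _ _ quad(3)[OF i(1)] quad(4)[OF i(1)] ed(3)[OF i(1) it], of q p] idx[OF it] i(1) p q k by auto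
    qed
    moreover have "on_curve (A (i + 1))" unfolding A_def using i(1) it zless_iff[of i t] by (intro on_vertex) auto
    ultimately show "on_curve p" using on i(1) it by blast
  qed
qed

context arith_model
begin

lemma jct_matrix:
  fixes e :: "string \<Rightarrow> 'z" and es :: "string \<Rightarrow> 'b"
  defines "n \<equiv> NV ''n''" and "t \<equiv> NV ''t''" and "P \<equiv> SV ''P''" and "P' \<equiv> SV ''P3''"
    and "p1 \<equiv> (NV ''x1'', NV ''y1'')" and "p2 \<equiv> (NV ''x2'', NV ''y2'')" and "p \<equiv> (NV ''x'', NV ''y'')"
    and "s \<equiv> NV ''s''" and "R \<equiv> SV ''R''"
  assumes e: "e ''x1'' \<ge> 0" "e ''y1'' \<ge> 0" "e ''x2'' \<ge> 0" "e ''y2'' \<ge> 0" "e ''x'' \<ge> 0" "e ''y'' \<ge> 0"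
    and 1: "sat M e es bn bs (closed_curve n t P)" and 2: "sat M e es bn bs (avoids_border n t P)"
    and 3: "sat M e es bn bs (tripled n t P P')"
    and 4: "sat M e es bn bs (in_grid (thrice n) p1)" "sat M e es bn bs (in_grid (thrice n) p2)"
    and 5: "sat M e es bn bs (different_sides (thrice t) P' p1 p2)"
    and 6: "sat M e es bn bs (in_grid (thrice n) p)" "sat M e es bn bs (degree0 (thrice t) P' p)"
  shows "sat M e es bn bs (\<^bold>\<exists>\<^sub>N[''s'']. \<^bold>\<exists>\<^sub>S[''R''].
    (connects (thrice n) s R p p1 \<^bold>\<or> connects (thrice n) s R p p2) \<^bold>\<and> \<^bold>\<not> intersect s R (thrice t) P')"
proof -
  let ?n = "e ''n''" and ?t = "e ''t''" and ?P = "es ''P''" and ?P' = "es ''P3''"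
    and ?p = "(e ''x'', e ''y'')" and ?p1 = "(e ''x1'', e ''y1'')" and ?p2 = "(e ''x2'', e ''y2'')"
  note defs = n_def t_def P_def P'_def p1_def p2_def p_def s_def R_def
  obtain Q where "ed_seq M ?n ?t ?P" "4 \<le> ?t" "Q \<in> DS M" "pt_seq M ?n ?t Q"
    "\<forall>i\<ge>0. \<forall>j\<ge>0. i < ?t \<and> j < ?t \<and> (\<exists>p\<in>quadrant. pt_at M Q i p \<and> pt_at M Q j p) \<longrightarrow> i = j"
    "\<forall>i\<ge>0. \<forall>p\<in>quadrant. \<forall>q\<in>quadrant. i + 1 < ?t \<and> pt_at M Q i p \<and> pt_at M Q (i + 1) q \<longrightarrow> ed_at M ?P i p q"
    "\<forall>i\<ge>0. \<forall>p\<in>quadrant. \<forall>q\<in>quadrant. i + 1 = ?t \<and> pt_at M Q i p \<and> pt_at M Q 0 q \<longrightarrow> ed_at M ?P i p q"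
    using 1 unfolding defs by (subst (asm) sat_closed_curve) (simp_all, blast)
  moreover have "\<forall>p\<in>pts ?n. fst p = 0 \<or> fst p = ?n \<or> snd p = 0 \<or> snd p = ?n \<longrightarrow> \<not> touches M ?t ?P p"
    using 2 unfolding defs by (subst (asm) sat_avoids_border) simp_all
  ultimately have "\<exists>c. curve M ?n ?t c \<and> (\<forall>i. 0 \<le> i \<longrightarrow> i < ?t \<longrightarrow> ed_at M ?P i (c i) (c (i + 1)))"
    by (rule curve_of_sequence) blast
  then obtain c where "curve M ?n ?t c" and cP: "\<And>i. 0 \<le> i \<Longrightarrow> i < ?t \<Longrightarrow> ed_at M ?P i (c i) (c (i + 1))"
    by blast
  interpret curve M ?n ?t c by fact
  have T: "ed_seq M (3 * ?n) (3 * ?t) ?P'"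
    "\<forall>i\<ge>0. \<forall>x\<ge>0. \<forall>y\<ge>0. \<forall>u\<ge>0. \<forall>v\<ge>0. i < ?t \<and> ed_at M ?P i (x, y) (u, v) \<longrightarrow>
      ed_at M ?P' (3 * i) (3 * x, 3 * y) (x + x + u, y + y + v) \<and>
      ed_at M ?P' (3 * i + 1) (x + x + u, y + y + v) (x + u + u, y + v + v) \<and>
      ed_at M ?P' (3 * i + 2) (x + u + u, y + v + v) (3 * u, 3 * v)"
    using 3 unfolding defs by (subst (asm) sat_tripled; simp)+
  have on: "on_curve q \<longleftrightarrow> touches M (3 * ?t) ?P' q" if "q \<in> quadrant" for q
    by (rule on_curve_iff_touches[OF _ T that]) (rule cP)
  have quad: "?p \<in> quadrant" "?p1 \<in> quadrant" "?p2 \<in> quadrant" using e by (simp_all add: quadrant_def)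
  have grid: "?p \<in> pts (3 * ?n)" "?p1 \<in> pts (3 * ?n)" "?p2 \<in> pts (3 * ?n)"
    using 4 6(1) e unfolding defs by (simp_all add: pts_def)
  have "\<not> touches M (3 * ?t) ?P' ?p"
    using 6(2) unfolding defs by (subst (asm) sat_degree0) simp_all
  then have free_p: "free ?p" using grid(1) on[OF quad(1)] by (simp add: free_def pts_def)
  obtain x y where w: "touches M (3 * ?t) ?P' (x, y)" and a: "\<not> touches M (3 * ?t) ?P' ?p1" "\<not> touches M (3 * ?t) ?P' ?p2"
    and xy: "?p1 = (x, y - 1) \<and> ?p2 = (x, y + 1) \<or> ?p1 = (x, y + 1) \<and> ?p2 = (x, y - 1)"
    by (rule sat_different_sides[OF _ _ _ _ _ 5[unfolded defs]]) simp_all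
  have "(x, y) \<in> quadrant" using xy e by (auto simp: quadrant_def)
  then have "on_curve (x, y)" using on w by blast
  moreover have "free ?p1" "free ?p2" using a grid on[OF quad(2)] on[OF quad(3)] by (simp_all add: free_def pts_def)
  ultimately have "conn free ?p ?p1 \<or> conn free ?p ?p2"
    using separation[OF free_p, of x y ?p1 ?p2] xy by blast
  \<comment> \<open>The target is kept as a pair of terms, so that the two alternatives are
    translated together.\<close>
  then obtain b g l where b: "b = p1 \<or> b = p2" and g: "path free g l" "g 0 = ?p" "g l = evP M e es bn bs b"
    unfolding conn_def defs by fastforce
  have "free q \<Longrightarrow> q \<in> pts (3 * ?n)" for q by (simp add: free_def pts_def)
  then obtain S Q where S: "S \<in> DS M" "Q \<in> DS M" "ed_seq M (3 * ?n) l S" "pt_seq M (3 * ?n) (l + 1) Q" "pt_at M Q 0 (g 0)" "pt_at M Q l (g l)"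
    "\<forall>i\<ge>0. \<forall>p\<in>quadrant. \<forall>q\<in>quadrant. i < l \<and> pt_at M Q i p \<and> pt_at M Q (i + 1) q \<longrightarrow> ed_at M S i p q"
    "\<And>p. p \<in> quadrant \<Longrightarrow> touches M l S p \<Longrightarrow> free p"
    using path_realized[OF g(1)] by metis
  let ?e = "e(''s'' := l)" and ?es = "es(''R'' := S)" and ?bn = "case_nat l bn" and ?bs = "case_nat S bs"
  have "sat M ?e ?es ?bn ?bs (connects (thrice n) s R p b)"
    using b unfolding defs
    by (elim disjE) (subst sat_connects; use S g in \<open>auto simp: p1_def p2_def intro!: bexI[of _ Q]\<close>)+
  then have "sat M ?e ?es ?bn ?bs (connects (thrice n) s R p p1 \<^bold>\<or> connects (thrice n) s R p p2)" using b by auto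
  moreover have "\<not> sat M ?e ?es ?bn ?bs (intersect s R (thrice t) P')"
  proof -
    have "\<not> (\<exists>p\<in>quadrant. touches M l S p \<and> touches M (3 * ?t) ?P' p)"
      using S(8) on unfolding free_def by blast
    then show ?thesis unfolding defs by (subst sat_intersect) simp_all
  qed
  moreover have "0 \<le> l" using g(1) by (simp add: path_def)
  ultimately show ?thesis using S(1) by auto
qed

text \<open>Strips the quantifier prefix one name at a time and leaves the matrix folded, in the
  shape that \<open>jct_matrix\<close> expects.\<close>

lemma sat_ALL:
  "sat M e es bn bs (foldr alln [] A) \<longleftrightarrow> sat M e es bn bs A"
  "sat M e es bn bs (foldr alln (x # xs) A) \<longleftrightarrow> (\<forall>d\<in>DN M. sat M (e(x := d)) es (case_nat d bn) bs (foldr alln xs A))"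
  "sat M e es bn bs (foldr alls [] A) \<longleftrightarrow> sat M e es bn bs A"
  "sat M e es bn bs (foldr alls (x # xs) A) \<longleftrightarrow> (\<forall>d\<in>DS M. sat M e (es(x := d)) bn (case_nat d bs) (foldr alls xs A))"
  by simp_all

theorem models_jct: "models M {jct}"
  unfolding models_def
proof (intro conjI ballI allI impI)
  show "struc_ok M" using V0 by (simp add: models_def)
  fix A bn bs and e :: "string \<Rightarrow> 'z" and es :: "string \<Rightarrow> 'b"
  assume "A \<in> {jct}" and e: "\<forall>x. e x \<in> DN M" and es: "\<forall>X. es X \<in> DS M"
  then have "A = jct" by simp
  show "sat M e es bn bs A"
    unfolding \<open>A = jct\<close> jct_def Let_def sat_ALL sat.simps(6) sat_connectives(3)
    by (intro ballI impI, elim conjE, rule jct_matrix) (use e in simp_all)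
qed

end

theorem theorem4p9:
  shows "V0 \<^bold>\<turnstile>
    (let n = NV ''n''; t = NV ''t''; P = SV ''P''; P' = SV ''P3'';
         p1 = (NV ''x1'', NV ''y1''); p2 = (NV ''x2'', NV ''y2''); p = (NV ''x'', NV ''y'');
         s = NV ''s''; R = SV ''R'' in
     \<^bold>\<forall>\<^sub>N[''n'', ''t'']. \<^bold>\<forall>\<^sub>S[''P'', ''P3'']. \<^bold>\<forall>\<^sub>N[''x1'', ''y1'', ''x2'', ''y2'', ''x'', ''y''].
       closed_curve n t P \<^bold>\<and> avoids_border n t P \<^bold>\<and> tripled n t P P' \<^bold>\<and>
       in_grid (thrice n) p1 \<^bold>\<and> in_grid (thrice n) p2 \<^bold>\<and>
       different_sides (thrice t) P' p1 p2 \<^bold>\<and>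
       in_grid (thrice n) p \<^bold>\<and> degree0 (thrice t) P' p \<^bold>\<longrightarrow>
       (\<^bold>\<exists>\<^sub>N[''s'']. \<^bold>\<exists>\<^sub>S[''R''].
         (connects (thrice n) s R p p1 \<^bold>\<or> connects (thrice n) s R p p2) \<^bold>\<and>
         \<^bold>\<not> intersect s R (thrice t) P'))"
proof -
  \<comment> \<open>The abstract results are instantiated with the integers over the fixed
    countermodel, where validity yields provability.\<close>
  interpret arith_model MZ
    by unfold_locales (rule MZ, simp_all add: MZ_def vint_discrete)
  show ?thesis using jct_if_MZ[OF models_jct] by (simp only: jct_def)
qed

end
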